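(* Consider the random design regression model $Y_i=f(X_i)+\varepsilon_i$, $1\le i\le n$, and let $\hat f$ be the warped-wavelet Bayesian (posterior median) estimator $$\hat f(x)=\sum_{j\le J}\sum_{k}\tilde\beta_{jk}\,\psi_{jk}(G(x))$$ built with the hyperparameters $\tau_j^2=c_1 2^{-j\alpha}$ and $\pi_j=\min(1,c_2 2^{-j\beta})$, where $\alpha,\beta\ge 0$ and $c_1,c_2>0$ are constants, and with $J:=J_\alpha$ given by $2^{J_\alpha}=(3/(2n))^{-1/\alpha}$. Let $0<s<r$ and $R>0$. If $\alpha>1$ and $\alpha\ge s$, then, as $n\to\infty$, $$\sup_{f\circ G^{-1}\in B^{s}_{2,\infty}(R)}\mathbb{E}\|\hat f-f\|_2^2=\mathcal{O}\big((1/n)^{1-1/\alpha}\log^2(n)\big)+\mathcal{O}\big((1/n)^{2s/\alpha}\big).$$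
   Context: Model. One observes independent, identically distributed pairs $(X_i,Y_i)$, $i=1,\dots,n$, with $Y_i=f(X_i)+\varepsilon_i$, where $f$ is an unknown function on $[0,1]$, the $\varepsilon_i$ are independent $N(0,\sigma^2)$ variables ($0<\sigma^2<\infty$), independent of the $X_i$, and the $X_i$ take values in $[0,1]$ with a known density $g$ satisfying $g\ge m_g$ for some constant $m_g>0$. Put $G(x)=\int_0^x g(t)\,dt$; $G$ is a known, continuous, strictly monotone function from $[0,1]$ to $[0,1]$. Wavelets. $\phi,\psi$ are compactly supported father and mother wavelets, $\psi$ having $r$ vanishing moments; $\{\psi_{jk}: j\ge -1,\ 0\le k\le 2^j-1\}$ is the associated periodic orthonormal wavelet basis of $\mathbb{L}_2[0,1]$, where for $j\ge 0$ $\psi_{jk}$ is the periodization of $2^{j/2}\psi(2^jx-k)$, and $\psi_{-1,k}=\phi_{0,k}$ denotes the scaling function (a single index $k=0$ at level $j=-1$). The warped coefficients of $f$ are $$\beta_{jk}=\int_0^1 f(G^{-1}(x))\psi_{jk}(x)\,dx=\int_0^1 f(x)\psi_{jk}(G(x))g(x)\,dx,$$ so that $f(x)=\sum_{j\ge-1}\sum_k\beta_{jk}\psi_{jk}(G(x))$. $\|\cdot\|_2$ is the norm of $\mathbb{L}_2[0,1]$ for Lebesgue measure. Besov ball. For $0<s<r$, a function $h\in\mathbb{L}_2[0,1]$ with coefficients $\theta_{jk}=\int_0^1 h\psi_{jk}$ belongs to $B^s_{2,\infty}(R)$ iff $\sup_{j\ge-1}2^{js}\big(\sum_k\theta_{jk}^2\big)^{1/2}\le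 R$. In the claim this is applied to $h=f\circ G^{-1}$. Estimator. Put $\hat\beta_{jk}=\frac1n\sum_{i=1}^n\psi_{jk}(G(X_i))Y_i$ and $\gamma_{jk}^2=\frac{\sigma^2}{n^2}\sum_{i=1}^n\psi_{jk}^2(G(X_i))$. Given hyperparameters $\tau_j>0$, $\pi_j\in(0,1]$, corresponding to the prior $\beta_{jk}\sim\pi_jN(0,\tau_j^2)+(1-\pi_j)\delta(0)$, the posterior median is $$\tilde\beta_{jk}=\mathrm{sign}(\hat\beta_{jk})\max(0,\zeta_{jk}),$$ $$\zeta_{jk}=\frac{\tau_j^2}{\gamma_{jk}^2+\tau_j^2}|\hat\beta_{jk}|-\frac{\tau_j\gamma_{jk}}{\sqrt{\gamma_{jk}^2+\tau_j^2}}\Phi^{-1}\Big(\frac{1+\min(\eta_{jk},1)}{2}\Big),$$ $$\eta_{jk}=\frac{1-\pi_j}{\pi_j}\frac{\sqrt{\tau_j^2+\gamma_{jk}^2}}{\gamma_{jk}}\exp\Big(-\frac{\tau_j^2\hat\beta_{jk}^2}{2\gamma_{jk}^2(\tau_j^2+\gamma_{jk}^2)}\Big),$$ where $\Phi$ is the standard normal distribution function; $\Phi^{-1}(1)=+\infty$, so $\tilde\beta_{jk}=0$ when $\eta_{jk}\ge1$; and $\tilde\beta_{jk}=0$ when $\gamma_{jk}=0$ (in which case $\hat\beta_{jk}=0$). The sum over $j\le J$ runs over integers $-1\le j\le J$. The implied constants in the $\mathcal{O}$ terms do not depend on $n$ (nor on $f$ in the ball).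
   Formalization: The compactly supported father and mother wavelets are assumed to be bounded, as usual; for unbounded ones (some length-4 orthonormal filters) the stated risk bound can fail for small s. *)

theory Defs
  imports "HOL-Probability.Probability" "HOL-Library.Landau_Symbols"
begin

section \<open>Orthonormal bases of real \<open>L\<^sub>2\<close> spaces\<close>

definition square_integrable :: "'a measure \<Rightarrow> ('a \<Rightarrow> real) \<Rightarrow> bool" where
  "square_integrable M u \<longleftrightarrow> u \<in> borel_measurable M \<and> integrable M (\<lambda>x. (u x)\<^sup>2)"

definition orthonormal_basis :: "'a measure \<Rightarrow> 'i set \<Rightarrow> ('i \<Rightarrow> 'a \<Rightarrow> real) \<Rightarrow> bool" where
  "orthonormal_basis M I e \<longleftrightarrow>
     (\<forall>i\<in>I. square_integrable M (e i)) \<and>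
     (\<forall>i\<in>I. \<forall>i'\<in>I. (LINT x|M. e i x * e i' x) = (if i = i' then 1 else 0)) \<and>
     (\<forall>u. square_integrable M u \<longrightarrow> (\<forall>\<delta>>0. \<exists>F c. finite F \<and> F \<subseteq> I \<and>
        (LINT x|M. (u x - (\<Sum>i\<in>F. c i * e i x))\<^sup>2) < \<delta>))"

section \<open>Wavelets\<close>

text \<open>
  Level \<open>j = -1\<close> carries the integer translates of the father wavelet \<open>\<phi>\<close>;
  levels \<open>j \<ge> 0\<close> carry the dilated translates of the mother wavelet \<open>\<psi>\<close>.
\<close>

definition wavelet_line ::
  "(real \<Rightarrow> real) \<Rightarrow> (real \<Rightarrow> real) \<Rightarrow> int \<Rightarrow> int \<Rightarrow> real \<Rightarrow> real" where
  "wavelet_line \<phi> \<psi> j k x =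
     (if j = -1 then \<phi> (x - real_of_int k)
      else 2 powr (real_of_int j / 2) * \<psi> (2 powr real_of_int j * x - real_of_int k))"

text \<open>
  Father and mother wavelets are functions whose system
  \<open>{\<phi>(\<cdot> - k)} \<union> {2\<^sup>j\<^sup>/\<^sup>2 \<psi>(2\<^sup>j \<cdot> - k) : j \<ge> 0}\<close> is an orthonormal basis of \<open>L\<^sub>2\<close> of the
  line, with \<open>\<phi>\<close> and \<open>\<psi>\<close> both in the closed span \<open>V\<^sub>1\<close> of the functions
  \<open>\<phi>(2 \<cdot> - k)\<close>.  (These spans are finite because the supports are compact.)
  Dilating the basis by 2 then gives \<open>V\<^sub>1 = V\<^sub>0 \<oplus> W\<^sub>0\<close>, so the spaces \<open>V\<^sub>j\<close> form a
  multiresolution analysis.  Boundedness is part of the notion: a compactly supported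
  orthonormal scaling function in \<open>L\<^sub>2\<close> need not be bounded.
\<close>

definition compactly_supported_wavelets :: "(real \<Rightarrow> real) \<Rightarrow> (real \<Rightarrow> real) \<Rightarrow> bool" where
  "compactly_supported_wavelets \<phi> \<psi> \<longleftrightarrow>
     \<phi> \<in> borel_measurable borel \<and> \<psi> \<in> borel_measurable borel \<and>
     bounded (range \<phi>) \<and> bounded (range \<psi>) \<and>
     compact (closure {x. \<phi> x \<noteq> 0}) \<and> compact (closure {x. \<psi> x \<noteq> 0}) \<and>
     (\<exists>F h. finite (F :: int set) \<and>
        (AE x in lborel. \<phi> x = (\<Sum>k\<in>F. h k * \<phi> (2 * x - real_of_int k)))) \<and>
     (\<exists>F h. finite (F :: int set) \<and>
        (AE x in lborel. \<psi> x = (\<Sum>k\<in>F. h k * \<phi> (2 * x - real_of_int k)))) \<and>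
     orthonormal_basis lborel ({-1..} \<times> UNIV) (\<lambda>(j, k). wavelet_line \<phi> \<psi> j k)"

definition vanishing_moments :: "nat \<Rightarrow> (real \<Rightarrow> real) \<Rightarrow> bool" where
  "vanishing_moments r \<psi> \<longleftrightarrow> (\<forall>l<r. (LINT x|lborel. x ^ l * \<psi> x) = 0)"

text \<open>For compactly supported \<open>\<phi>\<close> and \<open>\<psi>\<close> only finitely many terms are nonzero at each \<open>x\<close>.\<close>

definition wavelet_per ::
  "(real \<Rightarrow> real) \<Rightarrow> (real \<Rightarrow> real) \<Rightarrow> int \<Rightarrow> int \<Rightarrow> real \<Rightarrow> real" where
  "wavelet_per \<phi> \<psi> j k x = (\<Sum>\<^sub>\<infinity>l\<in>(UNIV :: int set). wavelet_line \<phi> \<psi> j k (x + real_of_int l))"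

definition wavelet_positions :: "int \<Rightarrow> int set" where
  "wavelet_positions j = (if j = -1 then {0} else {0..2 ^ nat j - 1})"

section \<open>Besov balls on the unit interval\<close>

definition wavelet_coeff ::
  "(real \<Rightarrow> real) \<Rightarrow> (real \<Rightarrow> real) \<Rightarrow> (real \<Rightarrow> real) \<Rightarrow> int \<Rightarrow> int \<Rightarrow> real" where
  "wavelet_coeff \<phi> \<psi> h j k = (LINT x:{0..1}|lborel. h x * wavelet_per \<phi> \<psi> j k x)"

definition besov_ball ::
  "(real \<Rightarrow> real) \<Rightarrow> (real \<Rightarrow> real) \<Rightarrow> real \<Rightarrow> real \<Rightarrow> (real \<Rightarrow> real) set" where
  "besov_ball \<phi> \<psi> s R = {h. square_integrable (restrict_space lborel {0..1}) h \<and>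
     (\<forall>j\<ge>-1. 2 powr (real_of_int j * s) *
        sqrt (\<Sum>k\<in>wavelet_positions j. (wavelet_coeff \<phi> \<psi> h j k)\<^sup>2) \<le> R)}"

section \<open>The random design model\<close>

text \<open>The warping map \<open>G\<close> is only used on \<open>[0,1]\<close>.\<close>

definition design_cdf :: "(real \<Rightarrow> real) \<Rightarrow> real \<Rightarrow> real" where
  "design_cdf g x = (LINT t:{0..x}|lborel. g t)"

definition random_design ::
  "'a measure \<Rightarrow> (nat \<Rightarrow> 'a \<Rightarrow> real) \<Rightarrow> (nat \<Rightarrow> 'a \<Rightarrow> real) \<Rightarrow> (real \<Rightarrow> real) \<Rightarrow> real \<Rightarrow> bool" where
  "random_design M X \<epsilon> g \<sigma> \<longleftrightarrow>
     prob_space M \<and>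
     (\<forall>i. \<forall>\<omega>\<in>space M. X i \<omega> \<in> {0..1}) \<and>
     (\<forall>i. distributed M lborel (X i) (\<lambda>x. ennreal (indicator {0..1} x * g x))) \<and>
     (\<forall>i. distributed M lborel (\<epsilon> i) (\<lambda>x. ennreal (normal_density 0 \<sigma> x))) \<and>
     prob_space.indep_vars M (\<lambda>_. borel) (case_sum X \<epsilon>) UNIV"

section \<open>The posterior median estimator\<close>

text \<open>The data are \<open>(x i, y i)\<close> for \<open>i = 1, \<dots>, n\<close>; \<open>w\<close> stands for \<open>\<psi>\<^sub>j\<^sub>k \<circ> G\<close>.\<close>

definition emp_coeff ::
  "(real \<Rightarrow> real) \<Rightarrow> nat \<Rightarrow> (nat \<Rightarrow> real) \<Rightarrow> (nat \<Rightarrow> real) \<Rightarrow> real" where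
  "emp_coeff w n x y = (1 / real n) * (\<Sum>i=1..n. w (x i) * y i)"

definition emp_scale :: "(real \<Rightarrow> real) \<Rightarrow> real \<Rightarrow> nat \<Rightarrow> (nat \<Rightarrow> real) \<Rightarrow> real" where
  "emp_scale w \<sigma> n x = sqrt (\<sigma>\<^sup>2 / (real n)\<^sup>2 * (\<Sum>i=1..n. (w (x i))\<^sup>2))"

definition std_normal_cdf :: "real \<Rightarrow> real" where
  "std_normal_cdf = cdf std_normal_distribution"

definition posterior_odds :: "real \<Rightarrow> real \<Rightarrow> real \<Rightarrow> real \<Rightarrow> real" where
  "posterior_odds \<tau> p \<gamma> b =
     (1 - p) / p * (sqrt (\<tau>\<^sup>2 + \<gamma>\<^sup>2) / \<gamma>) *
     exp (- (\<tau>\<^sup>2 * b\<^sup>2 / (2 * \<gamma>\<^sup>2 * (\<tau>\<^sup>2 + \<gamma>\<^sup>2))))"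

text \<open>
  Median of the posterior of a coefficient with prior \<open>p N(0,\<tau>\<^sup>2) + (1 - p) \<delta>(0)\<close> given the
  observation \<open>b\<close> with noise level \<open>\<gamma>\<close>.  The case \<open>\<eta> \<ge> 1\<close>, where the quantile in the
  formula is \<open>+\<infinity>\<close>, and the case \<open>\<gamma> = 0\<close> are separated out; otherwise the quantile is
  taken at a point of \<open>[1/2, 1)\<close>, where the inverse of the distribution function is genuine.
\<close>

definition posterior_median :: "real \<Rightarrow> real \<Rightarrow> real \<Rightarrow> real \<Rightarrow> real" where
  "posterior_median \<tau> p \<gamma> b =
     (let \<eta> = posterior_odds \<tau> p \<gamma> b;
          \<zeta> = \<tau>\<^sup>2 / (\<gamma>\<^sup>2 + \<tau>\<^sup>2) * \<bar>b\<bar>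
              - \<tau> * \<gamma> / sqrt (\<gamma>\<^sup>2 + \<tau>\<^sup>2) * the_inv std_normal_cdf ((1 + min \<eta> 1) / 2)
      in if \<gamma> = 0 \<or> \<eta> \<ge> 1 then 0 else sgn b * max 0 \<zeta>)"

text \<open>\<open>J\<close> is a real cut-off level; the sum runs over the integer levels \<open>-1 \<le> j \<le> J\<close>.\<close>

definition warped_estimator ::
  "(real \<Rightarrow> real) \<Rightarrow> (real \<Rightarrow> real) \<Rightarrow> (real \<Rightarrow> real) \<Rightarrow> real \<Rightarrow>
   (int \<Rightarrow> real) \<Rightarrow> (int \<Rightarrow> real) \<Rightarrow> real \<Rightarrow> nat \<Rightarrow>
   (nat \<Rightarrow> real) \<Rightarrow> (nat \<Rightarrow> real) \<Rightarrow> real \<Rightarrow> real" where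
  "warped_estimator \<phi> \<psi> G \<sigma> \<tau> p J n x y t =
     (\<Sum>j\<in>{j. -1 \<le> j \<and> real_of_int j \<le> J}. \<Sum>k\<in>wavelet_positions j.
        (let w = (\<lambda>u. wavelet_per \<phi> \<psi> j k (G u)) in
         posterior_median (\<tau> j) (p j) (emp_scale w \<sigma> n x) (emp_coeff w n x y) * w t))"

text \<open>Mean integrated squared error, valued in \<open>[0,\<infinity>]\<close> so that a divergent risk counts as \<open>\<infinity>\<close>.\<close>

definition l2_risk ::
  "'a measure \<Rightarrow> ('a \<Rightarrow> real \<Rightarrow> real) \<Rightarrow> (real \<Rightarrow> real) \<Rightarrow> ennreal" where
  "l2_risk M fhat f =
     (\<integral>\<^sup>+\<omega>. (\<integral>\<^sup>+t\<in>{0..1}. ennreal ((fhat \<omega> t - f t)\<^sup>2) \<partial>lborel) \<partial>M)"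

end

theory Submission
  imports Defs
begin

text \<open>
  With \<open>U = G \<circ> X\<close> uniform on the unit interval, the weighted loss becomes the \<open>L\<^sub>2\<close> distance
  between the estimated series and \<open>h = f \<circ> G\<inverse>\<close>, and the periodized wavelets satisfy an upper
  Riesz bound; exact orthonormality of the periodized system is not needed.  The levels above
  \<open>J\<close> contribute \<open>2\<^sup>-\<^sup>2\<^sup>J\<^sup>s\<close>.  On a level \<open>j \<le> J\<close> one has \<open>n \<tau>\<^sub>j\<^sup>2 \<ge> c\<^sub>1\<close>, so the noise level
  \<open>\<gamma>\<^sup>2\<close>, which is of order \<open>1 / n\<close>, never dominates \<open>\<tau>\<^sub>j\<^sup>2\<close>, and the posterior median differs
  from the empirical coefficient by a multiple of \<open>\<gamma>\<close> up to a factor of order \<open>sqrt (log n)\<close>, plus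
  the linear shrinkage \<open>\<gamma>\<^sup>2 / (\<gamma>\<^sup>2 + \<tau>\<^sub>j\<^sup>2)\<close> times the coefficient.  The first error, summed over the
  \<open>2\<^sup>J \<approx> n powr (1 / \<alpha>)\<close> coefficients, gives the variance term; the second one sums to at most
  \<open>n\<^sup>-\<^sup>2 (\<Sum>j\<le>J. 2 powr (2 j (\<alpha> - s)))\<close>, which is the bias rate if \<open>s < \<alpha>\<close> and is absorbed
  by the variance rate if \<open>s = \<alpha>\<close>.
\<close>

section \<open>Square integrable functions and orthonormal systems\<close>

text \<open>The noise level \<gamma> is random and depends on the same design points as the
  empirical coefficient \<open>b\<close>. Conditioning on the design is avoided: a deterministic
  inequality bounds the squared error of one posterior median by
  \<open>(b - \<beta>)\<^sup>2\<close>, with \<beta> the true coefficient, and by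
  \<open>Q\<^sup>2\<close>, with \<open>Q = n \<gamma>\<^sup>2\<close>, each multiplied by nonrandom
  factors only. Two second moments then suffice and no mixed moment appears. The moment of
  \<open>Q\<close> is uniform in the level because \<open>2\<^sup>j \<le> n\<close> up to the
  cut-off, which is where \<alpha> > 1 enters. The cut-off is the real level at which
  \<open>n \<tau>\<^sup>2\<close> has come down to \<open>3 c\<^sub>1 / 2\<close>. On the analytic
  side the obstacle is periodization: the wavelets are given as a basis of the line, while
  coefficients and Besov norm are periodic. On the unit interval a periodized wavelet is the sum of
  the line wavelets in one residue class of positions, and a number of them that is the same for all
  levels suffices. This gives both the upper Riesz bound and the convergence of the periodized
  expansion.\<close>

lemma square_integrable_mult:
  assumes "square_integrable M u" "square_integrable M v"
  shows "integrable M (\<lambda>x. u x * v x)"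
proof (rule Bochner_Integration.integrable_bound)
  show "integrable M (\<lambda>x. (u x)\<^sup>2 + (v x)\<^sup>2)"
    using assms by (auto simp: square_integrable_def)
  show "(\<lambda>x. u x * v x) \<in> borel_measurable M"
    using assms by (auto simp: square_integrable_def)
  have "norm (a * b) \<le> norm (a\<^sup>2 + b\<^sup>2)" for a b :: real
  proof -
    have "2 * (\<bar>a\<bar> * \<bar>b\<bar>) \<le> a\<^sup>2 + b\<^sup>2" "0 \<le> \<bar>a\<bar> * \<bar>b\<bar>"
      using sum_squares_bound[of "\<bar>a\<bar>" "\<bar>b\<bar>"] by (simp_all add: mult.assoc)
    then have "\<bar>a\<bar> * \<bar>b\<bar> \<le> a\<^sup>2 + b\<^sup>2" by linarith
    then show ?thesis by (simp add: abs_mult)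
  qed
  then show "AE x in M. norm (u x * v x) \<le> norm ((u x)\<^sup>2 + (v x)\<^sup>2)"
    by simp
qed

lemma square_integrable_cmult:
  "square_integrable M u \<Longrightarrow> square_integrable M (\<lambda>x. c * u x)"
  by (auto simp: square_integrable_def power_mult_distrib)

lemma square_integrable_add:
  assumes "square_integrable M u" "square_integrable M v"
  shows "square_integrable M (\<lambda>x. u x + v x)"
  using assms square_integrable_mult[OF assms]
  by (auto simp: square_integrable_def power2_sum mult.assoc)

lemma square_integrable_diff:
  assumes "square_integrable M u" "square_integrable M v"
  shows "square_integrable M (\<lambda>x. u x - v x)"
  using square_integrable_add[OF assms(1) square_integrable_cmult[OF assms(2), of "-1"]] by simp

lemma square_integrable_sum:
  "(\<And>i. i \<in> S \<Longrightarrow> square_integrable M (u i)) \<Longrightarrow> square_integrable M (\<lambda>x. \<Sum>i\<in>S. u i x)"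
proof (induction S rule: infinite_finite_induct)
  case (insert i S)
  then show ?case by (simp add: square_integrable_add)
qed (simp_all add: square_integrable_def)

lemma square_integrable_bound:
  assumes v: "square_integrable M v" and [measurable]: "u \<in> borel_measurable M"
    and le: "\<And>x. \<bar>u x\<bar> \<le> C * \<bar>v x\<bar>"
  shows "square_integrable M u"
proof -
  have "integrable M (\<lambda>x. (u x)\<^sup>2)"
  proof (rule Bochner_Integration.integrable_bound)
    show "integrable M (\<lambda>x. C\<^sup>2 * (v x)\<^sup>2)"
      using v by (auto simp: square_integrable_def)
    have "(u x)\<^sup>2 \<le> C\<^sup>2 * (v x)\<^sup>2" for x
      using power_mono[OF le[of x], of 2] by (simp add: power_mult_distrib)
    then show "AE x in M. norm ((u x)\<^sup>2) \<le> norm (C\<^sup>2 * (v x)\<^sup>2)"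
      by simp
  qed measurable
  then show ?thesis
    by (simp add: square_integrable_def)
qed

lemma orthonormal_basisD:
  assumes "orthonormal_basis M I e" "i \<in> I"
  shows "square_integrable M (e i)"
    and "i' \<in> I \<Longrightarrow> (LINT x|M. e i x * e i' x) = (if i = i' then 1 else 0)"
  using assms unfolding orthonormal_basis_def by auto

lemma orthonormal_sum_square:
  assumes onb: "orthonormal_basis M I e" and S: "finite S" "S \<subseteq> I"
  shows "(LINT x|M. (\<Sum>i\<in>S. d i * e i x)\<^sup>2) = (\<Sum>i\<in>S. (d i)\<^sup>2)"
proof -
  have int: "integrable M (\<lambda>x. e i x * e i' x)" if "i \<in> S" "i' \<in> S" for i i'
    using that S by (intro square_integrable_mult orthonormal_basisD(1)[OF onb]) auto
  have eq: "(\<lambda>x. (\<Sum>i\<in>S. d i * e i x)\<^sup>2) = (\<lambda>x. \<Sum>i\<in>S. \<Sum>i'\<in>S. (d i * d i') * (e i x * e i' x))"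
    by (simp add: power2_eq_square sum_product algebra_simps)
  have "(LINT x|M. (\<Sum>i\<in>S. d i * e i x)\<^sup>2) = (\<Sum>i\<in>S. \<Sum>i'\<in>S. (d i * d i') * (LINT x|M. e i x * e i' x))"
    unfolding eq using int by (simp add: Bochner_Integration.integral_sum)
  also have "\<dots> = (\<Sum>i\<in>S. \<Sum>i'\<in>S. if i = i' then (d i)\<^sup>2 else 0)"
  proof (intro sum.cong refl)
    fix i i' assume "i \<in> S" "i' \<in> S"
    then have "i \<in> I" "i' \<in> I" using S by auto
    then show "d i * d i' * (LINT x|M. e i x * e i' x) = (if i = i' then (d i)\<^sup>2 else 0)"
      using orthonormal_basisD(2)[OF onb, of i i'] by (auto simp: power2_eq_square)
  qed
  also have "\<dots> = (\<Sum>i\<in>S. (d i)\<^sup>2)"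
    using S by simp
  finally show ?thesis .
qed

lemma orthonormal_residual_square:
  assumes onb: "orthonormal_basis M I e" and S: "finite S" "S \<subseteq> I" and u: "square_integrable M u"
  shows "(LINT x|M. (u x - (\<Sum>i\<in>S. c i * e i x))\<^sup>2) =
    (LINT x|M. (u x)\<^sup>2) - 2 * (\<Sum>i\<in>S. c i * (LINT x|M. u x * e i x)) + (\<Sum>i\<in>S. (c i)\<^sup>2)"
proof -
  have e: "square_integrable M (e i)" if "i \<in> S" for i
    using that S by (intro orthonormal_basisD(1)[OF onb]) auto
  have sum: "square_integrable M (\<lambda>x. \<Sum>i\<in>S. c i * e i x)"
    by (intro square_integrable_sum square_integrable_cmult e)
  have int: "integrable M (\<lambda>x. u x * e i x)" if "i \<in> S" for i
    by (intro square_integrable_mult u e that)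
  have "(LINT x|M. u x * (\<Sum>i\<in>S. c i * e i x)) = (LINT x|M. (\<Sum>i\<in>S. c i * (u x * e i x)))"
    by (simp add: sum_distrib_left algebra_simps)
  also have "\<dots> = (\<Sum>i\<in>S. c i * (LINT x|M. u x * e i x))"
    using int by (simp add: Bochner_Integration.integral_sum)
  finally have cross: "(LINT x|M. u x * (\<Sum>i\<in>S. c i * e i x)) = (\<Sum>i\<in>S. c i * (LINT x|M. u x * e i x))" .
  have "(LINT x|M. (u x - (\<Sum>i\<in>S. c i * e i x))\<^sup>2) =
     (LINT x|M. (u x)\<^sup>2 + (\<Sum>i\<in>S. c i * e i x)\<^sup>2 - 2 * (u x * (\<Sum>i\<in>S. c i * e i x)))"
    by (simp add: power2_diff mult.assoc)
  also have "\<dots> = (LINT x|M. (u x)\<^sup>2) + (LINT x|M. (\<Sum>i\<in>S. c i * e i x)\<^sup>2)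
      - 2 * (LINT x|M. u x * (\<Sum>i\<in>S. c i * e i x))"
    using u sum square_integrable_mult[OF u sum] by (simp add: square_integrable_def)
  finally show ?thesis
    by (simp add: cross orthonormal_sum_square[OF onb S])
qed

text \<open>Completing the square: the two sides differ by the sum of the squared distances between
  \<open>c i\<close> and the Fourier coefficients.\<close>

lemma orthonormal_projection_le:
  assumes onb: "orthonormal_basis M I e" and S: "finite S" "S \<subseteq> I" and u: "square_integrable M u"
  shows "(LINT x|M. (u x - (\<Sum>i\<in>S. (LINT y|M. u y * e i y) * e i x))\<^sup>2)
    \<le> (LINT x|M. (u x - (\<Sum>i\<in>S. c i * e i x))\<^sup>2)"
proof -
  let ?d = "\<lambda>i. LINT y|M. u y * e i y"
  have "0 \<le> (\<Sum>i\<in>S. (c i - ?d i)\<^sup>2)"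
    by (simp add: sum_nonneg)
  also have "\<dots> = (\<Sum>i\<in>S. (c i)\<^sup>2) - 2 * (\<Sum>i\<in>S. c i * ?d i) + (\<Sum>i\<in>S. (?d i)\<^sup>2)"
    by (simp add: power2_diff sum.distrib sum_subtractf sum_distrib_left algebra_simps)
  finally show ?thesis
    unfolding orthonormal_residual_square[OF onb S u] by (simp add: power2_eq_square)
qed

lemma LINT_mono_square:
  assumes "square_integrable M u" "square_integrable M v" "\<And>x. \<bar>u x\<bar> \<le> \<bar>v x\<bar>"
  shows "(LINT x|M. (u x)\<^sup>2) \<le> (LINT x|M. (v x)\<^sup>2)"
  using assms by (intro integral_mono) (auto simp: square_integrable_def abs_le_square_iff)

lemma LINT_square_add_le:
  assumes u: "square_integrable M u" and v: "square_integrable M v"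
  shows "(LINT x|M. (u x + v x)\<^sup>2) \<le> 2 * (LINT x|M. (u x)\<^sup>2) + 2 * (LINT x|M. (v x)\<^sup>2)"
proof -
  have "(LINT x|M. (u x + v x)\<^sup>2) \<le> (LINT x|M. 2 * (u x)\<^sup>2 + 2 * (v x)\<^sup>2)"
  proof (rule integral_mono)
    show "integrable M (\<lambda>x. (u x + v x)\<^sup>2)" "integrable M (\<lambda>x. 2 * (u x)\<^sup>2 + 2 * (v x)\<^sup>2)"
      using square_integrable_add[OF u v] u v by (auto simp: square_integrable_def)
    show "(u x + v x)\<^sup>2 \<le> 2 * (u x)\<^sup>2 + 2 * (v x)\<^sup>2" for x
      using zero_le_power2[of "u x - v x"] by (simp add: power2_sum power2_diff)
  qed
  also have "\<dots> = 2 * (LINT x|M. (u x)\<^sup>2) + 2 * (LINT x|M. (v x)\<^sup>2)"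
    using u v by (simp add: square_integrable_def)
  finally show ?thesis .
qed

lemma square_integrable_shift:
  fixes v :: "real \<Rightarrow> real"
  assumes "square_integrable lborel v"
  shows "square_integrable lborel (\<lambda>x. v (x + t))"
    and "(LINT x|lborel. (v (x + t))\<^sup>2) = (LINT x|lborel. (v x)\<^sup>2)"
proof -
  have [measurable]: "v \<in> borel_measurable borel"
    using assms by (simp add: square_integrable_def)
  have "integrable lborel (\<lambda>x. (v (t + 1 * x))\<^sup>2)"
    using assms by (intro lborel_integrable_real_affine) (auto simp: square_integrable_def)
  then show "square_integrable lborel (\<lambda>x. v (x + t))"
    by (simp add: square_integrable_def add.commute)
  show "(LINT x|lborel. (v (x + t))\<^sup>2) = (LINT x|lborel. (v x)\<^sup>2)"
    using lborel_integral_real_affine[of 1 "\<lambda>x. (v x)\<^sup>2" t] by (simp add: add.commute)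
qed

lemma square_integrable_indicator:
  assumes "square_integrable M u" "A \<in> sets M"
  shows "square_integrable M (\<lambda>x. indicator A x * u x)"
  using assms by (intro square_integrable_bound[OF assms(1), of _ 1]) (auto simp: square_integrable_def indicator_def)

section \<open>Geometric sums over levels\<close>

text \<open>The closed form is proved by induction from the empty range \<open>m = a - 1\<close>.
  Dropping its second power makes the bound free of \<open>m\<close>, so that
  \<open>per_bias\<close> can let the last level grow.\<close>

lemma sum_powr_le:
  fixes c :: real
  assumes "0 < c" "a - 1 \<le> m"
  shows "(\<Sum>j\<in>{a..m}. 2 powr (- c * real_of_int j)) \<le> 2 powr (- c * real_of_int a) / (1 - 2 powr (- c))"
proof -
  define q where "q = 2 powr (- c)"
  have q: "0 < q" "q < 1" using assms powr_less_mono[of "- c" 0 2] by (auto simp: q_def)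
  have "(\<Sum>j\<in>{a..m}. 2 powr (- c * real_of_int j)) =
     (2 powr (- c * real_of_int a) - 2 powr (- c * real_of_int (m + 1))) / (1 - q)"
    using assms(2)
  proof (induction m rule: int_ge_induct)
    case (step m)
    have "2 powr (- c * real_of_int (m + 2)) = q * 2 powr (- c * real_of_int (m + 1))"
    proof -
      have "- c * real_of_int (m + 2) = - c + - c * real_of_int (m + 1)"
        by (simp add: algebra_simps)
      then show ?thesis
        unfolding q_def by (simp only: powr_add)
    qed
    moreover have "{a..m + 1} = insert (m + 1) {a..m}"
      using step.hyps by auto
    moreover have "P + (A - P) / (1 - q) = (A - q * P) / (1 - q)" for A P :: real
      using q by (simp add: divide_simps) (simp add: algebra_simps)
    ultimately show ?case
      using step.IH by (simp add: add.commute[of 2])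
  qed simp
  also have "\<dots> \<le> 2 powr (- c * real_of_int a) / (1 - q)"
    using q by (intro divide_right_mono) auto
  finally show ?thesis by (simp add: q_def)
qed

text \<open>Reflecting \<open>j\<close> to \<open>- j\<close> turns the growing sum into a decaying
  one, dominated by the top level.\<close>

lemma sum_powr_increasing_le:
  fixes c :: real
  assumes "0 < c" "-2 \<le> m"
  shows "(\<Sum>j\<in>{-1..m}. 2 powr (c * real_of_int j)) \<le> 2 powr (c * real_of_int m) / (1 - 2 powr (- c))"
proof -
  have "(\<Sum>j\<in>{-1..m}. 2 powr (c * real_of_int j)) = (\<Sum>i\<in>{- m..1}. 2 powr (- c * real_of_int i))"
    by (rule sum.reindex_bij_witness[of _ uminus uminus]) auto
  also have "\<dots> \<le> 2 powr (- c * real_of_int (- m)) / (1 - 2 powr (- c))"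
    using assms by (intro sum_powr_le) auto
  finally show ?thesis by simp
qed

section \<open>Periodized wavelets\<close>

text \<open>The support radius \<open>L\<close> is an integer so that the shifts entering a
  periodization can be enclosed in an integer interval that is the same for all levels.\<close>

locale compact_wavelets =
  fixes \<phi> \<psi> :: "real \<Rightarrow> real" and L :: int and B :: real
  assumes wavelets: "compactly_supported_wavelets \<phi> \<psi>"
    and B: "\<And>x. \<bar>\<phi> x\<bar> \<le> B" "\<And>x. \<bar>\<psi> x\<bar> \<le> B"
    and L: "0 \<le> L" "\<And>x. \<phi> x \<noteq> 0 \<Longrightarrow> \<bar>x\<bar> \<le> of_int L" "\<And>x. \<psi> x \<noteq> 0 \<Longrightarrow> \<bar>x\<bar> \<le> of_int L"

lemma compact_wavelets_exist:
  assumes "compactly_supported_wavelets \<phi> \<psi>"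
  obtains L B where "compact_wavelets \<phi> \<psi> L B"
proof -
  obtain B1 B2 where B: "\<And>x. \<bar>\<phi> x\<bar> \<le> B1" "\<And>x. \<bar>\<psi> x\<bar> \<le> B2"
    using assms unfolding compactly_supported_wavelets_def bounded_iff by fastforce
  have "bounded {x. \<phi> x \<noteq> 0}" "bounded {x. \<psi> x \<noteq> 0}"
    using assms bounded_subset[OF compact_imp_bounded closure_subset]
    unfolding compactly_supported_wavelets_def by blast+
  then obtain L1 L2 where L: "\<And>x. \<phi> x \<noteq> 0 \<Longrightarrow> \<bar>x\<bar> \<le> L1" "\<And>x. \<psi> x \<noteq> 0 \<Longrightarrow> \<bar>x\<bar> \<le> L2"
    unfolding bounded_iff by auto
  have "compact_wavelets \<phi> \<psi> (max 0 (max \<lceil>L1\<rceil> \<lceil>L2\<rceil>)) (max B1 B2)"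
  proof
    show "\<bar>\<phi> x\<bar> \<le> max B1 B2" "\<bar>\<psi> x\<bar> \<le> max B1 B2" for x
      using B[of x] by auto
    have "L1 \<le> of_int \<lceil>L1\<rceil>" "L2 \<le> of_int \<lceil>L2\<rceil>"
      by auto
    then have le: "L1 \<le> of_int (max 0 (max \<lceil>L1\<rceil> \<lceil>L2\<rceil>))" "L2 \<le> of_int (max 0 (max \<lceil>L1\<rceil> \<lceil>L2\<rceil>))"
      by linarith+
    show "\<bar>x\<bar> \<le> of_int (max 0 (max \<lceil>L1\<rceil> \<lceil>L2\<rceil>))" if "\<phi> x \<noteq> 0" for x
      using L(1)[OF that] le by linarith
    show "\<bar>x\<bar> \<le> of_int (max 0 (max \<lceil>L1\<rceil> \<lceil>L2\<rceil>))" if "\<psi> x \<noteq> 0" for x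
      using L(2)[OF that] le by linarith
  qed (use assms in auto)
  then show ?thesis by (rule that)
qed

context compact_wavelets
begin

abbreviation "e \<equiv> wavelet_line \<phi> \<psi>"
abbreviation "per \<equiv> wavelet_per \<phi> \<psi>"
abbreviation "pos \<equiv> wavelet_positions"

text \<open>Half width of the window of integer shifts that can move a wavelet with position in
  \<open>pos j\<close> onto the unit interval, uniformly in the level; see
  \<open>e_support\<close>.\<close>

definition "N = L + 2"

lemma B_nonneg: "0 \<le> B"
  using B(1)[of 0] by linarith

lemma onb: "orthonormal_basis lborel ({-1..} \<times> UNIV) (\<lambda>(j, k). e j k)"
  using wavelets unfolding compactly_supported_wavelets_def by blast

lemma e_measurable [measurable]: "e j k \<in> borel_measurable borel"
proof -
  have [measurable]: "\<phi> \<in> borel_measurable borel" "\<psi> \<in> borel_measurable borel"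
    using wavelets unfolding compactly_supported_wavelets_def by blast+
  show ?thesis
    unfolding wavelet_line_def by measurable
qed

lemma e_square_integrable: "-1 \<le> j \<Longrightarrow> square_integrable lborel (e j k)"
  using orthonormal_basisD(1)[OF onb, of "(j, k)"] by simp

text \<open>Since \<open>nat (-1) = 0\<close>, the formula also covers the scaling level, and
  \<open>2 ^ nat j\<close> is the number of positions at every level.\<close>

lemma pos_eq: "-1 \<le> j \<Longrightarrow> pos j = {0..<2 ^ nat j}"
  by (auto simp: wavelet_positions_def)

lemma finite_pos [simp]: "finite (pos j)"
  by (simp add: wavelet_positions_def)

lemma powr_nat_eq: "0 \<le> j \<Longrightarrow> 2 powr real_of_int j = 2 ^ nat j"
  by (metis of_nat_nat powr_realpow zero_less_numeral of_int_of_nat_eq int_nat_eq)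

text \<open>The factor 2 is due to the scaling level, which has one position while
  \<open>2 powr (-1)\<close> is one half.\<close>

lemma card_pos_le:
  assumes "-1 \<le> j"
  shows "real (card (pos j)) \<le> 2 * 2 powr j"
proof (cases "j = -1")
  case True
  then show ?thesis by (simp add: wavelet_positions_def powr_minus)
next
  case False
  then show ?thesis using assms powr_nat_eq[of j] by (simp add: pos_eq[OF assms])
qed

text \<open>An integer shift of the argument moves the position by a multiple of the number of
  positions. Hence a periodization runs through one residue class of line wavelets.\<close>

lemma e_shift:
  assumes "-1 \<le> j"
  shows "e j k (x + of_int l) = e j (k - 2 ^ nat j * l) x"
proof (cases "j = -1")
  case True
  then show ?thesis by (simp add: wavelet_line_def algebra_simps)
next
  case False
  then have "0 \<le> j" using assms by simp
  then show ?thesis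
    using False by (simp add: wavelet_line_def powr_nat_eq algebra_simps)
qed

text \<open>The factor 2 pays for the scaling level, where \<open>2 powr (j / 2)\<close> is below
  1.\<close>

lemma e_bound:
  assumes "-1 \<le> j"
  shows "\<bar>e j k x\<bar> \<le> 2 * B * 2 powr (j / 2)"
proof (cases "j = -1")
  case True
  have "1 \<le> 2 * 2 powr (-(1 / 2) :: real)"
    by (simp add: powr_minus powr_half_sqrt field_simps real_le_lsqrt)
  then have "\<bar>\<phi> (x - k)\<bar> \<le> B * (2 * 2 powr (-(1 / 2)))"
    using mult_left_mono[OF _ B_nonneg, of 1 "2 * 2 powr (-(1 / 2) :: real)"] B(1)[of "x - k"] by simp
  then show ?thesis
    using True by (simp add: wavelet_line_def algebra_simps)
next
  case False
  have "2 powr (j / 2) * \<bar>\<psi> (2 powr j * x - k)\<bar> \<le> 2 powr (j / 2) * (2 * B)"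
    using B(2)[of "2 powr j * x - k"] B_nonneg by (intro mult_left_mono) auto
  then show ?thesis
    using False by (simp add: wavelet_line_def abs_mult algebra_simps)
qed

text \<open>With \<open>q = 2\<^sup>j\<close> the support condition bounds
  \<open>q (x + l) - k\<close> by \<open>L\<close>. Dividing by \<open>q \<ge> 1\<close> leaves at
  most \<open>L\<close>, and \<open>x\<close> and \<open>k / q\<close> both lie in the unit
  interval, so their difference costs one more unit.\<close>

lemma e_support:
  assumes "-1 \<le> j" "k \<in> pos j" "x \<in> {0..1}" "e j k (x + of_int l) \<noteq> 0"
  shows "l \<in> {-N..N}"
proof (cases "j = -1")
  case True
  then have "\<bar>x + l - k\<bar> \<le> L" "k = 0"
    using assms L(2)[of "x + l - k"] by (auto simp: wavelet_line_def wavelet_positions_def)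
  then have "\<bar>real_of_int l\<bar> \<le> real_of_int (L + 2)"
    using assms(3) by (auto simp: abs_le_iff)
  then show ?thesis unfolding N_def by (simp only: of_int_abs[symmetric] of_int_le_iff) auto
next
  case False
  define q where "q = (2::real) ^ nat j"
  have q: "1 \<le> q" "2 powr j = q" unfolding q_def using powr_nat_eq[of j] False assms by auto
  have k: "0 \<le> real_of_int k" "real_of_int k \<le> q"
  proof -
    have "k < 2 ^ nat j" "0 \<le> k" using pos_eq[of j] assms by auto
    then show "0 \<le> real_of_int k" "real_of_int k \<le> q"
      unfolding q_def using of_int_less_iff[of k "2 ^ nat j", where 'a=real] by (simp_all del: of_int_less_iff)
  qed
  have "\<bar>q * (x + l) - k\<bar> \<le> L"
    using assms L(3)[of "q * (x + l) - k"] False by (auto simp: wavelet_line_def q)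
  then have le: "q * (x + l) - k \<le> L" "- L \<le> q * (x + l) - k" by (auto simp: abs_le_iff)
  have L0: "real_of_int L \<le> q * L" using L(1) q(1) by (simp add: mult_le_cancel_right1)
  have x: "0 \<le> q * x" "q * x \<le> q" using assms(3) q(1) by (auto simp: mult_left_le)
  have "q * l \<le> q * (L + 1)" "q * (-(L + 1)) \<le> q * l"
    using le k L0 x by (auto simp: algebra_simps)
  then have "real_of_int l \<le> real_of_int (L + 1)" "- real_of_int (L + 1) \<le> real_of_int l"
    using q(1) by (auto simp: mult_le_cancel_left)
  then show ?thesis unfolding N_def by auto
qed

lemma per_eq:
  assumes "-1 \<le> j" "k \<in> pos j" "x \<in> {0..1}" "finite S" "{-N..N} \<subseteq> S"
  shows "per j k x = (\<Sum>l\<in>S. e j (k - 2 ^ nat j * l) x)"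
proof -
  have "per j k x = (\<Sum>\<^sub>\<infinity>l\<in>S. e j k (x + real_of_int l))"
    unfolding wavelet_per_def
  proof (rule infsum_cong_neutral)
    fix l assume "l \<in> UNIV - S"
    then show "e j k (x + real_of_int l) = 0"
      using e_support[OF assms(1-3), of l] assms(5) by blast
  qed auto
  then show ?thesis
    using assms by (simp add: e_shift)
qed

lemma N_nonneg: "0 \<le> N"
  using L(1) by (simp add: N_def)

text \<open>Division with remainder: \<open>k\<close> is the residue modulo the number of positions
  and \<open>- l\<close> is the quotient.\<close>

lemma shift_inj: "inj_on (\<lambda>(k, l). k - 2 ^ nat j * l) (pos j \<times> (UNIV :: int set))" if "-1 \<le> j"
proof (rule inj_onI, clarify)
  fix k l k' l' :: int
  assume k: "k \<in> pos j" "k' \<in> pos j" and eq: "k - 2 ^ nat j * l = k' - 2 ^ nat j * l'"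
  have "k mod 2 ^ nat j = (k - 2 ^ nat j * l) mod 2 ^ nat j" for k l :: int
    by (simp add: mod_diff_eq[symmetric])
  then have "k mod 2 ^ nat j = k' mod 2 ^ nat j"
    using eq by metis
  then have "k = k'" using k pos_eq[OF that] by simp
  then show "k = k' \<and> l = l'" using eq by simp
qed

lemma per_measurable: 
  assumes "-1 \<le> j" "k \<in> pos j"
  shows "(\<lambda>x. indicator {0..1} x * per j k x) \<in> borel_measurable borel"
proof -
  have "(\<lambda>x. indicator {0..1} x * per j k x) =
      (\<lambda>x. indicator {0..1} x * (\<Sum>l\<in>{-N..N}. e j (k - 2 ^ nat j * l) x))"
    using per_eq[OF assms, of _ "{-N..N}"] by (auto simp: indicator_def)
  then show ?thesis by simp
qed

section \<open>Pointwise bounds for the periodized wavelets\<close>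

text \<open>\<open>2 L + 2\<close> counts the positions of one level in the interval
  \<open>I\<close> of \<open>per_sum_abs_le\<close>, outside which the line wavelets vanish at the
  given point. \<open>2 B\<close> is the constant of \<open>e_bound\<close>.\<close>

definition "B1 = (2 * real_of_int L + 2) * (2 * B)"

lemma B1_nonneg: "0 \<le> B1"
  using B_nonneg L(1) unfolding B1_def by simp

text \<open>Distinct pairs of position and shift label distinct line wavelets, and at a fixed point
  only boundedly many wavelets of one level are nonzero. So the whole sum over \<open>k\<close>
  costs no more than a single wavelet.\<close>

lemma per_sum_abs_le:
  assumes "-1 \<le> j" "x \<in> {0..1}"
  shows "(\<Sum>k\<in>pos j. \<bar>per j k x\<bar>) \<le> B1 * 2 powr (j / 2)"
proof -
  define y where "y = (if j = -1 then x else 2 powr j * x)"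
  define I where "I = {\<lfloor>y\<rfloor> - L .. \<lfloor>y\<rfloor> + L + 1}"
  define f where "f = (\<lambda>(k, l). k - 2 ^ nat j * l :: int)"
  define S where "S = pos j \<times> {-N..N}"
  have supp: "m \<in> I" if "e j m x \<noteq> 0" for m
  proof -
    have "\<bar>y - m\<bar> \<le> L"
      using that L(2)[of "y - m"] L(3)[of "y - m"] by (auto simp: wavelet_line_def y_def split: if_splits)
    then have "real_of_int m \<le> y + L" "y - L \<le> real_of_int m" by (auto simp: abs_le_iff)
    then show ?thesis unfolding I_def by simp linarith
  qed
  have "inj_on f S"
    using shift_inj[OF assms(1)] unfolding f_def S_def by (rule inj_on_subset) auto
  have "(\<Sum>k\<in>pos j. \<bar>per j k x\<bar>) \<le> (\<Sum>k\<in>pos j. \<Sum>l\<in>{-N..N}. \<bar>e j (k - 2 ^ nat j * l) x\<bar>)"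
    using assms by (intro sum_mono) (simp add: per_eq[of _ _ _ "{-N..N}"] sum_abs)
  also have "\<dots> = (\<Sum>i\<in>S. \<bar>e j (f i) x\<bar>)"
    unfolding S_def f_def by (simp add: sum.cartesian_product split_def)
  also have "\<dots> = (\<Sum>m\<in>f ` S. \<bar>e j m x\<bar>)"
    using \<open>inj_on f S\<close> by (simp add: sum.reindex)
  also have "\<dots> = (\<Sum>m\<in>f ` S \<inter> I. \<bar>e j m x\<bar>)"
    using supp by (intro sum.mono_neutral_right) (auto simp: S_def)
  also have "\<dots> \<le> (\<Sum>m\<in>I. \<bar>e j m x\<bar>)"
    by (intro sum_mono2) (auto simp: I_def)
  also have "\<dots> \<le> (\<Sum>m\<in>I. 2 * B * 2 powr (j / 2))"
    by (intro sum_mono e_bound assms)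
  also have "\<dots> = B1 * 2 powr (j / 2)"
    using L(1) by (simp add: I_def B1_def)
  finally show ?thesis .
qed

lemma per_abs_le:
  assumes "-1 \<le> j" "x \<in> {0..1}" "k \<in> pos j"
  shows "\<bar>per j k x\<bar> \<le> B1 * 2 powr (j / 2)"
  using member_le_sum[of k "pos j" "\<lambda>k. \<bar>per j k x\<bar>"] assms per_sum_abs_le[OF assms(1,2)] by simp

text \<open>One factor is bounded by its maximum and the other is summed. This yields the order
  \<open>2\<^sup>j\<close>, whereas the number of positions times the squared maximum would be of
  order \<open>2\<^sup>2\<^sup>j\<close>.\<close>

lemma per_sum_square_le:
  assumes "-1 \<le> j" "x \<in> {0..1}"
  shows "(\<Sum>k\<in>pos j. (per j k x)\<^sup>2) \<le> B1\<^sup>2 * 2 powr j"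
proof -
  have "(\<Sum>k\<in>pos j. (per j k x)\<^sup>2) \<le> (\<Sum>k\<in>pos j. \<bar>per j k x\<bar> * (B1 * 2 powr (j / 2)))"
  proof (rule sum_mono)
    fix k assume "k \<in> pos j"
    then have "\<bar>per j k x\<bar> * \<bar>per j k x\<bar> \<le> \<bar>per j k x\<bar> * (B1 * 2 powr (j / 2))"
      using per_abs_le[OF assms] by (intro mult_left_mono) auto
    then show "(per j k x)\<^sup>2 \<le> \<bar>per j k x\<bar> * (B1 * 2 powr (j / 2))"
      by (simp add: power2_eq_square)
  qed
  also have "\<dots> = (\<Sum>k\<in>pos j. \<bar>per j k x\<bar>) * (B1 * 2 powr (j / 2))"
    by (simp add: sum_distrib_right)
  also have "\<dots> \<le> (B1 * 2 powr (j / 2)) * (B1 * 2 powr (j / 2))"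
    using B1_nonneg by (intro mult_right_mono per_sum_abs_le assms) auto
  also have "\<dots> = B1\<^sup>2 * 2 powr j"
    by (simp add: power2_eq_square algebra_simps flip: powr_add)
  finally show ?thesis .
qed

lemma per_square_integrable:
  assumes "-1 \<le> j" "k \<in> pos j"
  shows "square_integrable lborel (\<lambda>x. indicator {0..1} x * per j k x)"
proof (rule square_integrable_bound)
  show "square_integrable lborel (indicator {0..1} :: real \<Rightarrow> real)"
    by (auto simp: square_integrable_def power2_eq_square simp flip: indicator_inter_arith)
  show "(\<lambda>x. indicator {0..1} x * per j k x) \<in> borel_measurable lborel"
    using per_measurable[OF assms] by simp
  show "\<bar>indicator {0..1} x * per j k x\<bar> \<le> (B1 * 2 powr (j / 2)) * \<bar>indicator {0..1} x :: real\<bar>" for x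
    using per_abs_le[OF assms(1) _ assms(2)] by (auto simp: indicator_def)
qed

section \<open>The line wavelets behind periodized levels, and the Riesz bound\<close>

text \<open>Triples of level, position and shift label the line wavelets that enter when the levels
  in \<open>K\<close> are periodized. \<open>shift_index\<close> below translates such a label into
  the index of the line wavelet.\<close>

definition shifted_indices :: "int set \<Rightarrow> (int \<times> int \<times> int) set" where
  "shifted_indices K = Sigma K (\<lambda>j. pos j \<times> {-N..N})"

definition shift_index :: "int \<times> int \<times> int \<Rightarrow> int \<times> int" where
  "shift_index = (\<lambda>(j, k, l). (j, k - 2 ^ nat j * l))"

lemma finite_shifted_indices: "finite K \<Longrightarrow> finite (shifted_indices K)"
  unfolding shifted_indices_def by auto

lemma inj_shift_index:
  assumes "K \<subseteq> {-1..}"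
  shows "inj_on shift_index (shifted_indices K)"
proof (rule inj_onI)
  fix t t' assume t: "t \<in> shifted_indices K" "t' \<in> shifted_indices K" "shift_index t = shift_index t'"
  obtain j k l j' k' l' where tt: "t = (j, k, l)" "t' = (j', k', l')"
    by (metis prod_cases3)
  show "t = t'"
    using t assms inj_onD[OF shift_inj[of j], of "(k, l)" "(k', l')"]
    by (auto simp: tt shifted_indices_def shift_index_def)
qed

lemma sum_shifted_indices:
  assumes "finite K"
  shows "(\<Sum>t\<in>shifted_indices K. F t) = (\<Sum>j\<in>K. \<Sum>k\<in>pos j. \<Sum>l\<in>{-N..N}. F (j, k, l))"
proof -
  have "(\<Sum>j\<in>K. \<Sum>k\<in>pos j. \<Sum>l\<in>{-N..N}. F (j, k, l)) = (\<Sum>j\<in>K. \<Sum>p\<in>pos j \<times> {-N..N}. F (j, p))"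
    by (simp add: sum.cartesian_product split_def)
  also have "\<dots> = (\<Sum>t\<in>shifted_indices K. F t)"
    unfolding shifted_indices_def using assms by (subst sum.Sigma) (auto simp: split_def)
  finally show ?thesis by simp
qed

text \<open>On the unit interval the periodized sum agrees with a sum of orthonormal line wavelets
  in which every \<open>c j k\<close> occurs \<open>2 N + 1\<close> times. Enlarging the domain to
  the whole line only increases the integral, and there Pythagoras applies.\<close>

lemma per_riesz:
  assumes K: "finite K" "K \<subseteq> {-1..}"
  shows "(LINT x|lborel. (indicator {0..1} x * (\<Sum>j\<in>K. \<Sum>k\<in>pos j. c j k * per j k x))\<^sup>2)
    \<le> (2 * real_of_int N + 1) * (\<Sum>j\<in>K. \<Sum>k\<in>pos j. (c j k)\<^sup>2)"
proof -
  let ?S = "shifted_indices K" and ?e = "\<lambda>(j, k). e j k"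
  \<comment> \<open>The coefficients are carried over to the line indices along the inverse of the
    injection \<open>shift_index\<close>.\<close>
  define d where "d i = (case the_inv_into ?S shift_index i of (j, k, l) \<Rightarrow> c j k)" for i
  note inj = inj_shift_index[OF K(2)]
  have d: "d (shift_index t) = (case t of (j, k, l) \<Rightarrow> c j k)" if "t \<in> ?S" for t
    unfolding d_def the_inv_into_f_f[OF inj that] ..
  have I: "shift_index ` ?S \<subseteq> {-1..} \<times> UNIV"
    using K(2) by (auto simp: shifted_indices_def shift_index_def)
  have fin: "finite (shift_index ` ?S)"
    using finite_shifted_indices[OF K(1)] by simp
  have eq: "indicator {0..1} x * (\<Sum>j\<in>K. \<Sum>k\<in>pos j. c j k * per j k x) =
      indicator {0..1} x * (\<Sum>i\<in>shift_index ` ?S. d i * ?e i x)" for x :: real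
  proof (cases "x \<in> {0..1}")
    case True
    have "(\<Sum>i\<in>shift_index ` ?S. d i * ?e i x) = (\<Sum>t\<in>?S. d (shift_index t) * ?e (shift_index t) x)"
      using inj by (simp add: sum.reindex)
    also have "\<dots> = (\<Sum>(j, k, l)\<in>?S. c j k * e j (k - 2 ^ nat j * l) x)"
      by (intro sum.cong) (auto simp: d, auto simp: shift_index_def)
    also have "\<dots> = (\<Sum>j\<in>K. \<Sum>k\<in>pos j. c j k * per j k x)"
      unfolding sum_shifted_indices[OF K(1)] prod.case using K(2) True
      by (intro sum.cong refl) (auto simp: per_eq[of _ _ _ "{-N..N}"] sum_distrib_left)
    finally show ?thesis by simp
  qed simp
  have si: "square_integrable lborel (\<lambda>x. \<Sum>i\<in>shift_index ` ?S. d i * ?e i x)"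
    using I by (intro square_integrable_sum square_integrable_cmult orthonormal_basisD(1)[OF onb]) auto
  have "(LINT x|lborel. (indicator {0..1} x * (\<Sum>i\<in>shift_index ` ?S. d i * ?e i x))\<^sup>2)
      \<le> (LINT x|lborel. (\<Sum>i\<in>shift_index ` ?S. d i * ?e i x)\<^sup>2)"
    by (intro LINT_mono_square square_integrable_indicator si) (auto simp: indicator_def)
  also have "\<dots> = (\<Sum>i\<in>shift_index ` ?S. (d i)\<^sup>2)"
    by (rule orthonormal_sum_square[OF onb fin I])
  also have "\<dots> = (\<Sum>t\<in>?S. (d (shift_index t))\<^sup>2)"
    using inj by (simp add: sum.reindex)
  also have "\<dots> = (\<Sum>(j, k, l)\<in>?S. (c j k)\<^sup>2)"
    by (intro sum.cong) (auto simp: d)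
  also have "\<dots> = (\<Sum>j\<in>K. \<Sum>k\<in>pos j. \<Sum>l\<in>{-N..N}. (c j k)\<^sup>2)"
    unfolding sum_shifted_indices[OF K(1)] by simp
  also have "\<dots> = (2 * real_of_int N + 1) * (\<Sum>j\<in>K. \<Sum>k\<in>pos j. (c j k)\<^sup>2)"
    using N_nonneg by (simp add: sum_distrib_left)
  finally show ?thesis unfolding eq .
qed

text \<open>Residue and quotient of \<open>m\<close> give the position and the shift, so the finite
  list misses no line wavelet that is nonzero somewhere on the unit interval.\<close>

lemma shift_index_surj:
  assumes "-1 \<le> j" "x \<in> {0..1}" "e j m x \<noteq> 0" "j \<in> K"
  shows "(j, m) \<in> shift_index ` shifted_indices K"
proof -
  define k l where "k = m mod 2 ^ nat j" and "l = - (m div 2 ^ nat j)"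
  have m: "m = k - 2 ^ nat j * l"
    unfolding k_def l_def by simp
  have k: "k \<in> pos j"
    unfolding pos_eq[OF assms(1)] k_def by simp
  have "e j k (x + of_int l) \<noteq> 0"
    using assms m by (simp add: e_shift)
  then have "l \<in> {-N..N}"
    using e_support assms k by blast
  then have "(j, k, l) \<in> shifted_indices K"
    using assms k by (auto simp: shifted_indices_def)
  then show ?thesis
    unfolding m by (auto simp: shift_index_def intro!: image_eqI)
qed

section \<open>Completeness of the periodized expansion\<close>

lemma square_integrable_unit:
  fixes h :: "real \<Rightarrow> real"
  assumes "square_integrable (restrict_space lborel {0..1}) h"
  shows "square_integrable lborel (\<lambda>x. indicator {0..1} x * h x)"
proof -
  have int: "integrable (restrict_space lborel {0..1}) (\<lambda>x. (h x)\<^sup>2)"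
    and meas: "h \<in> borel_measurable (restrict_space lborel {0..1})"
    using assms by (auto simp: square_integrable_def)
  have unit: "{0..1::real} \<inter> space lborel \<in> sets lborel"
    by simp
  have "(indicator {0..1} x * h x)\<^sup>2 = indicator {0..1} x *\<^sub>R (h x)\<^sup>2" for x :: real
    by (auto simp: indicator_def)
  then show ?thesis
    using integrable_restrict_space[OF unit, THEN iffD1, OF int]
      borel_measurable_restrict_space_iff[OF unit, THEN iffD1, OF meas]
    by (simp add: square_integrable_def)
qed

text \<open>A periodic coefficient is the sum of the line coefficients of the zero extension over
  one residue class. This lets \<open>per_complete\<close> recognise the folded line
  expansion.\<close>

lemma coeff_eq:
  assumes h: "square_integrable (restrict_space lborel {0..1}) h" and jk: "-1 \<le> j" "k \<in> pos j"
  shows "wavelet_coeff \<phi> \<psi> h j k =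
    (\<Sum>l\<in>{-N..N}. LINT x|lborel. (indicator {0..1} x * h x) * e j (k - 2 ^ nat j * l) x)"
proof -
  have "wavelet_coeff \<phi> \<psi> h j k =
      (LINT x|lborel. (\<Sum>l\<in>{-N..N}. (indicator {0..1} x * h x) * e j (k - 2 ^ nat j * l) x))"
    unfolding wavelet_coeff_def set_lebesgue_integral_def
    by (intro Bochner_Integration.integral_cong refl)
      (auto simp: indicator_def per_eq[OF jk, of _ "{-N..N}"] sum_distrib_left)
  also have "\<dots> = (\<Sum>l\<in>{-N..N}. LINT x|lborel. (indicator {0..1} x * h x) * e j (k - 2 ^ nat j * l) x)"
    by (intro Bochner_Integration.integral_sum square_integrable_mult square_integrable_unit h
        e_square_integrable jk)
  finally show ?thesis .
qed


lemma residual_square_integrable: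
  assumes h: "square_integrable (restrict_space lborel {0..1}) h" and K: "K \<subseteq> {-1..}"
  shows "square_integrable lborel (\<lambda>x. indicator {0..1} x *
    (h x - (\<Sum>j\<in>K. \<Sum>k\<in>pos j. b j k * per j k x)))"
proof -
  have "indicator {0..1} x * (h x - (\<Sum>j\<in>K. \<Sum>k\<in>pos j. b j k * per j k x)) =
     indicator {0..1} x * h x -
       (\<Sum>j\<in>K. \<Sum>k\<in>pos j. b j k * (indicator {0..1} x * per j k x))" for x
    by (simp add: algebra_simps sum_distrib_left)
  moreover have "square_integrable lborel (\<lambda>x. indicator {0..1} x * h x -
       (\<Sum>j\<in>K. \<Sum>k\<in>pos j. b j k * (indicator {0..1} x * per j k x)))"
    using K by (intro square_integrable_diff square_integrable_unit h square_integrable_sum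
        square_integrable_cmult per_square_integrable) auto
  ultimately show ?thesis by simp
qed

text \<open>
  Project \<open>h\<close> (extended by zero) onto wavelets on the line.  Only the wavelets meeting the unit
  interval contribute, so the residual \<open>v\<close> is supported in a fixed interval, and periodizing it
  gives the residual of the periodized expansion.
\<close>

lemma per_complete:
  assumes h: "square_integrable (restrict_space lborel {0..1}) h" and \<delta>: "0 < \<delta>"
  shows "\<exists>m\<ge>m0. (LINT x|lborel. (indicator {0..1} x *
    (h x - (\<Sum>j\<in>{-1..m}. \<Sum>k\<in>pos j. wavelet_coeff \<phi> \<psi> h j k * per j k x)))\<^sup>2) < \<delta>"
proof -
  define u where "u x = indicator {0..1} x * h x" for x
  define c where "c i = (LINT x|lborel. u x * (case i of (j, k) \<Rightarrow> e j k) x)" for i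
  define D where "D = 4 * real_of_int N + 1"
  have D: "0 < D" using N_nonneg by (simp add: D_def)
  have u: "square_integrable lborel u"
    using square_integrable_unit[OF h] by (simp add: u_def[abs_def])
  have "\<forall>\<delta>>0. \<exists>F c. finite F \<and> F \<subseteq> {-1..} \<times> UNIV \<and>
      (LINT x|lborel. (u x - (\<Sum>i\<in>F. c i * (case i of (j, k) \<Rightarrow> e j k) x))\<^sup>2) < \<delta>"
    using onb u unfolding orthonormal_basis_def by blast
  \<comment> \<open>One factor \<open>D\<close> will be lost to Cauchy-Schwarz over the shifts, the
    other to the number of translates of the residual.\<close>
  then obtain F b where F: "finite F" "F \<subseteq> {-1..} \<times> UNIV"
    and b: "(LINT x|lborel. (u x - (\<Sum>i\<in>F. b i * (case i of (j, k) \<Rightarrow> e j k) x))\<^sup>2) < \<delta> / D\<^sup>2"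
    using \<delta> D by (meson divide_pos_pos zero_less_power)
  \<comment> \<open>All levels of \<open>F\<close> are included, so an index of \<open>F\<close>
    outside \<open>T\<close> belongs to a wavelet vanishing on the unit interval and has Fourier
    coefficient zero.\<close>
  define m where "m = Max (insert m0 (fst ` F))"
  have m: "m0 \<le> m" "\<And>i. i \<in> F \<Longrightarrow> fst i \<le> m"
    unfolding m_def using F(1) by (auto intro!: Max_ge)
  define K where "K = {-1..m}"
  have K: "finite K" "K \<subseteq> {-1..}" unfolding K_def by auto
  define T where "T = shift_index ` shifted_indices K"
  have T: "finite T" "T \<subseteq> {-1..} \<times> UNIV"
    using finite_shifted_indices[OF K(1)] K(2) by (auto simp: T_def shifted_indices_def shift_index_def)
  have c0: "c i = 0" if "i \<in> F - T" for i
  proof -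
    obtain j k where i: "i = (j, k)" by (cases i)
    have j: "-1 \<le> j" "j \<in> K"
      using that F(2) m(2)[of i] by (auto simp: i K_def)
    have "e j k x = 0" if "x \<in> {0..1}" for x
      using shift_index_surj[OF j(1) that _ j(2), of k] \<open>i \<in> F - T\<close> by (auto simp: i T_def)
    then have "(\<lambda>x. u x * e j k x) = (\<lambda>_. 0)"
      by (auto simp: u_def indicator_def)
    then show ?thesis by (simp add: c_def i)
  qed
  define v where "v x = u x - (\<Sum>i\<in>T. c i * (case i of (j, k) \<Rightarrow> e j k) x)" for x
  have v: "square_integrable lborel v"
    unfolding v_def using T
    by (intro square_integrable_diff u square_integrable_sum square_integrable_cmult
        orthonormal_basisD(1)[OF onb]) auto
  have "(LINT x|lborel. (v x)\<^sup>2) =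
      (LINT x|lborel. (u x - (\<Sum>i\<in>F \<union> T. c i * (case i of (j, k) \<Rightarrow> e j k) x))\<^sup>2)"
  proof -
    have "(\<Sum>i\<in>T. c i * (case i of (j, k) \<Rightarrow> e j k) x) =
        (\<Sum>i\<in>F \<union> T. c i * (case i of (j, k) \<Rightarrow> e j k) x)" for x
      using F(1) T(1) c0 by (intro sum.mono_neutral_left) auto
    then show ?thesis unfolding v_def by simp
  qed
  \<comment> \<open>On \<open>F \<union> T\<close> the Fourier coefficients are optimal, in
    particular no worse than \<open>b\<close> extended by zero.\<close>
  also have "\<dots> \<le> (LINT x|lborel. (u x - (\<Sum>i\<in>F \<union> T. (if i \<in> F then b i else 0) *
      (case i of (j, k) \<Rightarrow> e j k) x))\<^sup>2)"
    unfolding c_def using F T by (intro orthonormal_projection_le[OF onb] u) auto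
  also have "\<dots> = (LINT x|lborel. (u x - (\<Sum>i\<in>F. b i * (case i of (j, k) \<Rightarrow> e j k) x))\<^sup>2)"
  proof -
    have "(\<Sum>i\<in>F \<union> T. (if i \<in> F then b i else 0) * (case i of (j, k) \<Rightarrow> e j k) x) =
        (\<Sum>i\<in>F. b i * (case i of (j, k) \<Rightarrow> e j k) x)" for x
      using F(1) T(1) by (intro sum.mono_neutral_cong_right) auto
    then show ?thesis by simp
  qed
  finally have v_small: "(LINT x|lborel. (v x)\<^sup>2) < \<delta> / D\<^sup>2"
    using b by simp
  \<comment> \<open>Twice the basic window: after translation by any \<open>l'\<close> in
    \<open>{-N..N}\<close> it must still cover \<open>{-N..N}\<close>.\<close>
  define I where "I = {-2*N..2*N}"
  have I: "finite I" "0 \<in> I" "real (card I) = D"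
    using N_nonneg by (auto simp: I_def D_def)
  let ?r = "\<lambda>x. h x - (\<Sum>j\<in>K. \<Sum>k\<in>pos j. wavelet_coeff \<phi> \<psi> h j k * per j k x)"
  \<comment> \<open>The endpoints are excluded because 0 and 1 differ by an integer shift and both
    carry a value of \<open>h\<close>, so folding would add two values there.\<close>
  have v_sum: "(\<Sum>l\<in>I. v (x + of_int l)) = ?r x" if x: "x \<in> {0<..<1}" for x
  proof -
    have "u (x + of_int l) = (if l = 0 then h x else 0)" for l
    proof -
      have "x + of_int l \<in> {0..1} \<longleftrightarrow> l = 0"
        using x by (auto; cases "l \<ge> 1"; cases "l \<le> -1"; force)
      then show ?thesis using x by (auto simp: u_def indicator_def)
    qed
    then have "(\<Sum>l\<in>I. u (x + of_int l)) = h x"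
      using I by simp
    moreover have "(\<Sum>l\<in>I. \<Sum>i\<in>T. c i * (case i of (j, k) \<Rightarrow> e j k) (x + of_int l)) =
        (\<Sum>j\<in>K. \<Sum>k\<in>pos j. wavelet_coeff \<phi> \<psi> h j k * per j k x)"
    proof -
      have per: "(\<Sum>l\<in>I. e j (k - 2 ^ nat j * l') (x + of_int l)) = per j k x"
        if "-1 \<le> j" "k \<in> pos j" "l' \<in> {-N..N}" for j k l'
      proof -
        have "per j k x = (\<Sum>l\<in>(\<lambda>l. l + l') ` I. e j (k - 2 ^ nat j * l) x)"
        proof (rule per_eq)
          have "l \<in> (\<lambda>l. l + l') ` I" if "l \<in> {-N..N}" for l
            unfolding I_def using that \<open>l' \<in> {-N..N}\<close> by (intro image_eqI[of _ _ "l - l'"]) auto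
          then show "{-N..N} \<subseteq> (\<lambda>l. l + l') ` I" by blast
        qed (use that x I in auto)
        also have "\<dots> = (\<Sum>l\<in>I. e j (k - 2 ^ nat j * (l + l')) x)"
          by (subst sum.reindex) (auto simp: inj_on_def)
        finally show ?thesis
          using that by (simp add: e_shift algebra_simps)
      qed
      have "(\<Sum>l\<in>I. \<Sum>i\<in>T. c i * (case i of (j, k) \<Rightarrow> e j k) (x + of_int l)) =
          (\<Sum>i\<in>T. c i * (\<Sum>l\<in>I. (case i of (j, k) \<Rightarrow> e j k) (x + of_int l)))"
        by (subst sum.swap) (simp add: sum_distrib_left)
      also have "\<dots> = (\<Sum>t\<in>shifted_indices K. c (shift_index t) *
          (\<Sum>l\<in>I. (case shift_index t of (j, k) \<Rightarrow> e j k) (x + of_int l)))"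
        unfolding T_def using inj_shift_index[OF K(2)] by (simp add: sum.reindex)
      also have "\<dots> = (\<Sum>j\<in>K. \<Sum>k\<in>pos j. \<Sum>l'\<in>{-N..N}.
          (LINT y|lborel. u y * e j (k - 2 ^ nat j * l') y) * per j k x)"
        unfolding sum_shifted_indices[OF K(1)] using K(2)
        by (intro sum.cong refl) (auto simp: shift_index_def c_def per)
      also have "\<dots> = (\<Sum>j\<in>K. \<Sum>k\<in>pos j. wavelet_coeff \<phi> \<psi> h j k * per j k x)"
        using K(2) by (intro sum.cong refl) (auto simp: coeff_eq[OF h] u_def sum_distrib_right)
      finally show ?thesis .
    qed
    ultimately show ?thesis
      unfolding v_def by (simp add: sum_subtractf)
  qed
  have "(LINT x|lborel. (indicator {0..1} x * ?r x)\<^sup>2) =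
      (LINT x|lborel. (indicator {0..1} x * (\<Sum>l\<in>I. v (x + of_int l)))\<^sup>2)"
  proof (rule integral_cong_AE)
    have v_meas [measurable]: "v \<in> borel_measurable borel"
      using v by (simp add: square_integrable_def)
    show "(\<lambda>x. (indicator {0..1} x * (\<Sum>l\<in>I. v (x + of_int l)))\<^sup>2) \<in> borel_measurable lborel"
      by measurable
    show "(\<lambda>x. (indicator {0..1} x * ?r x)\<^sup>2) \<in> borel_measurable lborel"
      using residual_square_integrable[OF h K(2), of "wavelet_coeff \<phi> \<psi> h"]
      by (intro borel_measurable_power) (simp add: square_integrable_def)
    have "AE x in lborel. x \<noteq> (0::real) \<and> x \<noteq> 1"
      using AE_lborel_singleton[of "0::real"] AE_lborel_singleton[of "1::real"] by auto
    then show "AE x in lborel. (indicator {0..1} x * ?r x)\<^sup>2 =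
        (indicator {0..1} x * (\<Sum>l\<in>I. v (x + of_int l)))\<^sup>2"
    proof eventually_elim
      case (elim x)
      then show ?case
        using v_sum[of x] by (cases "x \<in> {0..1}") auto
    qed
  qed
  also have "\<dots> \<le> (LINT x|lborel. D * (\<Sum>l\<in>I. (v (x + of_int l))\<^sup>2))"
  proof (rule integral_mono)
    have "square_integrable lborel (\<lambda>x. indicator {0..1} x * (\<Sum>l\<in>I. v (x + of_int l)))"
      by (intro square_integrable_indicator square_integrable_sum square_integrable_shift v) simp
    then show "integrable lborel (\<lambda>x. (indicator {0..1} x * (\<Sum>l\<in>I. v (x + of_int l)))\<^sup>2)"
      by (simp add: square_integrable_def)
    show "integrable lborel (\<lambda>x. D * (\<Sum>l\<in>I. (v (x + of_int l))\<^sup>2))"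
      using square_integrable_shift(1)[OF v]
      by (intro integrable_mult_right Bochner_Integration.integrable_sum) (auto simp: square_integrable_def)
    fix x
    have "(indicator {0..1} x * (\<Sum>l\<in>I. v (x + of_int l)))\<^sup>2 \<le> (\<Sum>l\<in>I. v (x + of_int l))\<^sup>2"
      by (auto simp: indicator_def)
    also have "\<dots> \<le> D * (\<Sum>l\<in>I. (v (x + of_int l))\<^sup>2)"
      using sum_squared_le_sum_of_squares[of "\<lambda>l. v (x + of_int l)" I] by (simp add: I(3)[symmetric] mult.commute)
    finally show "(indicator {0..1} x * (\<Sum>l\<in>I. v (x + of_int l)))\<^sup>2 \<le>
      D * (\<Sum>l\<in>I. (v (x + of_int l))\<^sup>2)" .
  qed
  also have "\<dots> = D * (\<Sum>l\<in>I. LINT x|lborel. (v (x + of_int l))\<^sup>2)"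
    using square_integrable_shift(1)[OF v]
    by (subst integral_mult_right_zero, subst Bochner_Integration.integral_sum) (auto simp: square_integrable_def)
  also have "\<dots> = D * (D * (LINT x|lborel. (v x)\<^sup>2))"
    using I by (simp add: square_integrable_shift(2)[OF v])
  also have "\<dots> < \<delta>"
    using v_small D by (simp add: field_simps power2_eq_square)
  finally show ?thesis
    using m(1) unfolding K_def by blast
qed

section \<open>Bias and total loss over a Besov ball\<close>

lemma besov_level:
  assumes "h \<in> besov_ball \<phi> \<psi> s R" "-1 \<le> j"
  shows "(\<Sum>k\<in>pos j. (wavelet_coeff \<phi> \<psi> h j k)\<^sup>2) \<le> R\<^sup>2 * 2 powr (- (2 * s) * real_of_int j)"
proof -
  let ?S = "\<Sum>k\<in>pos j. (wavelet_coeff \<phi> \<psi> h j k)\<^sup>2"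
  have S: "0 \<le> ?S" by (simp add: sum_nonneg)
  have "2 powr (real_of_int j * s) * sqrt ?S \<le> R"
    using assms by (auto simp: besov_ball_def)
  then have "(2 powr (real_of_int j * s) * sqrt ?S)\<^sup>2 \<le> R\<^sup>2"
    using S by (intro power_mono) auto
  then have "2 powr (2 * s * j) * ?S \<le> R\<^sup>2"
  proof -
    have "(2 powr (real_of_int j * s))\<^sup>2 = 2 powr (2 * s * j)"
      by (simp add: power2_eq_square algebra_simps flip: powr_add)
    then show ?thesis
      using \<open>(2 powr (real_of_int j * s) * sqrt ?S)\<^sup>2 \<le> R\<^sup>2\<close> S by (simp add: power_mult_distrib)
  qed
  then have "2 powr (- (2 * s) * j) * (2 powr (2 * s * j) * ?S) \<le> 2 powr (- (2 * s) * j) * R\<^sup>2"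
    by (intro mult_left_mono) auto
  then show ?thesis
    by (simp add: mult.assoc[symmetric] mult.commute[of _ "R\<^sup>2"] flip: powr_add)
qed

text \<open>The 2 comes from splitting a square of a sum, \<open>2 N + 1\<close> from
  \<open>per_riesz\<close>, and the denominator from the geometric series over the omitted
  levels.\<close>

definition "bias_const s = 2 * (2 * real_of_int N + 1) / (1 - 2 powr (- (2 * s)))"

text \<open>The levels between \<open>m\<close> and a far level \<open>n\<close> are bounded by
  \<open>per_riesz\<close> and the Besov decay, uniformly in \<open>n\<close>; what remains beyond
  \<open>n\<close> is small by \<open>per_complete\<close>. The value \<open>m = -2\<close> is
  allowed on purpose: the expansion is then empty and the lemma bounds the norm of \<open>h\<close>
  itself.\<close>

lemma per_bias:
  assumes h: "h \<in> besov_ball \<phi> \<psi> s R" and s: "0 < s" and m: "-2 \<le> m"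
  shows "(LINT x|lborel. (indicator {0..1} x *
    (h x - (\<Sum>j\<in>{-1..m}. \<Sum>k\<in>pos j. wavelet_coeff \<phi> \<psi> h j k * per j k x)))\<^sup>2)
    \<le> bias_const s * R\<^sup>2 * 2 powr (- (2 * s) * real_of_int (m + 1))" (is "?I \<le> ?C")
\<comment> \<open>The level \<open>n\<close> supplied by completeness depends on \<delta>, hence the
  detour through an arbitrary \<delta>.\<close>
proof (rule field_le_epsilon)
  fix \<delta> :: real assume \<delta>: "0 < \<delta>"
  let ?c = "wavelet_coeff \<phi> \<psi> h"
  have hsi: "square_integrable (restrict_space lborel {0..1}) h"
    using h by (simp add: besov_ball_def)
  obtain n where n: "m \<le> n" and small: "(LINT x|lborel. (indicator {0..1} x *
    (h x - (\<Sum>j\<in>{-1..n}. \<Sum>k\<in>pos j. ?c j k * per j k x)))\<^sup>2) < \<delta> / 2"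
    using per_complete[OF hsi, of "\<delta> / 2" m] \<delta> by auto
  define K where "K = {m + 1..n}"
  have K: "finite K" "K \<subseteq> {-1..}" and disj: "{-1..n} = {-1..m} \<union> K" "{-1..m} \<inter> K = {}"
    using m n by (auto simp: K_def)
  define u where "u x = indicator {0..1} x * (h x - (\<Sum>j\<in>{-1..n}. \<Sum>k\<in>pos j. ?c j k * per j k x))" for x
  define v where "v x = indicator {0..1} x * (\<Sum>j\<in>K. \<Sum>k\<in>pos j. ?c j k * per j k x)" for x
  have u: "square_integrable lborel u"
    unfolding u_def by (intro residual_square_integrable hsi) auto
  have v: "square_integrable lborel v"
  proof -
    have "v = (\<lambda>x. \<Sum>j\<in>K. \<Sum>k\<in>pos j. ?c j k * (indicator {0..1} x * per j k x))"
      by (simp add: v_def fun_eq_iff sum_distrib_left algebra_simps)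
    then show ?thesis
      using K by (auto intro!: square_integrable_sum square_integrable_cmult per_square_integrable)
  qed
  have "?I = (LINT x|lborel. (u x + v x)\<^sup>2)"
    unfolding u_def v_def disj(1) by (simp add: sum.union_disjoint K(1) disj(2) algebra_simps)
  also have "\<dots> \<le> 2 * (LINT x|lborel. (u x)\<^sup>2) + 2 * (LINT x|lborel. (v x)\<^sup>2)"
    by (rule LINT_square_add_le[OF u v])
  also have "\<dots> \<le> \<delta> + 2 * (LINT x|lborel. (v x)\<^sup>2)"
    using small by (simp add: u_def)
  also have "(LINT x|lborel. (v x)\<^sup>2) \<le> (2 * real_of_int N + 1) *
      (R\<^sup>2 * (2 powr (- (2 * s) * real_of_int (m + 1)) / (1 - 2 powr (- (2 * s)))))"
  proof -
    have "(\<Sum>j\<in>K. \<Sum>k\<in>pos j. (?c j k)\<^sup>2) \<le> (\<Sum>j\<in>K. R\<^sup>2 * 2 powr (- (2 * s) * real_of_int j))"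
      using K(2) by (intro sum_mono besov_level[OF h]) auto
    also have "\<dots> = R\<^sup>2 * (\<Sum>j\<in>{m + 1..n}. 2 powr (- (2 * s) * real_of_int j))"
      by (simp add: sum_distrib_left K_def)
    also have "\<dots> \<le> R\<^sup>2 * (2 powr (- (2 * s) * real_of_int (m + 1)) / (1 - 2 powr (- (2 * s))))"
      using n s by (intro mult_left_mono sum_powr_le) auto
    finally show ?thesis
      using per_riesz[OF K, of ?c] N_nonneg unfolding v_def
      by (meson add_nonneg_nonneg mult_left_mono mult_nonneg_nonneg of_int_0_le_iff order_trans zero_le_numeral zero_le_one)
  qed
  finally have "?I \<le> \<delta> + 2 * ((2 * real_of_int N + 1) *
      (R\<^sup>2 * (2 powr (- (2 * s) * real_of_int (m + 1)) / (1 - 2 powr (- (2 * s))))))"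
    by simp
  moreover have "?C = 2 * ((2 * real_of_int N + 1) *
      (R\<^sup>2 * (2 powr (- (2 * s) * real_of_int (m + 1)) / (1 - 2 powr (- (2 * s))))))"
    by (simp add: bias_const_def)
  ultimately show "?I \<le> ?C + \<delta>"
    by linarith
qed

lemma per_loss:
  assumes h: "h \<in> besov_ball \<phi> \<psi> s R" and s: "0 < s" and m: "-2 \<le> m"
  shows "(LINT x|lborel. (indicator {0..1} x * (h x - (\<Sum>j\<in>{-1..m}. \<Sum>k\<in>pos j. b j k * per j k x)))\<^sup>2)
    \<le> 2 * (2 * real_of_int N + 1) * (\<Sum>j\<in>{-1..m}. \<Sum>k\<in>pos j. (b j k - wavelet_coeff \<phi> \<psi> h j k)\<^sup>2) +
      2 * (bias_const s * R\<^sup>2 * 2 powr (- (2 * s) * real_of_int (m + 1)))" (is "?I \<le> _")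
proof -
  let ?c = "wavelet_coeff \<phi> \<psi> h"
  have hsi: "square_integrable (restrict_space lborel {0..1}) h"
    using h by (simp add: besov_ball_def)
  define u where "u x = indicator {0..1} x * (h x - (\<Sum>j\<in>{-1..m}. \<Sum>k\<in>pos j. ?c j k * per j k x))" for x
  define v where "v x = indicator {0..1} x * (\<Sum>j\<in>{-1..m}. \<Sum>k\<in>pos j. (?c j k - b j k) * per j k x)" for x
  have u: "square_integrable lborel u"
    unfolding u_def by (intro residual_square_integrable hsi) auto
  have v: "square_integrable lborel v"
  proof -
    have "v = (\<lambda>x. \<Sum>j\<in>{-1..m}. \<Sum>k\<in>pos j. (?c j k - b j k) * (indicator {0..1} x * per j k x))"
      by (simp add: v_def fun_eq_iff sum_distrib_left algebra_simps)
    then show ?thesis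
      by (auto intro!: square_integrable_sum square_integrable_cmult per_square_integrable)
  qed
  have "?I = (LINT x|lborel. (u x + v x)\<^sup>2)"
    unfolding u_def v_def by (simp add: sum_subtractf algebra_simps)
  also have "\<dots> \<le> 2 * (LINT x|lborel. (u x)\<^sup>2) + 2 * (LINT x|lborel. (v x)\<^sup>2)"
    by (rule LINT_square_add_le[OF u v])
  also have "(LINT x|lborel. (v x)\<^sup>2) \<le>
      (2 * real_of_int N + 1) * (\<Sum>j\<in>{-1..m}. \<Sum>k\<in>pos j. (?c j k - b j k)\<^sup>2)"
    unfolding v_def by (rule per_riesz) auto
  also have "(LINT x|lborel. (u x)\<^sup>2) \<le> bias_const s * R\<^sup>2 * 2 powr (- (2 * s) * real_of_int (m + 1))"
    unfolding u_def by (rule per_bias[OF h s m])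
  finally show ?thesis
    unfolding power2_commute[of "wavelet_coeff _ _ _ _ _"] mult.assoc by linarith
qed

end

section \<open>The posterior median as a shrinkage rule\<close>

interpretation std_normal: real_distribution std_normal_distribution
  by (rule real_dist_normal_dist)

lemma continuous_std_normal_cdf: "isCont std_normal_cdf x"
proof -
  have "emeasure std_normal_distribution {x} = 0"
    by (simp add: emeasure_density nn_integral_indicator_singleton)
  then show ?thesis
    unfolding std_normal_cdf_def by (simp add: std_normal.isCont_cdf measure_def)
qed

lemma strict_mono_std_normal_cdf: "strict_mono std_normal_cdf"
proof (rule strict_monoI)
  fix x y :: real assume "x < y"
  have "emeasure std_normal_distribution {x<..y} \<noteq> 0"
  proof
    assume "emeasure std_normal_distribution {x<..y} = 0"
    then have "AE t in lborel. t \<notin> {x<..y}"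
      by (subst (asm) emeasure_density)
        (auto simp: nn_integral_0_iff_AE indicator_def normal_density_pos ennreal_eq_0_iff
          not_le less_imp_le normal_density_nonneg normal_density_pos[THEN not_le[THEN iffD2]] elim!: eventually_mono)
    then have "emeasure lborel {x<..y} = 0"
      by (subst (asm) AE_iff_measurable[of "{x<..y}"]) auto
    then show False using \<open>x < y\<close> by simp
  qed
  then have "0 < measure std_normal_distribution {x<..y}"
    by (simp add: std_normal.emeasure_eq_measure measure_nonneg less_le)
  then show "std_normal_cdf x < std_normal_cdf y"
    using std_normal.cdf_diff_eq[OF \<open>x < y\<close>] by (simp add: std_normal_cdf_def)
qed

text \<open>The quantile is taken at \<open>(1 + \<eta>) / 2\<close>. It is bounded below for all
  \<eta> in [0, 1), but above only while \<eta> stays away from 1; the limit 3/4 corresponds to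
  \<eta> = 1/2, where the case distinction of \<open>posterior_median_error\<close> is made.\<close>

lemma std_normal_quantile_bounds:
  obtains K :: real where "0 \<le> K"
    "\<And>y. 1 / 2 \<le> y \<Longrightarrow> y < 1 \<Longrightarrow> - K \<le> the_inv std_normal_cdf y"
    "\<And>y. 1 / 2 \<le> y \<Longrightarrow> y \<le> 3 / 4 \<Longrightarrow> the_inv std_normal_cdf y \<le> K"
proof -
  have ev_top: "\<forall>\<^sub>F x in at_top. c < std_normal_cdf x" if c: "c < 1" for c
    using order_tendstoD(1)[OF std_normal.cdf_lim_at_top_prob c] unfolding std_normal_cdf_def .
  have ev_bot: "\<forall>\<^sub>F x in at_bot. std_normal_cdf x < 1 / 2"
    using order_tendstoD(2)[OF std_normal.cdf_lim_at_bot, of "1 / 2"] unfolding std_normal_cdf_def by simp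
  obtain a where a: "std_normal_cdf a < 1 / 2"
    using eventually_happens[OF ev_bot] by auto
  obtain b where b: "3 / 4 < std_normal_cdf b"
    using eventually_happens[OF ev_top[of "3 / 4"]] by auto
  \<comment> \<open>\<open>the_inv\<close> is meaningful only on the range, so the intermediate
    value theorem must show that \<open>y\<close> is attained.\<close>
  have inv: "std_normal_cdf (the_inv std_normal_cdf y) = y" if y: "1 / 2 \<le> y" "y < 1" for y
  proof -
    obtain c where c: "y < std_normal_cdf c"
      using eventually_happens[OF ev_top[OF y(2)]] by auto
    have "a \<le> c"
      using a c y strict_mono_less_eq[OF strict_mono_std_normal_cdf, of a c] by simp
    then obtain x where "std_normal_cdf x = y"
      using IVT[of std_normal_cdf a y c] a c y continuous_std_normal_cdf by auto
    then have "y \<in> range std_normal_cdf" by auto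
    then show ?thesis
      by (rule f_the_inv_into_f[OF strict_mono_imp_inj_on[OF strict_mono_std_normal_cdf]])
  qed
  have lo: "a \<le> the_inv std_normal_cdf y" if "1 / 2 \<le> y" "y < 1" for y
    using inv[OF that] a that strict_mono_less_eq[OF strict_mono_std_normal_cdf, of a "the_inv std_normal_cdf y"]
    by simp
  have hi: "the_inv std_normal_cdf y \<le> b" if "1 / 2 \<le> y" "y \<le> 3 / 4" for y
    using inv[of y] b that strict_mono_less_eq[OF strict_mono_std_normal_cdf, of "the_inv std_normal_cdf y" b]
    by simp
  show ?thesis
  proof (rule that[of "max 0 (max (- a) b)"])
    show "- max 0 (max (- a) b) \<le> the_inv std_normal_cdf y" if "1 / 2 \<le> y" "y < 1" for y
      using lo[OF that] by linarith
    show "the_inv std_normal_cdf y \<le> max 0 (max (- a) b)" if "1 / 2 \<le> y" "y \<le> 3 / 4" for y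
      using hi[OF that] by linarith
  qed simp
qed

section \<open>Error of a single posterior median\<close>

text \<open>The odds are a prefactor, at most
  \<open>(1 + \<tau>\<^sup>2 / \<gamma>\<^sup>2) / p\<close>, times \<open>exp (- E)\<close>. If
  they reach one half, \<open>E\<close> is at most the logarithm of twice that bound, and
  \<open>E\<close> is proportional to \<open>b\<^sup>2\<close>.\<close>

lemma observation_le_of_odds_ge:
  assumes \<tau>: "0 < \<tau>" and \<gamma>: "0 < \<gamma>" and p: "0 < p" "p \<le> 1" and odds: "1 / 2 \<le> posterior_odds \<tau> p \<gamma> b"
  shows "b\<^sup>2 \<le> 2 * \<gamma>\<^sup>2 * (1 + \<gamma>\<^sup>2 / \<tau>\<^sup>2) * (ln (2 / p) + ln (1 + \<tau>\<^sup>2 / \<gamma>\<^sup>2))"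
proof -
  define E where "E = \<tau>\<^sup>2 * b\<^sup>2 / (2 * \<gamma>\<^sup>2 * (\<tau>\<^sup>2 + \<gamma>\<^sup>2))"
  have r: "sqrt (\<tau>\<^sup>2 + \<gamma>\<^sup>2) / \<gamma> = sqrt (1 + \<tau>\<^sup>2 / \<gamma>\<^sup>2)"
    using \<gamma> real_sqrt_divide[of "\<tau>\<^sup>2 + \<gamma>\<^sup>2" "\<gamma>\<^sup>2"] by (simp add: add_divide_distrib add.commute)
  have ge1: "1 \<le> 1 + \<tau>\<^sup>2 / \<gamma>\<^sup>2" by simp
  have "sqrt (1 + \<tau>\<^sup>2 / \<gamma>\<^sup>2) \<le> 1 + \<tau>\<^sup>2 / \<gamma>\<^sup>2"
    using ge1 by (intro real_le_lsqrt) (auto simp: power2_eq_square mult_le_cancel_left1)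
  moreover have "(1 - p) / p \<le> 1 / p"
    using p by (simp add: divide_right_mono)
  moreover have "0 \<le> (1 - p) / p" using p by simp
  ultimately have "(1 - p) / p * sqrt (1 + \<tau>\<^sup>2 / \<gamma>\<^sup>2) \<le> 1 / p * (1 + \<tau>\<^sup>2 / \<gamma>\<^sup>2)"
    using p by (intro mult_mono) auto
  then have "1 / 2 \<le> 1 / p * (1 + \<tau>\<^sup>2 / \<gamma>\<^sup>2) * exp (- E)"
    using odds unfolding posterior_odds_def r E_def[symmetric]
    by (meson exp_ge_zero mult_right_mono order_trans)
  then have "exp E \<le> 2 / p * (1 + \<tau>\<^sup>2 / \<gamma>\<^sup>2)"
    using p by (simp add: exp_minus field_simps)
  then have "E \<le> ln (2 / p * (1 + \<tau>\<^sup>2 / \<gamma>\<^sup>2))"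
    using ln_mono[of "exp E" "2 / p * (1 + \<tau>\<^sup>2 / \<gamma>\<^sup>2)"] exp_gt_zero[of E] by (metis ln_exp less_le_trans)
  also have "\<dots> = ln (2 / p) + ln (1 + \<tau>\<^sup>2 / \<gamma>\<^sup>2)"
    using p ge1 by (intro ln_mult_pos) (auto intro: add_pos_nonneg)
  finally have "2 * \<gamma>\<^sup>2 * (1 + \<gamma>\<^sup>2 / \<tau>\<^sup>2) * E \<le>
      2 * \<gamma>\<^sup>2 * (1 + \<gamma>\<^sup>2 / \<tau>\<^sup>2) * (ln (2 / p) + ln (1 + \<tau>\<^sup>2 / \<gamma>\<^sup>2))"
    by (intro mult_left_mono) auto
  moreover have "2 * \<gamma>\<^sup>2 * (1 + \<gamma>\<^sup>2 / \<tau>\<^sup>2) * E = b\<^sup>2"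
  proof -
    have "\<tau>\<^sup>2 + \<gamma>\<^sup>2 \<noteq> 0" using \<tau> by (simp add: sum_power2_eq_zero_iff)
    then show ?thesis
      using \<tau> \<gamma> unfolding E_def by (simp add: divide_simps)
  qed
  ultimately show ?thesis by simp
qed

text \<open>
  If the posterior odds of zero are at least one half, \<open>b\<close> itself is below the threshold up to a
  logarithm.  Otherwise the median shifts \<open>b\<close> by linear shrinkage plus a bounded multiple of \<open>\<gamma>\<close>.
\<close>

lemma posterior_median_error:
  assumes K: "0 \<le> K"
    "\<And>y. 1 / 2 \<le> y \<Longrightarrow> y < 1 \<Longrightarrow> - K \<le> the_inv std_normal_cdf y"
    "\<And>y. 1 / 2 \<le> y \<Longrightarrow> y \<le> 3 / 4 \<Longrightarrow> the_inv std_normal_cdf y \<le> K"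
    and \<tau>: "0 < \<tau>" and \<gamma>: "0 \<le> \<gamma>" "\<gamma> = 0 \<Longrightarrow> b = 0" and p: "0 < p" "p \<le> 1"
  shows "(posterior_median \<tau> p \<gamma> b - b)\<^sup>2 \<le> 2 * K\<^sup>2 * \<gamma>\<^sup>2 + 2 * (\<gamma>\<^sup>2 / (\<gamma>\<^sup>2 + \<tau>\<^sup>2) * b)\<^sup>2 +
    4 * \<gamma>\<^sup>2 * (1 + \<gamma>\<^sup>2 / \<tau>\<^sup>2) * (ln (2 / p) + ln (1 + \<tau>\<^sup>2 / \<gamma>\<^sup>2))"
proof (cases "\<gamma> = 0")
  case True
  then show ?thesis using \<gamma> by (simp add: posterior_median_def)
next
  case False
  then have \<gamma>0: "0 < \<gamma>" using \<gamma> by simp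
  define \<eta> where "\<eta> = posterior_odds \<tau> p \<gamma> b"
  define q where "q = the_inv std_normal_cdf ((1 + min \<eta> 1) / 2)"
  define t where "t = \<tau> * \<gamma> / sqrt (\<gamma>\<^sup>2 + \<tau>\<^sup>2)"
  define S where "S = \<gamma>\<^sup>2 / (\<gamma>\<^sup>2 + \<tau>\<^sup>2) * \<bar>b\<bar>"
  define Z where "Z = max 0 (\<tau>\<^sup>2 / (\<gamma>\<^sup>2 + \<tau>\<^sup>2) * \<bar>b\<bar> - t * q)"
  have S: "0 \<le> S" by (simp add: S_def)
  have \<eta>: "0 \<le> \<eta>" using p \<gamma>0 by (simp add: \<eta>_def posterior_odds_def)
  have t: "0 \<le> t" "t \<le> \<gamma>"
  proof -
    have "\<tau> \<le> sqrt (\<gamma>\<^sup>2 + \<tau>\<^sup>2)" using \<tau> by (simp add: real_le_rsqrt)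
    moreover have "0 < sqrt (\<gamma>\<^sup>2 + \<tau>\<^sup>2)" using \<tau> by (simp add: sum_power2_gt_zero_iff)
    ultimately show "t \<le> \<gamma>" "0 \<le> t"
      using \<gamma> \<tau> unfolding t_def by (auto simp: divide_le_eq mult.commute mult_left_mono)
  qed
  have shrink: "\<tau>\<^sup>2 / (\<gamma>\<^sup>2 + \<tau>\<^sup>2) * \<bar>b\<bar> = \<bar>b\<bar> - S"
  proof -
    have "\<gamma>\<^sup>2 + \<tau>\<^sup>2 \<noteq> 0" using \<tau> by (simp add: sum_power2_eq_zero_iff)
    then show ?thesis unfolding S_def by (simp add: divide_simps) (simp add: algebra_simps)
  qed
  have pm: "posterior_median \<tau> p \<gamma> b = (if 1 \<le> \<eta> then 0 else sgn b * Z)"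
    using False unfolding posterior_median_def Let_def \<eta>_def[symmetric] q_def[symmetric] t_def[symmetric] Z_def
    by simp
  have Zb: "\<bar>sgn b * Z - b\<bar> \<le> \<bar>Z - \<bar>b\<bar>\<bar>"
    by (cases b "0::real" rule: linorder_cases) (auto simp: sgn_if)
  let ?L = "ln (2 / p) + ln (1 + \<tau>\<^sup>2 / \<gamma>\<^sup>2)"
  have L: "0 \<le> ?L"
    using p by (intro add_nonneg_nonneg ln_ge_zero) auto
  have sq: "(x + y)\<^sup>2 \<le> 2 * x\<^sup>2 + 2 * y\<^sup>2" for x y :: real
    using zero_le_power2[of "x - y"] by (simp add: power2_sum power2_diff)
  show ?thesis
  proof (cases "1 / 2 \<le> \<eta>")
    case True
    have "\<bar>posterior_median \<tau> p \<gamma> b - b\<bar> \<le> K * \<gamma> + \<bar>b\<bar>"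
    proof (cases "1 \<le> \<eta>")
      case True
      then show ?thesis using K \<gamma> by (simp add: pm)
    next
      case False
      \<comment> \<open>Near \<eta> = 1 the quantile has no upper bound, but a large quantile only
        pushes \<open>Z\<close> down to 0, where the error is \<open>\<bar>b\<bar>\<close>. Only
        overshooting needs control, and the lower bound on \<open>q\<close> provides it.\<close>
      then have "- K \<le> q" using K(2) \<eta> by (simp add: q_def)
      then have "t * (- K) \<le> t * q" using t by (intro mult_left_mono)
      then have "- (t * q) \<le> \<gamma> * K" using t K(1) mult_right_mono[of t \<gamma> K] by simp
      then have "\<bar>Z - \<bar>b\<bar>\<bar> \<le> \<gamma> * K + \<bar>b\<bar>"
        using S K(1) \<gamma> mult_nonneg_nonneg[of \<gamma> K] unfolding Z_def shrink by linarith
      then show ?thesis using False Zb by (simp add: pm mult.commute)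
    qed
    then have "(posterior_median \<tau> p \<gamma> b - b)\<^sup>2 \<le> (K * \<gamma> + \<bar>b\<bar>)\<^sup>2"
      by (metis abs_ge_zero power2_abs power_mono)
    also have "\<dots> \<le> 2 * K\<^sup>2 * \<gamma>\<^sup>2 + 2 * b\<^sup>2"
      using sq[of "K * \<gamma>" "\<bar>b\<bar>"] by (simp add: power_mult_distrib)
    also have "b\<^sup>2 \<le> 2 * \<gamma>\<^sup>2 * (1 + \<gamma>\<^sup>2 / \<tau>\<^sup>2) * ?L"
      using observation_le_of_odds_ge[OF \<tau> \<gamma>0 p] True by (simp add: \<eta>_def)
    finally show ?thesis
      using zero_le_power2[of "\<gamma>\<^sup>2 / (\<gamma>\<^sup>2 + \<tau>\<^sup>2) * b"] by linarith
  next
    case False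
    \<comment> \<open>Now \<eta> < 1/2 places the argument of the quantile below 3/4, so both bounds
      apply.\<close>
    then have "- K \<le> q" "q \<le> K" using K(2,3)[of "(1 + min \<eta> 1) / 2"] \<eta> by (auto simp: q_def)
    then have "\<bar>t * q\<bar> \<le> \<gamma> * K"
      using t by (auto simp: abs_mult abs_le_iff intro!: mult_mono)
    then have "\<bar>Z - \<bar>b\<bar>\<bar> \<le> K * \<gamma> + S"
      using S unfolding Z_def shrink by (simp add: mult.commute)
    then have "\<bar>posterior_median \<tau> p \<gamma> b - b\<bar> \<le> K * \<gamma> + S"
      using False Zb by (simp add: pm)
    then have "(posterior_median \<tau> p \<gamma> b - b)\<^sup>2 \<le> (K * \<gamma> + S)\<^sup>2"
      by (metis abs_ge_zero power2_abs power_mono)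
    also have "\<dots> \<le> 2 * K\<^sup>2 * \<gamma>\<^sup>2 + 2 * S\<^sup>2"
      using sq[of "K * \<gamma>" S] by (simp add: power_mult_distrib)
    also have "S\<^sup>2 = (\<gamma>\<^sup>2 / (\<gamma>\<^sup>2 + \<tau>\<^sup>2) * b)\<^sup>2"
      by (simp add: S_def power_mult_distrib power_divide)
    finally have "(posterior_median \<tau> p \<gamma> b - b)\<^sup>2 \<le>
        2 * K\<^sup>2 * \<gamma>\<^sup>2 + 2 * (\<gamma>\<^sup>2 / (\<gamma>\<^sup>2 + \<tau>\<^sup>2) * b)\<^sup>2" .
    moreover have "0 \<le> 4 * \<gamma>\<^sup>2 * (1 + \<gamma>\<^sup>2 / \<tau>\<^sup>2) * ?L"
      using L by (intro mult_nonneg_nonneg) auto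
    ultimately show ?thesis by linarith
  qed
qed

text \<open>
  \<open>Q = n \<gamma>\<^sup>2\<close> is the quantity with bounded moments.  The term
  \<open>\<gamma>\<^sup>2 ln (1 + \<tau>\<^sup>2 / \<gamma>\<^sup>2)\<close> stays bounded for small \<open>\<gamma>\<close> because
  \<open>1 + \<tau>\<^sup>2 / \<gamma>\<^sup>2 \<le> (1 + n \<tau>\<^sup>2) (1 + 1 / Q)\<close> and \<open>ln (1 + 1 / Q) \<le> 1 / Q\<close>.
\<close>

lemma posterior_median_risk:
  assumes K: "0 \<le> K"
    "\<And>y. 1 / 2 \<le> y \<Longrightarrow> y < 1 \<Longrightarrow> - K \<le> the_inv std_normal_cdf y"
    "\<And>y. 1 / 2 \<le> y \<Longrightarrow> y \<le> 3 / 4 \<Longrightarrow> the_inv std_normal_cdf y \<le> K"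
    and \<tau>: "0 < \<tau>" and \<gamma>: "0 \<le> \<gamma>" "\<gamma> = 0 \<Longrightarrow> b = 0" and p: "0 < p" "p \<le> 1"
    and n: "0 < n" and c: "0 < c" "c \<le> n * \<tau>\<^sup>2" and Q: "Q = n * \<gamma>\<^sup>2"
    and \<Lambda>: "ln (2 / p) + ln (1 + n * \<tau>\<^sup>2) \<le> \<Lambda>" "1 \<le> \<Lambda>"
  shows "(posterior_median \<tau> p \<gamma> b - \<beta>)\<^sup>2 \<le>
    (4 * K\<^sup>2 + 16 + 16 / c) * (\<Lambda> / n) * (1 + Q\<^sup>2) + 10 * (b - \<beta>)\<^sup>2 + 8 * \<beta>\<^sup>2 * Q\<^sup>2 / (n * \<tau>\<^sup>2)\<^sup>2"
proof -
  have sq: "(x + y)\<^sup>2 \<le> 2 * x\<^sup>2 + 2 * y\<^sup>2" for x y :: real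
    using zero_le_power2[of "x - y"] by (simp add: power2_sum power2_diff)
  have Q0: "0 \<le> Q" using Q n by simp
  have \<gamma>Q: "\<gamma>\<^sup>2 = Q / n" using Q n by simp
  have nt: "0 < n * \<tau>\<^sup>2" using c by simp
  have g: "\<gamma>\<^sup>2 / \<tau>\<^sup>2 = Q / (n * \<tau>\<^sup>2)" using n by (simp add: \<gamma>Q)
  have le_c: "\<gamma>\<^sup>2 / \<tau>\<^sup>2 \<le> Q / c"
    unfolding g using c Q0 by (intro divide_left_mono) auto
  have Q1: "Q \<le> 1 + Q\<^sup>2" "1 \<le> 1 + Q\<^sup>2" "Q\<^sup>2 \<le> 1 + Q\<^sup>2"
    using zero_le_power2[of "Q - 1 / 2"] by (simp_all add: power2_eq_square algebra_simps)
  have \<Lambda>0: "0 \<le> \<Lambda>" "0 \<le> ln (2 / p) + ln (1 + n * \<tau>\<^sup>2)"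
    using \<Lambda> p nt by (auto intro!: add_nonneg_nonneg ln_ge_zero)
  have log: "\<gamma>\<^sup>2 * (ln (2 / p) + ln (1 + \<tau>\<^sup>2 / \<gamma>\<^sup>2)) \<le> (Q + 1) * (\<Lambda> / n)"
  proof (cases "\<gamma> = 0")
    case True
    then show ?thesis using Q0 \<Lambda>0 n by simp
  next
    case False
    then have Qp: "0 < Q" using n Q by simp
    have "1 + \<tau>\<^sup>2 / \<gamma>\<^sup>2 \<le> (1 + n * \<tau>\<^sup>2) * (1 + 1 / Q)"
    proof -
      have "\<tau>\<^sup>2 / \<gamma>\<^sup>2 = n * \<tau>\<^sup>2 / Q" using n False by (simp add: Q)
      then show ?thesis using Qp nt by (simp add: algebra_simps)
    qed
    then have "ln (1 + \<tau>\<^sup>2 / \<gamma>\<^sup>2) \<le> ln ((1 + n * \<tau>\<^sup>2) * (1 + 1 / Q))"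
      by (intro ln_mono) (auto intro: add_pos_nonneg)
    also have "\<dots> = ln (1 + n * \<tau>\<^sup>2) + ln (1 + 1 / Q)"
      using nt Qp by (intro ln_mult_pos) (auto intro: add_pos_pos)
    also have "ln (1 + 1 / Q) \<le> 1 / Q"
      using Qp by (intro ln_add_one_self_le_self) auto
    finally have "ln (2 / p) + ln (1 + \<tau>\<^sup>2 / \<gamma>\<^sup>2) \<le> \<Lambda> + 1 / Q"
      using \<Lambda> by simp
    then have "Q / n * (ln (2 / p) + ln (1 + \<tau>\<^sup>2 / \<gamma>\<^sup>2)) \<le> Q / n * (\<Lambda> + 1 / Q)"
      using Q0 n by (intro mult_left_mono) auto
    also have "\<dots> = Q * (\<Lambda> / n) + 1 / n"
      using Qp n by (simp add: field_simps)
    also have "\<dots> \<le> Q * (\<Lambda> / n) + \<Lambda> / n"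
      using \<Lambda> n by (simp add: divide_right_mono)
    finally show ?thesis unfolding \<gamma>Q by (simp only: distrib_right mult_1)
  qed
  define X where "X = 4 * \<gamma>\<^sup>2 * (1 + \<gamma>\<^sup>2 / \<tau>\<^sup>2) * (ln (2 / p) + ln (1 + \<tau>\<^sup>2 / \<gamma>\<^sup>2))"
  define Y where "Y = (\<gamma>\<^sup>2 / (\<gamma>\<^sup>2 + \<tau>\<^sup>2) * b)\<^sup>2"
  have X: "X \<le> (8 + 8 / c) * (\<Lambda> / n) * (1 + Q\<^sup>2)"
  proof -
    have "X = 4 * (1 + \<gamma>\<^sup>2 / \<tau>\<^sup>2) * (\<gamma>\<^sup>2 * (ln (2 / p) + ln (1 + \<tau>\<^sup>2 / \<gamma>\<^sup>2)))"
      by (simp add: X_def)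
    also have "\<dots> \<le> 4 * (1 + \<gamma>\<^sup>2 / \<tau>\<^sup>2) * ((Q + 1) * (\<Lambda> / n))"
      using log by (intro mult_left_mono) auto
    also have "\<dots> \<le> 4 * (1 + Q / c) * ((Q + 1) * (\<Lambda> / n))"
      using le_c Q0 \<Lambda>0 n by (intro mult_right_mono) auto
    also have "\<dots> = (4 * (1 + Q / c) * (Q + 1)) * (\<Lambda> / n)"
      by simp
    also have "\<dots> \<le> ((8 + 8 / c) * (1 + Q\<^sup>2)) * (\<Lambda> / n)"
    proof (rule mult_right_mono)
      have "(1 + Q / c) * (Q + 1) = (Q + 1) + (Q\<^sup>2 + Q) / c"
        using c by (simp add: field_simps power2_eq_square)
      also have "\<dots> \<le> 2 * (1 + Q\<^sup>2) + 2 * (1 + Q\<^sup>2) / c"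
      proof -
        have "Q + 1 \<le> 2 * (1 + Q\<^sup>2)" "Q\<^sup>2 + Q \<le> 2 * (1 + Q\<^sup>2)"
          using add_mono[OF Q1(1,2)] add_mono[OF Q1(3,1)] by simp_all
        then show ?thesis
          using c by (intro add_mono divide_right_mono) auto
      qed
      also have "\<dots> = (8 + 8 / c) * (1 + Q\<^sup>2) / 4"
        using c by (simp add: field_simps)
      finally show "4 * (1 + Q / c) * (Q + 1) \<le> (8 + 8 / c) * (1 + Q\<^sup>2)"
        by (simp only: le_divide_eq_numeral1 mult_ac)
    qed (use \<Lambda>0 n in auto)
    finally show ?thesis by (simp only: mult_ac)
  qed
  \<comment> \<open>The shrinkage factor \<open>w\<close> is random. It is bounded by 1 in front of
    the deviation and by \<open>\<gamma>\<^sup>2 / \<tau>\<^sup>2\<close> in front of the fixed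
    \<beta>, which keeps \<open>Q\<close> and \<open>b - \<beta>\<close> from being
    multiplied.\<close>
  have Y: "Y \<le> 2 * (b - \<beta>)\<^sup>2 + 2 * \<beta>\<^sup>2 * Q\<^sup>2 / (n * \<tau>\<^sup>2)\<^sup>2"
  proof -
    define w where "w = \<gamma>\<^sup>2 / (\<gamma>\<^sup>2 + \<tau>\<^sup>2)"
    have w: "0 \<le> w" "w \<le> 1" "w \<le> \<gamma>\<^sup>2 / \<tau>\<^sup>2"
      using \<tau> by (auto simp: w_def divide_le_eq_1 add_pos_pos add_nonneg_pos intro!: divide_left_mono)
    have "Y = (w * (b - \<beta>) + w * \<beta>)\<^sup>2"
      by (simp add: Y_def w_def[symmetric] algebra_simps)
    also have "\<dots> \<le> 2 * (w\<^sup>2 * (b - \<beta>)\<^sup>2) + 2 * (w\<^sup>2 * \<beta>\<^sup>2)"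
      using sq[of "w * (b - \<beta>)" "w * \<beta>"] by (simp add: power_mult_distrib)
    also have "w\<^sup>2 * (b - \<beta>)\<^sup>2 \<le> 1 * (b - \<beta>)\<^sup>2"
      using w by (intro mult_right_mono) (auto simp: power_le_one)
    also have "w\<^sup>2 * \<beta>\<^sup>2 \<le> (Q / (n * \<tau>\<^sup>2))\<^sup>2 * \<beta>\<^sup>2"
      using w unfolding g by (intro mult_right_mono power_mono) auto
    finally show ?thesis by (simp add: power_divide algebra_simps)
  qed
  have "2 * K\<^sup>2 * \<gamma>\<^sup>2 \<le> 2 * K\<^sup>2 * ((\<Lambda> / n) * (1 + Q\<^sup>2))"
  proof (rule mult_left_mono)
    have "\<gamma>\<^sup>2 = (1 / n) * Q" using \<gamma>Q by simp
    also have "\<dots> \<le> (\<Lambda> / n) * (1 + Q\<^sup>2)"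
      using \<Lambda> n Q0 Q1 by (intro mult_mono divide_right_mono) auto
    finally show "\<gamma>\<^sup>2 \<le> (\<Lambda> / n) * (1 + Q\<^sup>2)" .
  qed simp
  then have "(posterior_median \<tau> p \<gamma> b - b)\<^sup>2 \<le> (2 * K\<^sup>2) * ((\<Lambda> / n) * (1 + Q\<^sup>2)) + 2 * Y + X"
    using posterior_median_error[OF K \<tau> \<gamma> p] unfolding X_def Y_def by linarith
  \<comment> \<open>Passing from \<open>b\<close> to \<beta> doubles everything. The deviation
    receives \<open>4 * 2 + 2 = 10\<close> and the shrinkage term \<open>4 * 2 = 8\<close>.\<close>
  then have "2 * (posterior_median \<tau> p \<gamma> b - b)\<^sup>2 + 2 * (b - \<beta>)\<^sup>2 \<le>
      (4 * K\<^sup>2) * ((\<Lambda> / n) * (1 + Q\<^sup>2)) + 4 * Y + 2 * X + 2 * (b - \<beta>)\<^sup>2"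
    by simp
  also have "\<dots> \<le> (4 * K\<^sup>2) * ((\<Lambda> / n) * (1 + Q\<^sup>2)) + 4 * (2 * (b - \<beta>)\<^sup>2 + 2 * \<beta>\<^sup>2 * Q\<^sup>2 / (n * \<tau>\<^sup>2)\<^sup>2)
      + 2 * ((8 + 8 / c) * (\<Lambda> / n) * (1 + Q\<^sup>2)) + 2 * (b - \<beta>)\<^sup>2"
    using X Y by (intro add_mono mult_left_mono order_refl) auto
  also have "\<dots> = (4 * K\<^sup>2 + 16 + 16 / c) * (\<Lambda> / n) * (1 + Q\<^sup>2) + 10 * (b - \<beta>)\<^sup>2 +
      8 * \<beta>\<^sup>2 * Q\<^sup>2 / (n * \<tau>\<^sup>2)\<^sup>2"
    by (simp add: algebra_simps add_divide_distrib)
  finally show ?thesis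
    using sq[of "posterior_median \<tau> p \<gamma> b - b" "b - \<beta>"] by simp
qed

section \<open>Moments of the empirical coefficients\<close>

text \<open>Pairwise independence kills the mixed terms of the expanded square, and each diagonal
  term is a variance, hence at most the second moment.\<close>

lemma (in prob_space) mean_deviation:
  fixes W :: "nat \<Rightarrow> 'a \<Rightarrow> real"
  assumes indep: "\<And>i j. i \<noteq> j \<Longrightarrow> indep_var borel (W i) borel (W j)"
    and W: "\<And>i. square_integrable M (W i)" "\<And>i. expectation (W i) = \<mu>"
      "\<And>i. expectation (\<lambda>\<omega>. (W i \<omega>)\<^sup>2) \<le> V" and n: "0 < n"
  shows "square_integrable M (\<lambda>\<omega>. (1 / real n) * (\<Sum>i=1..n. W i \<omega>) - \<mu>)"
    and "expectation (\<lambda>\<omega>. ((1 / real n) * (\<Sum>i=1..n. W i \<omega>) - \<mu>)\<^sup>2) \<le> V / real n"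
proof -
  have const: "square_integrable M (\<lambda>_. c)" for c
    by (simp add: square_integrable_def)
  have int: "integrable M (W i)" for i
    using square_integrable_mult[OF W(1)[of i] const[of 1]] by simp
  define D where "D i \<omega> = W i \<omega> - \<mu>" for i \<omega>
  have D: "square_integrable M (D i)" for i
    unfolding D_def by (intro square_integrable_diff W const)
  have eq: "(1 / real n) * (\<Sum>i=1..n. W i \<omega>) - \<mu> = (1 / real n) * (\<Sum>i=1..n. D i \<omega>)" for \<omega>
    using n by (simp add: D_def sum_subtractf field_simps)
  show "square_integrable M (\<lambda>\<omega>. (1 / real n) * (\<Sum>i=1..n. W i \<omega>) - \<mu>)"
    unfolding eq by (intro square_integrable_cmult square_integrable_sum D)
  have cov: "expectation (\<lambda>\<omega>. D i \<omega> * D j \<omega>) = 0" if "i \<noteq> j" for i j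
  proof -
    have "expectation (\<lambda>\<omega>. D i \<omega> * D j \<omega>) =
        expectation (\<lambda>\<omega>. W i \<omega> * W j \<omega> - \<mu> * W i \<omega> - \<mu> * W j \<omega> + \<mu> * \<mu>)"
      by (simp add: D_def algebra_simps)
    also have "\<dots> = expectation (\<lambda>\<omega>. W i \<omega> * W j \<omega>) - \<mu> * \<mu> - \<mu> * \<mu> + \<mu> * \<mu>"
      using square_integrable_mult[OF W(1)[of i] W(1)[of j]] int W(2) by (simp add: prob_space)
    also have "\<dots> = 0"
      using indep_var_lebesgue_integral[OF indep[OF that] int int] W(2) by simp
    finally show ?thesis .
  qed
  have var: "expectation (\<lambda>\<omega>. D i \<omega> * D i \<omega>) \<le> V" for i
  proof -
    have "expectation (\<lambda>\<omega>. D i \<omega> * D i \<omega>) =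
        expectation (\<lambda>\<omega>. (W i \<omega>)\<^sup>2 - 2 * \<mu> * W i \<omega> + \<mu> * \<mu>)"
      by (simp add: D_def algebra_simps power2_eq_square)
    also have "\<dots> = expectation (\<lambda>\<omega>. (W i \<omega>)\<^sup>2) - \<mu> * \<mu>"
      using W(1)[of i] int W(2) by (simp add: prob_space square_integrable_def)
    also have "\<dots> \<le> V"
      using W(3)[of i] zero_le_square[of \<mu>] by linarith
    finally show ?thesis .
  qed
  have "(\<lambda>\<omega>. ((1 / real n) * (\<Sum>i=1..n. W i \<omega>) - \<mu>)\<^sup>2) =
      (\<lambda>\<omega>. (1 / real n)\<^sup>2 * (\<Sum>i=1..n. \<Sum>j=1..n. D i \<omega> * D j \<omega>))"
    unfolding eq power_mult_distrib by (simp add: power2_eq_square sum_product)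
  then have "expectation (\<lambda>\<omega>. ((1 / real n) * (\<Sum>i=1..n. W i \<omega>) - \<mu>)\<^sup>2) =
      (1 / real n)\<^sup>2 * (\<Sum>i=1..n. \<Sum>j=1..n. expectation (\<lambda>\<omega>. D i \<omega> * D j \<omega>))"
    using square_integrable_mult[OF D D] by (simp add: Bochner_Integration.integral_sum)
  also have "(\<Sum>i=1..n. \<Sum>j=1..n. expectation (\<lambda>\<omega>. D i \<omega> * D j \<omega>)) =
      (\<Sum>i=1..n. \<Sum>j=1..n. if i = j then expectation (\<lambda>\<omega>. D i \<omega> * D i \<omega>) else 0)"
    by (intro sum.cong refl) (simp add: cov)
  also have "\<dots> = (\<Sum>i=1..n. expectation (\<lambda>\<omega>. D i \<omega> * D i \<omega>))"
    by simp
  also have "(1 / real n)\<^sup>2 * \<dots> \<le> (1 / real n)\<^sup>2 * (\<Sum>i=1..n. V)"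
    by (intro mult_left_mono sum_mono var) auto
  also have "\<dots> = V / real n"
    using n by (simp add: power2_eq_square field_simps)
  finally show "expectation (\<lambda>\<omega>. ((1 / real n) * (\<Sum>i=1..n. W i \<omega>) - \<mu>)\<^sup>2) \<le> V / real n" .
qed

locale warped_design = compact_wavelets \<phi> \<psi> L B
  for \<phi> \<psi> :: "real \<Rightarrow> real" and L B +
  fixes M :: "'a measure" and X \<epsilon> :: "nat \<Rightarrow> 'a \<Rightarrow> real" and g :: "real \<Rightarrow> real" and \<sigma> m\<^sub>g :: real
  assumes \<sigma>: "0 < \<sigma>" and m\<^sub>g: "0 < m\<^sub>g" "\<And>x. x \<in> {0..1} \<Longrightarrow> m\<^sub>g \<le> g x"
    and design: "random_design M X \<epsilon> g \<sigma>"
begin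

sublocale prob_space M
  using design by (simp add: random_design_def)

section \<open>Law of the design and the uniform variables\<close>

definition "D = distr M borel (X 0)"
text \<open>The model gives information on the density only after cutting it off at the unit
  interval; even measurability is available only for this product.\<close>

definition "gdens x = indicator {0..1} x * g x"
text \<open>A substitute for \<open>G\<close> that agrees with it on the unit interval
  (\<open>G_eq_F\<close>). As a distribution function it is monotone, hence Borel, on the whole
  line, whatever \<open>g\<close> does elsewhere.\<close>

definition "F = cdf D"
abbreviation "G \<equiv> design_cdf g"
definition "U i \<omega> = F (X i \<omega>)"

lemma X_unit: "\<omega> \<in> space M \<Longrightarrow> X i \<omega> \<in> {0..1}"
  using design by (auto simp: random_design_def)

lemma X_distributed: "distributed M lborel (X i) (\<lambda>x. ennreal (gdens x))"
  using design by (simp add: random_design_def gdens_def)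

lemma \<epsilon>_distributed: "distributed M lborel (\<epsilon> i) (\<lambda>x. ennreal (normal_density 0 \<sigma> x))"
  using design by (simp add: random_design_def)

lemma X_measurable [measurable]: "X i \<in> borel_measurable M"
  using distributed_measurable[OF X_distributed[of i]] by simp

lemma \<epsilon>_measurable [measurable]: "\<epsilon> i \<in> borel_measurable M"
  using distributed_measurable[OF \<epsilon>_distributed[of i]] by simp

lemma gdens_nonneg: "0 \<le> gdens x"
  using m\<^sub>g by (auto simp: gdens_def indicator_def intro: order_trans[OF less_imp_le])

lemma gdens_measurable [measurable]: "gdens \<in> borel_measurable borel"
proof -
  have "(\<lambda>x. enn2real (ennreal (gdens x))) \<in> borel_measurable lborel"
    using distributed_borel_measurable[OF X_distributed[of 0]] by (rule borel_measurable_enn2real)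
  then show ?thesis by (simp add: gdens_nonneg)
qed

lemma distr_X: "distr M borel (X i) = density lborel (\<lambda>x. ennreal (gdens x))"
  using distributed_distr_eq_density[OF X_distributed[of i]]
  by (subst distr_cong[of M M borel lborel]) auto

lemma distr_X_eq: "distr M borel (X i) = D"
  unfolding D_def distr_X ..

sublocale D: real_distribution D
  unfolding D_def by (rule real_distribution_distr) simp

lemma nn_integral_gdens: "(\<integral>\<^sup>+x. ennreal (gdens x) \<partial>lborel) = 1"
  using D.emeasure_space_1 unfolding D_def distr_X by (simp add: emeasure_density)

lemma integrable_gdens: "integrable lborel gdens"
  using nn_integral_gdens by (intro integrableI_nn_integral_finite[of _ _ 1]) (auto simp: gdens_nonneg)

lemma F_eq_nn: "ennreal (F x) = (\<integral>\<^sup>+t. ennreal (gdens t) * indicator {..x} t \<partial>lborel)"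
proof -
  have "ennreal (F x) = emeasure D {..x}"
    by (simp add: F_def cdf_def D.emeasure_eq_measure)
  also have "\<dots> = (\<integral>\<^sup>+t. ennreal (gdens t) * indicator {..x} t \<partial>lborel)"
    unfolding D_def distr_X by (simp add: emeasure_density)
  finally show ?thesis .
qed

lemma G_eq_F: "x \<in> {0..1} \<Longrightarrow> G x = F x"
proof -
  assume x: "x \<in> {0..1}"
  have eq: "indicator {0..x} t * g t = gdens t * indicator {..x} t" for t
    using x by (auto simp: gdens_def indicator_def)
  have int: "integrable lborel (\<lambda>t. gdens t * indicator {..x} t)"
    by (intro integrable_real_mult_indicator integrable_gdens) simp
  have "ennreal (G x) = (\<integral>\<^sup>+t. ennreal (gdens t * indicator {..x} t) \<partial>lborel)"
    unfolding design_cdf_def set_lebesgue_integral_def real_scaleR_def eq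
    by (intro nn_integral_eq_integral[symmetric] int) (simp add: gdens_nonneg)
  also have "\<dots> = ennreal (F x)"
    unfolding F_eq_nn by (intro nn_integral_cong) (auto simp: indicator_def)
  finally show ?thesis
  proof (rule ennreal_inj[THEN iffD1, rotated 2])
    show "0 \<le> G x"
      unfolding design_cdf_def set_lebesgue_integral_def real_scaleR_def eq
      by (intro integral_nonneg_AE) (simp add: gdens_nonneg)
    show "0 \<le> F x" by (simp add: F_def D.cdf_nonneg)
  qed
qed

lemma F_measurable [measurable]: "F \<in> borel_measurable borel"
  by (intro borel_measurable_mono) (simp add: mono_def F_def D.cdf_nondecreasing)

lemma F_bounds: "0 \<le> F x" "F x \<le> 1"
  by (auto simp: F_def D.cdf_nonneg D.cdf_bounded_prob)

lemma F_0: "F 0 = 0"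
proof -
  have "(\<integral>\<^sup>+t. ennreal (gdens t) * indicator {..0} t \<partial>lborel) = (\<integral>\<^sup>+t. ennreal (gdens 0) * indicator {0::real} t \<partial>lborel)"
    by (intro nn_integral_cong) (auto simp: gdens_def indicator_def)
  then show ?thesis
    using F_eq_nn[of 0] F_bounds(1)[of 0] by (simp add: ennreal_eq_0_iff nn_integral_cmult_indicator)
qed

lemma F_1: "F 1 = 1"
proof -
  have "(\<integral>\<^sup>+t. ennreal (gdens t) * indicator {..1} t \<partial>lborel) = (\<integral>\<^sup>+t. ennreal (gdens t) \<partial>lborel)"
    by (intro nn_integral_cong) (auto simp: gdens_def indicator_def)
  then show ?thesis
    using F_eq_nn[of 1] F_bounds(1)[of 1] by (simp add: nn_integral_gdens flip: ennreal_1)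
qed

lemma F_diff:
  assumes "0 \<le> x" "x < y" "y \<le> 1"
  shows "m\<^sub>g * (y - x) \<le> F y - F x"
proof -
  have "ennreal (m\<^sub>g * (y - x)) = (\<integral>\<^sup>+t. ennreal m\<^sub>g * indicator {x<..y} t \<partial>lborel)"
    using m\<^sub>g assms by (simp add: nn_integral_cmult_indicator ennreal_mult)
  also have "\<dots> \<le> (\<integral>\<^sup>+t. ennreal (gdens t) * indicator {x<..y} t \<partial>lborel)"
    using m\<^sub>g assms by (intro nn_integral_mono) (auto simp: gdens_def indicator_def intro!: ennreal_leI)
  also have "\<dots> = emeasure D {x<..y}"
    unfolding D_def distr_X by (simp add: emeasure_density)
  also have "\<dots> = ennreal (F y - F x)"
    using D.cdf_diff_eq[OF assms(2)] by (simp add: D.emeasure_eq_measure F_def)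
  finally show ?thesis
    by (subst (asm) ennreal_le_iff) (auto simp: F_def D.cdf_nondecreasing assms less_imp_le)
qed

lemma F_le_iff: "x \<in> {0..1} \<Longrightarrow> y \<in> {0..1} \<Longrightarrow> F x \<le> F y \<longleftrightarrow> x \<le> y"
proof -
  assume xy: "x \<in> {0..1}" "y \<in> {0..1}"
  show ?thesis
  proof
    assume "F x \<le> F y"
    show "x \<le> y"
    proof (rule ccontr)
      assume "\<not> x \<le> y"
      then have "m\<^sub>g * (x - y) \<le> F x - F y" "0 < m\<^sub>g * (x - y)"
        using F_diff[of y x] xy m\<^sub>g by auto
      then show False using \<open>F x \<le> F y\<close> by linarith
    qed
  qed (simp add: F_def D.cdf_nondecreasing)
qed

lemma G_inj: "inj_on G {0..1}"
proof (rule inj_onI)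
  fix x y :: real assume xy: "x \<in> {0..1}" "y \<in> {0..1}" "G x = G y"
  then show "x = y"
    using F_le_iff[of x y] F_le_iff[of y x] by (simp add: G_eq_F)
qed

lemma F_isCont: "isCont F x"
proof -
  have "emeasure D {x} = (\<integral>\<^sup>+t. ennreal (gdens t) * indicator {x} t \<partial>lborel)"
    unfolding D_def distr_X by (simp add: emeasure_density)
  also have "\<dots> = (\<integral>\<^sup>+t. ennreal (gdens x) * indicator {x} t \<partial>lborel)"
    by (intro nn_integral_cong) (auto simp: indicator_def)
  also have "\<dots> = 0"
    by (simp add: nn_integral_cmult_indicator)
  finally show ?thesis
    unfolding F_def by (simp add: D.isCont_cdf measure_def)
qed

lemma U_measurable [measurable]: "U i \<in> borel_measurable M"
  unfolding U_def by measurable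

lemma U_unit: "U i \<omega> \<in> {0..1}"
  by (simp add: U_def F_bounds)

text \<open>Probability integral transform: the intermediate value theorem writes
  \<open>t = F x\<close>, and strict monotonicity on the unit interval turns
  \<open>U i \<le> t\<close> into \<open>X i \<le> x\<close>.\<close>

lemma U_uniform: "distributed M lborel (U i) (\<lambda>x. ennreal (indicator {0..1} x))"
proof -
  have "distributed M lborel (U i) (\<lambda>x. ennreal (indicator {0..1} x / measure lborel {0..1::real}))"
  proof (rule uniform_distrI_borel_atLeastAtMost)
    fix t :: real assume t: "0 \<le> t" "t \<le> 1"
    obtain x where x: "x \<in> {0..1}" "F x = t"
      using IVT[of F 0 t 1] t F_0 F_1 F_isCont by auto
    have "prob {\<omega> \<in> space M. U i \<omega> \<le> t} = prob {\<omega> \<in> space M. X i \<omega> \<le> x}"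
      unfolding U_def x(2)[symmetric] using F_le_iff[OF X_unit x(1)]
      by (intro arg_cong[where f = prob] Collect_cong conj_cong refl)
    also have "\<dots> = measure (distr M borel (X i)) {..x}"
      by (subst measure_distr) (auto intro!: arg_cong[where f = prob])
    also have "\<dots> = t"
      by (simp add: distr_X_eq x(2)[symmetric] F_def cdf_def)
    finally show "prob {\<omega> \<in> space M. U i \<omega> \<le> t} = (t - 0) / (1 - 0)" by simp
  qed simp_all
  then show ?thesis
    by simp
qed

lemma nn_integral_U:
  "q \<in> borel_measurable borel \<Longrightarrow> (\<integral>\<^sup>+\<omega>. q (U i \<omega>) \<partial>M) = (\<integral>\<^sup>+x. ennreal (indicator {0..1} x) * q x \<partial>lborel)"
  using distributed_nn_integral[OF U_uniform, of q i] by simp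

lemma expectation_U:
  fixes q :: "real \<Rightarrow> real"
  assumes [measurable]: "q \<in> borel_measurable borel"
  shows "expectation (\<lambda>\<omega>. q (U i \<omega>)) = (LINT x|lborel. indicator {0..1} x * q x)"
    and "integrable M (\<lambda>\<omega>. q (U i \<omega>)) \<longleftrightarrow> integrable lborel (\<lambda>x. indicator {0..1} x * q x)"
  using distributed_integral[OF U_uniform, of q i] distributed_integrable[OF U_uniform, of q i] by simp_all

lemma square_integrable_U:
  fixes q :: "real \<Rightarrow> real"
  assumes "square_integrable lborel (\<lambda>x. indicator {0..1} x * q x)" and [measurable]: "q \<in> borel_measurable borel"
  shows "square_integrable M (\<lambda>\<omega>. q (U i \<omega>))"
proof -
  have "(indicator {0..1} x * q x)\<^sup>2 = indicator {0..1} x * (q x)\<^sup>2" for x :: real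
    by (auto simp: indicator_def)
  then show ?thesis
    using assms expectation_U(2)[of "\<lambda>x. (q x)\<^sup>2" i] by (simp add: square_integrable_def)
qed

lemma \<epsilon>_moments:
  "square_integrable M (\<epsilon> i)" "expectation (\<epsilon> i) = 0" "expectation (\<lambda>\<omega>. (\<epsilon> i \<omega>)\<^sup>2) = \<sigma>\<^sup>2"
proof -
  have "has_bochner_integral lborel (\<lambda>x. normal_density 0 \<sigma> x * x\<^sup>2) (\<sigma>\<^sup>2)"
    using normal_moment_even[OF \<sigma>, of 0 1] \<sigma> by (simp add: fact_numeral)
  then have sq: "integrable lborel (\<lambda>x. normal_density 0 \<sigma> x * x\<^sup>2)"
    "(LINT x|lborel. normal_density 0 \<sigma> x * x\<^sup>2) = \<sigma>\<^sup>2"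
    by (auto simp: has_bochner_integral_iff)
  show "square_integrable M (\<epsilon> i)"
    using sq(1) distributed_integrable[OF \<epsilon>_distributed, of "\<lambda>x. x\<^sup>2" i] by (simp add: square_integrable_def)
  show "expectation (\<lambda>\<omega>. (\<epsilon> i \<omega>)\<^sup>2) = \<sigma>\<^sup>2"
    using sq(2) distributed_integral[OF \<epsilon>_distributed, of "\<lambda>x. x\<^sup>2" i] by simp
  show "expectation (\<epsilon> i) = 0"
    using distributed_integral[OF \<epsilon>_distributed, of "\<lambda>x. x" i] integral_normal_moment_nz_1[OF \<sigma>, of 0] by simp
qed

section \<open>Independence of the observations\<close>

lemma indep: "indep_vars (\<lambda>_. borel) (case_sum X \<epsilon>) UNIV"
  using design by (simp add: random_design_def)

text \<open>Design points and errors form one independent family, and the blocks consisting of the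
  design point and the error with the same index are disjoint for different indices.\<close>

lemma indep_observations:
  fixes H :: "real \<Rightarrow> real \<Rightarrow> real"
  assumes [measurable]: "(\<lambda>p. H (fst p) (snd p)) \<in> borel_measurable (borel \<Otimes>\<^sub>M borel)" and ij: "i \<noteq> j"
  shows "indep_var borel (\<lambda>\<omega>. H (U i \<omega>) (\<epsilon> i \<omega>)) borel (\<lambda>\<omega>. H (U j \<omega>) (\<epsilon> j \<omega>))"
proof -
  have meas: "(\<lambda>f. H (F (f (Inl i))) (f (Inr i))) \<in> borel_measurable (PiM {Inl i, Inr i} (\<lambda>_. borel))" for i :: nat
  proof -
    have "(\<lambda>f. (F (f (Inl i)), f (Inr i))) \<in> PiM {Inl i, Inr i} (\<lambda>_. borel) \<rightarrow>\<^sub>M borel \<Otimes>\<^sub>M borel"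
      by measurable
    from measurable_compose[OF this assms(1)] show ?thesis by simp
  qed
  have "indep_var (PiM {Inl i, Inr i} (\<lambda>_. borel)) (\<lambda>\<omega>. restrict (\<lambda>t. case_sum X \<epsilon> t \<omega>) {Inl i, Inr i})
      (PiM {Inl j, Inr j} (\<lambda>_. borel)) (\<lambda>\<omega>. restrict (\<lambda>t. case_sum X \<epsilon> t \<omega>) {Inl j, Inr j})"
    using ij by (intro indep_var_restrict[OF indep]) auto
  from indep_var_compose[OF this meas meas] show ?thesis
    by (simp add: comp_def U_def)
qed

lemma indep_U_\<epsilon>:
  fixes q :: "real \<Rightarrow> real"
  assumes [measurable]: "q \<in> borel_measurable borel" "r \<in> borel_measurable borel"
  shows "indep_var borel (\<lambda>\<omega>. q (U i \<omega>)) borel (\<lambda>\<omega>. r (\<epsilon> i \<omega>))"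
proof -
  have "indep_var (PiM {Inl i} (\<lambda>_. borel)) (\<lambda>\<omega>. restrict (\<lambda>t. case_sum X \<epsilon> t \<omega>) {Inl i})
      (PiM {Inr i} (\<lambda>_. borel)) (\<lambda>\<omega>. restrict (\<lambda>t. case_sum X \<epsilon> t \<omega>) {Inr i})"
    by (intro indep_var_restrict[OF indep]) auto
  moreover have "(\<lambda>f. q (F (f (Inl i)))) \<in> borel_measurable (PiM {Inl i} (\<lambda>_. borel))"
    "(\<lambda>f. r (f (Inr i))) \<in> borel_measurable (PiM {Inr i} (\<lambda>_. borel))"
    by measurable
  ultimately have "indep_var borel ((\<lambda>f. q (F (f (Inl i)))) \<circ> (\<lambda>\<omega>. restrict (\<lambda>t. case_sum X \<epsilon> t \<omega>) {Inl i}))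
      borel ((\<lambda>f. r (f (Inr i))) \<circ> (\<lambda>\<omega>. restrict (\<lambda>t. case_sum X \<epsilon> t \<omega>) {Inr i}))"
    by (rule indep_var_compose)
  then show ?thesis by (simp add: comp_def U_def)
qed


section \<open>Second moments of the noise level and of the empirical coefficients\<close>

text \<open>The cut-off makes the function Borel on the whole line, and it changes nothing at the
  arguments \<open>U i\<close>.\<close>

definition "w j k x = indicator {0..1} x * per j k x"
definition "D\<^sub>0 = 2 * real_of_int N + 1"

lemma D\<^sub>0_nonneg: "0 \<le> D\<^sub>0"
  using N_nonneg by (simp add: D\<^sub>0_def)

lemma w_measurable [measurable]: "-1 \<le> j \<Longrightarrow> k \<in> pos j \<Longrightarrow> w j k \<in> borel_measurable borel"
  using per_measurable unfolding w_def by simp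

lemma w_square_integrable: "-1 \<le> j \<Longrightarrow> k \<in> pos j \<Longrightarrow> square_integrable lborel (w j k)"
  using per_square_integrable unfolding w_def by simp

lemma w_abs_le:
  assumes "-1 \<le> j" "k \<in> pos j"
  shows "\<bar>w j k x\<bar> \<le> B1 * 2 powr (j / 2)"
  using per_abs_le[OF assms(1) _ assms(2), of x] B1_nonneg by (auto simp: w_def indicator_def)

lemma w_square_le:
  assumes "-1 \<le> j" "k \<in> pos j"
  shows "(w j k x)\<^sup>2 \<le> B1\<^sup>2 * 2 powr j"
proof -
  have "(w j k x)\<^sup>2 \<le> (B1 * 2 powr (j / 2))\<^sup>2"
    using power_mono[OF w_abs_le[OF assms, of x], of 2] by simp
  also have "\<dots> = B1\<^sup>2 * 2 powr j"
    by (simp add: power2_eq_square algebra_simps flip: powr_add)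
  finally show ?thesis .
qed

text \<open>\<open>per_riesz\<close> with a single coefficient equal to 1.\<close>

lemma w_norm_le:
  assumes "-1 \<le> j" "k \<in> pos j"
  shows "(LINT x|lborel. (w j k x)\<^sup>2) \<le> D\<^sub>0"
proof -
  have "(\<Sum>i\<in>pos j. (if i = k then 1 else 0) * per j i x) = per j k x" for x
    using assms by (simp add: if_distrib[of "\<lambda>c. c * _"] sum.delta cong: if_cong)
  moreover have "(\<Sum>i\<in>pos j. (if i = k then 1 else 0 :: real)\<^sup>2) = 1"
    using assms by (simp add: if_distrib[of "\<lambda>c. c ^ 2"] sum.delta cong: if_cong)
  ultimately show ?thesis
    using per_riesz[of "{j}" "\<lambda>_ i. if i = k then 1 else 0"] assms by (simp add: w_def D\<^sub>0_def)
qed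

lemma indicator_w [simp]: "indicator {0..1} x * w j k x = w j k x"
  by (simp add: w_def indicator_def)

lemma indicator_w_power [simp]: "indicator {0..1} x * (w j k x)\<^sup>2 = (w j k x)\<^sup>2"
  by (simp add: w_def indicator_def)

text \<open>The \<open>Q\<close> of \<open>posterior_median_risk\<close>, expressed through the
  uniform variables; \<open>scaled_noise_eq\<close> makes the link.\<close>

definition "scaled_noise j k n \<omega> = \<sigma>\<^sup>2 * ((1 / real n) * (\<Sum>i=1..n. (w j k (U i \<omega>))\<^sup>2))"

text \<open>Up to \<open>\<sigma>\<^sup>2\<close> this is an average of squared wavelets. Its mean
  is at most \<open>D\<^sub>0\<close>, and its variance is at most
  \<open>B1\<^sup>2 2\<^sup>j D\<^sub>0 / n\<close>, which stays bounded because
  \<open>2\<^sup>j \<le> n\<close>.\<close>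

lemma scaled_noise_moment:
  assumes jk: "-1 \<le> j" "k \<in> pos j" and n: "0 < n" "2 powr j \<le> real n"
  shows "square_integrable M (scaled_noise j k n)"
    and "expectation (\<lambda>\<omega>. (scaled_noise j k n \<omega>)\<^sup>2) \<le> \<sigma> ^ 4 * (2 * B1\<^sup>2 * D\<^sub>0 + 2 * D\<^sub>0\<^sup>2)"
proof -
  note [measurable] = w_measurable[OF jk]
  define W where "W i \<omega> = (w j k (U i \<omega>))\<^sup>2" for i \<omega>
  define \<mu> where "\<mu> = (LINT x|lborel. (w j k x)\<^sup>2)"
  define V where "V = B1\<^sup>2 * 2 powr j * D\<^sub>0"
  have \<mu>: "0 \<le> \<mu>" "\<mu> \<le> D\<^sub>0"
    using w_norm_le[OF jk] by (auto simp: \<mu>_def)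
  have w2: "square_integrable lborel (\<lambda>x. (w j k x)\<^sup>2)"
  proof (rule square_integrable_bound[OF w_square_integrable[OF jk]])
    show "\<bar>(w j k x)\<^sup>2\<bar> \<le> (B1 * 2 powr (j / 2)) * \<bar>w j k x\<bar>" for x
      using mult_right_mono[OF w_abs_le[OF jk, of x], of "\<bar>w j k x\<bar>"] by (simp add: power2_eq_square)
  qed simp
  have W: "square_integrable M (W i)" "expectation (W i) = \<mu>" for i
    unfolding W_def using square_integrable_U[of "\<lambda>x. (w j k x)\<^sup>2" i] w2
      expectation_U(1)[of "\<lambda>x. (w j k x)\<^sup>2" i] by (auto simp: \<mu>_def)
  have W2: "expectation (\<lambda>\<omega>. (W i \<omega>)\<^sup>2) \<le> V" for i
  proof -
    have eq: "indicator {0..1} x * ((w j k x)\<^sup>2)\<^sup>2 = ((w j k x)\<^sup>2)\<^sup>2" for x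
      by (simp add: w_def indicator_def)
    have "expectation (\<lambda>\<omega>. (W i \<omega>)\<^sup>2) = (LINT x|lborel. ((w j k x)\<^sup>2)\<^sup>2)"
      unfolding W_def using expectation_U(1)[of "\<lambda>x. ((w j k x)\<^sup>2)\<^sup>2" i] unfolding eq by measurable
    also have "\<dots> \<le> (LINT x|lborel. (B1\<^sup>2 * 2 powr j) * (w j k x)\<^sup>2)"
    proof (rule integral_mono)
      show "((w j k x)\<^sup>2)\<^sup>2 \<le> (B1\<^sup>2 * 2 powr j) * (w j k x)\<^sup>2" for x
        using mult_right_mono[OF w_square_le[OF jk, of x], of "(w j k x)\<^sup>2"]
        by (simp only: power2_eq_square[of "(w j k x)\<^sup>2"]) simp
    qed (use w2 w_square_integrable[OF jk] in \<open>auto simp: square_integrable_def\<close>)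
    also have "\<dots> = (B1\<^sup>2 * 2 powr j) * \<mu>"
      by (simp add: \<mu>_def)
    also have "\<dots> \<le> V"
      unfolding V_def using \<mu> by (intro mult_left_mono) auto
    finally show ?thesis .
  qed
  have indep: "indep_var borel (W i) borel (W i')" if "i \<noteq> i'" for i i'
    unfolding W_def by (intro indep_observations that) measurable
  define A where "A \<omega> = (1 / real n) * (\<Sum>i=1..n. W i \<omega>)" for \<omega>
  have A: "square_integrable M A"
    unfolding A_def by (intro square_integrable_cmult square_integrable_sum W)
  have dev: "square_integrable M (\<lambda>\<omega>. A \<omega> - \<mu>)" "expectation (\<lambda>\<omega>. (A \<omega> - \<mu>)\<^sup>2) \<le> V / n"
    using mean_deviation[OF indep W W2 n(1)] by (simp_all add: A_def)
  have const: "square_integrable M (\<lambda>_. \<mu>)"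
    by (simp add: square_integrable_def)
  have "expectation (\<lambda>\<omega>. (A \<omega>)\<^sup>2) = expectation (\<lambda>\<omega>. ((A \<omega> - \<mu>) + \<mu>)\<^sup>2)"
    by simp
  also have "\<dots> \<le> 2 * expectation (\<lambda>\<omega>. (A \<omega> - \<mu>)\<^sup>2) + 2 * expectation (\<lambda>_. \<mu>\<^sup>2)"
    by (rule LINT_square_add_le[OF dev(1) const])
  also have "\<dots> \<le> 2 * (B1\<^sup>2 * D\<^sub>0) + 2 * D\<^sub>0\<^sup>2"
  proof -
    have "V / n = B1\<^sup>2 * D\<^sub>0 * (2 powr j / n)" by (simp add: V_def)
    also have "\<dots> \<le> B1\<^sup>2 * D\<^sub>0 * 1"
      using n D\<^sub>0_nonneg by (intro mult_left_mono) auto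
    finally have "V / n \<le> B1\<^sup>2 * D\<^sub>0" by simp
    moreover have "\<mu>\<^sup>2 \<le> D\<^sub>0\<^sup>2" using \<mu> by (intro power_mono) auto
    ultimately show ?thesis using dev(2) by (simp add: prob_space)
  qed
  finally have A2: "expectation (\<lambda>\<omega>. (A \<omega>)\<^sup>2) \<le> 2 * B1\<^sup>2 * D\<^sub>0 + 2 * D\<^sub>0\<^sup>2" by simp
  have eq: "scaled_noise j k n = (\<lambda>\<omega>. \<sigma>\<^sup>2 * A \<omega>)"
    by (simp add: fun_eq_iff scaled_noise_def A_def W_def)
  show "square_integrable M (scaled_noise j k n)"
    unfolding eq by (rule square_integrable_cmult[OF A])
  have "expectation (\<lambda>\<omega>. (scaled_noise j k n \<omega>)\<^sup>2) = \<sigma> ^ 4 * expectation (\<lambda>\<omega>. (A \<omega>)\<^sup>2)"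
    unfolding eq by (simp add: power_mult_distrib)
  also have "\<dots> \<le> \<sigma> ^ 4 * (2 * B1\<^sup>2 * D\<^sub>0 + 2 * D\<^sub>0\<^sup>2)"
    using A2 by (intro mult_left_mono) auto
  finally show "expectation (\<lambda>\<omega>. (scaled_noise j k n \<omega>)\<^sup>2) \<le> \<sigma> ^ 4 * (2 * B1\<^sup>2 * D\<^sub>0 + 2 * D\<^sub>0\<^sup>2)" .
qed

definition "emp h j k n \<omega> = (1 / real n) * (\<Sum>i=1..n. w j k (U i \<omega>) * (indicator {0..1} (U i \<omega>) * h (U i \<omega>) + \<epsilon> i \<omega>))"

text \<open>Signal part \<open>P\<close> and noise part \<open>E\<close> are treated separately:
  \<open>P\<close> has the coefficient as its mean, and \<open>E\<close> is centred because the
  error is independent of the design. The integral containing \<open>h\<close> is left unevaluated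
  so that \<open>emp_deviation_sum\<close> can add it up over the positions.\<close>

lemma emp_deviation:
  assumes jk: "-1 \<le> j" "k \<in> pos j" and n: "0 < n"
    and h: "square_integrable (restrict_space lborel {0..1}) h"
  shows "square_integrable M (\<lambda>\<omega>. emp h j k n \<omega> - wavelet_coeff \<phi> \<psi> h j k)"
    and "expectation (\<lambda>\<omega>. (emp h j k n \<omega> - wavelet_coeff \<phi> \<psi> h j k)\<^sup>2) \<le>
      (2 * (LINT x|lborel. (w j k x)\<^sup>2 * (indicator {0..1} x * h x)\<^sup>2) + 2 * \<sigma>\<^sup>2 * D\<^sub>0) / real n"
proof -
  note [measurable] = w_measurable[OF jk]
  define u where "u x = indicator {0..1} x * h x" for x
  have u: "square_integrable lborel u"
    unfolding u_def by (rule square_integrable_unit[OF h])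
  have [measurable]: "u \<in> borel_measurable borel"
    using u by (simp add: square_integrable_def)
  define V where "V = 2 * (LINT x|lborel. (w j k x)\<^sup>2 * (u x)\<^sup>2) + 2 * \<sigma>\<^sup>2 * D\<^sub>0"
  have ind: "indicator {0..1} x * (w j k x * u x) = w j k x * u x" for x
    by (simp add: u_def w_def indicator_def)
  have wu: "square_integrable lborel (\<lambda>x. w j k x * u x)"
    using w_abs_le[OF jk] by (intro square_integrable_bound[OF u, of _ "B1 * 2 powr (j / 2)"])
      (auto simp: abs_mult intro: mult_right_mono)
  define P where "P i \<omega> = w j k (U i \<omega>) * u (U i \<omega>)" for i \<omega>
  define E where "E i \<omega> = w j k (U i \<omega>) * \<epsilon> i \<omega>" for i \<omega>
  define W where "W i \<omega> = w j k (U i \<omega>) * (u (U i \<omega>) + \<epsilon> i \<omega>)" for i \<omega>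
  have W_eq: "W i = (\<lambda>\<omega>. P i \<omega> + E i \<omega>)" for i
    by (simp add: W_def P_def E_def fun_eq_iff algebra_simps)
  have const: "square_integrable M (\<lambda>_. 1)"
    by (simp add: square_integrable_def)
  have P: "square_integrable M (P i)" for i
    unfolding P_def using square_integrable_U[of "\<lambda>x. w j k x * u x" i] wu by (simp add: ind)
  have E: "square_integrable M (E i)" for i
    unfolding E_def using w_abs_le[OF jk]
    by (intro square_integrable_bound[OF \<epsilon>_moments(1)[of i], of _ "B1 * 2 powr (j / 2)"])
      (auto simp: abs_mult intro: mult_right_mono)
  have P1: "expectation (P i) = wavelet_coeff \<phi> \<psi> h j k" for i
  proof -
    have "expectation (P i) = (LINT x|lborel. w j k x * u x)"
      unfolding P_def using expectation_U(1)[of "\<lambda>x. w j k x * u x" i] by (simp add: ind)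
    also have "\<dots> = wavelet_coeff \<phi> \<psi> h j k"
      unfolding wavelet_coeff_def set_lebesgue_integral_def
      by (intro Bochner_Integration.integral_cong) (auto simp: w_def u_def indicator_def)
    finally show ?thesis .
  qed
  have P2: "expectation (\<lambda>\<omega>. (P i \<omega>)\<^sup>2) = (LINT x|lborel. (w j k x)\<^sup>2 * (u x)\<^sup>2)" for i
  proof -
    have "indicator {0..1} x * (w j k x * u x)\<^sup>2 = (w j k x)\<^sup>2 * (u x)\<^sup>2" for x
      by (simp add: u_def w_def indicator_def power_mult_distrib)
    then show ?thesis
      unfolding P_def using expectation_U(1)[of "\<lambda>x. (w j k x * u x)\<^sup>2" i] by simp
  qed
  have E1: "expectation (E i) = 0" for i
  proof -
    have "square_integrable M (\<lambda>\<omega>. w j k (U i \<omega>))"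
      using square_integrable_U[of "w j k" i] w_square_integrable[OF jk] by simp
    from square_integrable_mult[OF this const] have w: "integrable M (\<lambda>\<omega>. w j k (U i \<omega>))"
      by simp
    have e: "integrable M (\<epsilon> i)"
      using square_integrable_mult[OF \<epsilon>_moments(1)[of i] const] by simp
    have "indep_var borel (\<lambda>\<omega>. w j k (U i \<omega>)) borel (\<epsilon> i)"
      by (rule indep_U_\<epsilon>[of "w j k" "\<lambda>x. x" i]) measurable
    from indep_var_lebesgue_integral[OF this w e] show ?thesis
      unfolding E_def by (simp add: \<epsilon>_moments(2))
  qed
  have E2: "expectation (\<lambda>\<omega>. (E i \<omega>)\<^sup>2) \<le> \<sigma>\<^sup>2 * D\<^sub>0" for i
  proof -
    have "square_integrable M (\<lambda>\<omega>. w j k (U i \<omega>))"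
      using square_integrable_U[of "w j k" i] w_square_integrable[OF jk] by simp
    then have we: "integrable M (\<lambda>\<omega>. (w j k (U i \<omega>))\<^sup>2)" "integrable M (\<lambda>\<omega>. (\<epsilon> i \<omega>)\<^sup>2)"
      using \<epsilon>_moments(1)[of i] by (auto simp: square_integrable_def)
    have "indep_var borel (\<lambda>\<omega>. (w j k (U i \<omega>))\<^sup>2) borel (\<lambda>\<omega>. (\<epsilon> i \<omega>)\<^sup>2)"
      by (rule indep_U_\<epsilon>[of "\<lambda>x. (w j k x)\<^sup>2" "\<lambda>x. x\<^sup>2" i]) measurable
    from indep_var_lebesgue_integral[OF this we] have "expectation (\<lambda>\<omega>. (E i \<omega>)\<^sup>2) = expectation (\<lambda>\<omega>. (w j k (U i \<omega>))\<^sup>2) * \<sigma>\<^sup>2"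
      unfolding E_def power_mult_distrib by (simp add: \<epsilon>_moments(3))
    also have "expectation (\<lambda>\<omega>. (w j k (U i \<omega>))\<^sup>2) = (LINT x|lborel. (w j k x)\<^sup>2)"
      using expectation_U(1)[of "\<lambda>x. (w j k x)\<^sup>2" i] by simp
    also have "\<dots> * \<sigma>\<^sup>2 \<le> D\<^sub>0 * \<sigma>\<^sup>2"
      using w_norm_le[OF jk] by (intro mult_right_mono) auto
    finally show ?thesis by (simp add: mult.commute)
  qed
  have W: "square_integrable M (W i)" for i
    unfolding W_eq by (intro square_integrable_add P E)
  have W1: "expectation (W i) = wavelet_coeff \<phi> \<psi> h j k" for i
  proof -
    have "integrable M (P i)" "integrable M (E i)"
      using square_integrable_mult[OF P[of i] const] square_integrable_mult[OF E[of i] const] by simp_all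
    then show ?thesis unfolding W_eq by (simp add: P1 E1)
  qed
  have W2: "expectation (\<lambda>\<omega>. (W i \<omega>)\<^sup>2) \<le> V" for i
    unfolding W_eq using LINT_square_add_le[OF P[of i] E[of i]] E2[of i] by (simp add: V_def P2)
  have indep: "indep_var borel (W i) borel (W i')" if "i \<noteq> i'" for i i'
    unfolding W_def by (intro indep_observations that) measurable
  show "square_integrable M (\<lambda>\<omega>. emp h j k n \<omega> - wavelet_coeff \<phi> \<psi> h j k)"
    "expectation (\<lambda>\<omega>. (emp h j k n \<omega> - wavelet_coeff \<phi> \<psi> h j k)\<^sup>2) \<le>
      (2 * (LINT x|lborel. (w j k x)\<^sup>2 * (indicator {0..1} x * h x)\<^sup>2) + 2 * \<sigma>\<^sup>2 * D\<^sub>0) / real n"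
    using mean_deviation[OF indep W W1 W2 n] by (simp_all add: emp_def W_def V_def u_def)
qed

text \<open>
  Summing over \<open>k\<close> first is essential: \<open>h\<close> need not be bounded, but
  \<open>\<Sum>k. (per j k x)\<^sup>2 \<le> B1\<^sup>2 2\<^sup>j\<close> pointwise.
\<close>

lemma emp_deviation_sum:
  assumes j: "-1 \<le> j" and n: "0 < n"
    and h: "square_integrable (restrict_space lborel {0..1}) h"
    and H: "(LINT x|lborel. (indicator {0..1} x * h x)\<^sup>2) \<le> H"
  shows "(\<Sum>k\<in>pos j. expectation (\<lambda>\<omega>. (emp h j k n \<omega> - wavelet_coeff \<phi> \<psi> h j k)\<^sup>2)) \<le>
      (2 * B1\<^sup>2 * H + 4 * \<sigma>\<^sup>2 * D\<^sub>0) * (2 powr j / real n)"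
proof -
  define u where "u x = indicator {0..1} x * h x" for x
  have u: "square_integrable lborel u"
    unfolding u_def by (rule square_integrable_unit[OF h])
  have [measurable]: "u \<in> borel_measurable borel"
    using u by (simp add: square_integrable_def)
  have int: "integrable lborel (\<lambda>x. (w j k x)\<^sup>2 * (u x)\<^sup>2)" if k: "k \<in> pos j" for k
  proof -
    note [measurable] = w_measurable[OF j k]
    have "square_integrable lborel (\<lambda>x. w j k x * u x)"
      using w_abs_le[OF j k] by (intro square_integrable_bound[OF u, of _ "B1 * 2 powr (j / 2)"])
        (auto simp: abs_mult intro: mult_right_mono)
    then show ?thesis by (simp add: square_integrable_def power_mult_distrib)
  qed
  note card = card_pos_le[OF j]
  have "(\<Sum>k\<in>pos j. LINT x|lborel. (w j k x)\<^sup>2 * (u x)\<^sup>2) = (LINT x|lborel. (\<Sum>k\<in>pos j. (w j k x)\<^sup>2 * (u x)\<^sup>2))"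
    using int by (simp add: Bochner_Integration.integral_sum)
  also have "\<dots> \<le> (LINT x|lborel. (B1\<^sup>2 * 2 powr j) * (u x)\<^sup>2)"
  proof (rule integral_mono)
    show "integrable lborel (\<lambda>x. \<Sum>k\<in>pos j. (w j k x)\<^sup>2 * (u x)\<^sup>2)"
      by (intro Bochner_Integration.integrable_sum int)
    show "integrable lborel (\<lambda>x. (B1\<^sup>2 * 2 powr j) * (u x)\<^sup>2)"
      using u by (simp add: square_integrable_def)
    show "(\<Sum>k\<in>pos j. (w j k x)\<^sup>2 * (u x)\<^sup>2) \<le> (B1\<^sup>2 * 2 powr j) * (u x)\<^sup>2" for x
    proof (cases "x \<in> {0..1}")
      case True
      then have "(\<Sum>k\<in>pos j. (w j k x)\<^sup>2) \<le> B1\<^sup>2 * 2 powr j"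
        using per_sum_square_le[OF j True] by (simp add: w_def)
      then show ?thesis
        unfolding sum_distrib_right[symmetric] by (intro mult_right_mono) auto
    qed (simp add: u_def)
  qed
  also have "\<dots> \<le> (B1\<^sup>2 * 2 powr j) * H"
    using H by (simp add: u_def mult_left_mono)
  finally have S: "(\<Sum>k\<in>pos j. LINT x|lborel. (w j k x)\<^sup>2 * (u x)\<^sup>2) \<le> (B1\<^sup>2 * 2 powr j) * H" .
  have "(\<Sum>k\<in>pos j. expectation (\<lambda>\<omega>. (emp h j k n \<omega> - wavelet_coeff \<phi> \<psi> h j k)\<^sup>2)) \<le>
     (\<Sum>k\<in>pos j. (2 * (LINT x|lborel. (w j k x)\<^sup>2 * (u x)\<^sup>2) + 2 * \<sigma>\<^sup>2 * D\<^sub>0) / real n)"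
    unfolding u_def using emp_deviation(2)[OF j _ n h] by (intro sum_mono) auto
  also have "\<dots> = (2 * (\<Sum>k\<in>pos j. LINT x|lborel. (w j k x)\<^sup>2 * (u x)\<^sup>2) + 2 * \<sigma>\<^sup>2 * D\<^sub>0 * card (pos j)) / real n"
    by (simp add: sum_divide_distrib[symmetric] sum.distrib sum_distrib_left)
  also have "\<dots> \<le> (2 * ((B1\<^sup>2 * 2 powr j) * H) + 2 * \<sigma>\<^sup>2 * D\<^sub>0 * (2 * 2 powr j)) / real n"
    using S card D\<^sub>0_nonneg by (intro divide_right_mono add_mono mult_left_mono) auto
  also have "\<dots> = (2 * B1\<^sup>2 * H + 4 * \<sigma>\<^sup>2 * D\<^sub>0) * (2 powr j / real n)"
    by (simp add: algebra_simps add_divide_distrib)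
  finally show ?thesis .
qed

end

section \<open>Risk of the warped estimator\<close>

locale posterior_median_setting = warped_design \<phi> \<psi> L B M X \<epsilon> g \<sigma> m\<^sub>g
  for \<phi> \<psi> :: "real \<Rightarrow> real" and L B and M :: "'a measure" and X \<epsilon> g \<sigma> m\<^sub>g +
  fixes \<alpha> \<beta> c\<^sub>1 c\<^sub>2 s R :: real and J :: "nat \<Rightarrow> real"
  assumes \<beta>: "0 \<le> \<beta>" and c\<^sub>1: "0 < c\<^sub>1" and c\<^sub>2: "0 < c\<^sub>2"
    and J: "\<And>n. 1 \<le> n \<Longrightarrow> 2 powr J n = (3 / (2 * real n)) powr (- 1 / \<alpha>)"
    and s: "0 < s" and \<alpha>: "1 < \<alpha>" "s \<le> \<alpha>"
begin

definition "\<tau> j = sqrt (c\<^sub>1 * 2 powr (- (real_of_int j * \<alpha>)))"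
definition "p j = min 1 (c\<^sub>2 * 2 powr (- (real_of_int j * \<beta>)))"
definition "fhat n f \<omega> = warped_estimator \<phi> \<psi> G \<sigma> \<tau> p (J n) n (\<lambda>i. X i \<omega>) (\<lambda>i. f (X i \<omega>) + \<epsilon> i \<omega>)"
definition "unwarp f = f \<circ> the_inv_into {0..1} G"

definition "obs_scale j k n \<omega> = emp_scale (\<lambda>u. per j k (G u)) \<sigma> n (\<lambda>i. X i \<omega>)"
definition "obs_coeff f j k n \<omega> = emp_coeff (\<lambda>u. per j k (G u)) n (\<lambda>i. X i \<omega>) (\<lambda>i. f (X i \<omega>) + \<epsilon> i \<omega>)"
definition "post_median f j k n \<omega> = posterior_median (\<tau> j) (p j) (obs_scale j k n \<omega>) (obs_coeff f j k n \<omega>)"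

lemma \<tau>_pos: "0 < \<tau> j"
  using c\<^sub>1 by (simp add: \<tau>_def)

lemma \<tau>_square: "(\<tau> j)\<^sup>2 = c\<^sub>1 * 2 powr (- (real_of_int j * \<alpha>))"
  using c\<^sub>1 by (simp add: \<tau>_def)

lemma p_bounds: "0 < p j" "p j \<le> 1"
  using c\<^sub>2 by (auto simp: p_def)

lemma unwarp_G: "x \<in> {0..1} \<Longrightarrow> unwarp f (G x) = f x"
  by (simp add: unwarp_def the_inv_into_f_f[OF G_inj])

lemma G_X: "\<omega> \<in> space M \<Longrightarrow> G (X i \<omega>) = U i \<omega>"
  using X_unit[of \<omega> i] by (simp add: G_eq_F U_def)

lemma coeff_eq_emp:
  assumes "\<omega> \<in> space M"
  shows "obs_coeff f j k n \<omega> = emp (unwarp f) j k n \<omega>"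
proof -
  have "per j k (G (X i \<omega>)) * (f (X i \<omega>) + \<epsilon> i \<omega>) =
      w j k (U i \<omega>) * (indicator {0..1} (U i \<omega>) * unwarp f (U i \<omega>) + \<epsilon> i \<omega>)" for i
    using U_unit[of i \<omega>] unwarp_G[OF X_unit[OF assms], of f i] by (simp add: G_X[OF assms] w_def indicator_def)
  then show ?thesis
    by (simp add: obs_coeff_def emp_coeff_def emp_def)
qed

lemma scale_square:
  assumes "\<omega> \<in> space M"
  shows "(obs_scale j k n \<omega>)\<^sup>2 = \<sigma>\<^sup>2 / (real n)\<^sup>2 * (\<Sum>i=1..n. (w j k (U i \<omega>))\<^sup>2)" "0 \<le> obs_scale j k n \<omega>"
proof -
  have "per j k (G (X i \<omega>)) = w j k (U i \<omega>)" for i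
    using U_unit[of i \<omega>] by (simp add: G_X[OF assms] w_def indicator_def)
  then show "(obs_scale j k n \<omega>)\<^sup>2 = \<sigma>\<^sup>2 / (real n)\<^sup>2 * (\<Sum>i=1..n. (w j k (U i \<omega>))\<^sup>2)" "0 \<le> obs_scale j k n \<omega>"
    by (simp_all add: obs_scale_def emp_scale_def sum_nonneg)
qed

lemma scaled_noise_eq:
  assumes "\<omega> \<in> space M" "0 < n"
  shows "scaled_noise j k n \<omega> = real n * (obs_scale j k n \<omega>)\<^sup>2"
  using assms(2) by (simp add: scale_square(1)[OF assms(1)] scaled_noise_def power2_eq_square[of "real n"])

text \<open>A vanishing noise level forces all wavelet values at the design points to be zero. This
  discharges the side condition for \<open>\<gamma> = 0\<close> in
  \<open>posterior_median_risk\<close>.\<close>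

lemma coeff_zero:
  assumes "\<omega> \<in> space M" "0 < n" "obs_scale j k n \<omega> = 0"
  shows "obs_coeff f j k n \<omega> = 0"
proof -
  have "(\<Sum>i=1..n. (w j k (U i \<omega>))\<^sup>2) = 0"
    using scale_square(1)[OF assms(1), of j k n] assms \<sigma> by simp
  then have "\<forall>i\<in>{1..n}. w j k (U i \<omega>) = 0"
    by (subst (asm) sum_nonneg_eq_0_iff) auto
  then show ?thesis
    by (simp add: coeff_eq_emp[OF assms(1)] emp_def)
qed

lemma bias_const_nonneg: "0 \<le> bias_const s"
  using s N_nonneg powr_less_mono[of "- (2 * s)" 0 2] by (simp add: bias_const_def)

text \<open>The factor \<open>gdens t / m\<^sub>g \<ge> 1\<close> is inserted to replace Lebesgue
  measure by the law of the design, which \<open>F\<close> maps to the uniform law; then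
  \<open>per_loss\<close> applies.\<close>

lemma loss_le:
  assumes h: "unwarp f \<in> besov_ball \<phi> \<psi> s R" and n: "- 2 \<le> J n"
  shows "(\<integral>\<^sup>+t\<in>{0..1}. ennreal ((fhat n f \<omega> t - f t)\<^sup>2) \<partial>lborel) \<le>
    ennreal (1 / m\<^sub>g * (2 * D\<^sub>0 * (\<Sum>j\<in>{-1..\<lfloor>J n\<rfloor>}. \<Sum>k\<in>pos j.
        (post_median f j k n \<omega> - wavelet_coeff \<phi> \<psi> (unwarp f) j k)\<^sup>2)
      + 2 * (bias_const s * R\<^sup>2 * 2 powr (- (2 * s) * J n))))"
proof -
  let ?h = "unwarp f" and ?K = "{-1..\<lfloor>J n\<rfloor>}"
  have K: "{j. - 1 \<le> j \<and> real_of_int j \<le> J n} = ?K"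
    by (auto simp: le_floor_iff)
  have hsi: "square_integrable (restrict_space lborel {0..1}) ?h"
    using h by (simp add: besov_ball_def)
  define v where "v x = indicator {0..1} x * (?h x - (\<Sum>j\<in>?K. \<Sum>k\<in>pos j. post_median f j k n \<omega> * per j k x))" for x
  have v: "square_integrable lborel v"
    unfolding v_def by (intro residual_square_integrable hsi) auto
  then have [measurable]: "v \<in> borel_measurable borel"
    by (simp add: square_integrable_def)
  have "(\<integral>\<^sup>+t\<in>{0..1}. ennreal ((fhat n f \<omega> t - f t)\<^sup>2) \<partial>lborel) \<le>
      (\<integral>\<^sup>+t. ennreal (1 / m\<^sub>g) * (ennreal (gdens t) * ennreal ((v (F t))\<^sup>2)) \<partial>lborel)"
  proof (rule nn_integral_mono)
    fix t :: real
    show "ennreal ((fhat n f \<omega> t - f t)\<^sup>2) * indicator {0..1} t \<le>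
        ennreal (1 / m\<^sub>g) * (ennreal (gdens t) * ennreal ((v (F t))\<^sup>2))"
    proof (cases "t \<in> {0..1}")
      case True
      have "(fhat n f \<omega> t - f t)\<^sup>2 = (v (F t))\<^sup>2"
      proof -
        have "fhat n f \<omega> t = (\<Sum>j\<in>?K. \<Sum>k\<in>pos j. post_median f j k n \<omega> * per j k (F t))"
          unfolding fhat_def warped_estimator_def Let_def K G_eq_F[OF True, symmetric]
          by (simp add: post_median_def obs_scale_def obs_coeff_def)
        moreover have "f t = ?h (F t)"
          using unwarp_G[OF True, of f] G_eq_F[OF True] by simp
        ultimately show ?thesis
          using F_bounds[of t] by (simp add: v_def power2_commute)
      qed
      moreover have "(v (F t))\<^sup>2 \<le> 1 / m\<^sub>g * (gdens t * (v (F t))\<^sup>2)"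
      proof -
        have "1 * (v (F t))\<^sup>2 \<le> (gdens t / m\<^sub>g) * (v (F t))\<^sup>2"
          using True m\<^sub>g by (intro mult_right_mono) (auto simp: gdens_def)
        then show ?thesis by simp
      qed
      ultimately show ?thesis
        using True m\<^sub>g by (simp add: gdens_nonneg flip: ennreal_mult)
    qed simp
  qed
  also have "\<dots> = ennreal (1 / m\<^sub>g) * (\<integral>\<^sup>+t. ennreal (gdens t) * ennreal ((v (F t))\<^sup>2) \<partial>lborel)"
    by (rule nn_integral_cmult) measurable
  also have "(\<integral>\<^sup>+t. ennreal (gdens t) * ennreal ((v (F t))\<^sup>2) \<partial>lborel) = (\<integral>\<^sup>+\<omega>. ennreal ((v (U 0 \<omega>))\<^sup>2) \<partial>M)"
    using distributed_nn_integral[OF X_distributed, of "\<lambda>t. ennreal ((v (F t))\<^sup>2)" 0] by (simp add: U_def)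
  also have "\<dots> = (\<integral>\<^sup>+x. ennreal ((v x)\<^sup>2) \<partial>lborel)"
  proof -
    have "(\<integral>\<^sup>+\<omega>. ennreal ((v (U 0 \<omega>))\<^sup>2) \<partial>M) =
        (\<integral>\<^sup>+x. ennreal (indicator {0..1} x) * ennreal ((v x)\<^sup>2) \<partial>lborel)"
      by (rule nn_integral_U) measurable
    also have "\<dots> = (\<integral>\<^sup>+x. ennreal ((v x)\<^sup>2) \<partial>lborel)"
      by (intro nn_integral_cong) (auto simp: v_def indicator_def)
    finally show ?thesis .
  qed
  also have "\<dots> = ennreal (LINT x|lborel. (v x)\<^sup>2)"
    using v by (intro nn_integral_eq_integral) (auto simp: square_integrable_def)
  also have "ennreal (1 / m\<^sub>g) * \<dots> = ennreal (1 / m\<^sub>g * (LINT x|lborel. (v x)\<^sup>2))"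
    using m\<^sub>g by (intro ennreal_mult[symmetric]) auto
  also have "\<dots> \<le> ennreal (1 / m\<^sub>g * (2 * D\<^sub>0 * (\<Sum>j\<in>?K. \<Sum>k\<in>pos j.
        (post_median f j k n \<omega> - wavelet_coeff \<phi> \<psi> ?h j k)\<^sup>2)
      + 2 * (bias_const s * R\<^sup>2 * 2 powr (- (2 * s) * J n))))"
  proof (intro ennreal_leI mult_left_mono)
    have m: "- 2 \<le> \<lfloor>J n\<rfloor>" using n by (simp add: le_floor_iff)
    \<comment> \<open>The first omitted integer level lies above the real cut-off
      \<open>J n\<close>, so rounding down only helps.\<close>
    have "2 powr (- (2 * s) * real_of_int (\<lfloor>J n\<rfloor> + 1)) \<le> 2 powr (- (2 * s) * J n)"
    proof (rule powr_mono)
      have "J n \<le> real_of_int (\<lfloor>J n\<rfloor> + 1)" by linarith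
      then show "- (2 * s) * real_of_int (\<lfloor>J n\<rfloor> + 1) \<le> - (2 * s) * J n"
        using s by simp
    qed simp
    then have "bias_const s * R\<^sup>2 * 2 powr (- (2 * s) * real_of_int (\<lfloor>J n\<rfloor> + 1)) \<le>
        bias_const s * R\<^sup>2 * 2 powr (- (2 * s) * J n)"
      using bias_const_nonneg by (intro mult_left_mono) auto
    then show "(LINT x|lborel. (v x)\<^sup>2) \<le> 2 * D\<^sub>0 * (\<Sum>j\<in>?K. \<Sum>k\<in>pos j.
        (post_median f j k n \<omega> - wavelet_coeff \<phi> \<psi> ?h j k)\<^sup>2)
      + 2 * (bias_const s * R\<^sup>2 * 2 powr (- (2 * s) * J n))"
      using per_loss[OF h s m, of "\<lambda>j k. post_median f j k n \<omega>"] unfolding v_def D\<^sub>0_def by linarith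
  qed (use m\<^sub>g in simp)
  finally show ?thesis .
qed

section \<open>The cut-off level and the logarithmic factors\<close>

text \<open>Everything follows from \<open>2 powr (J n * \<alpha>) = 2 n / 3\<close>. Positivity of
  \<open>J n\<close> uses \<open>2 n / 3 > 1\<close>, which is why \<open>n\<close> starts at
  2.\<close>

lemma cutoff:
  assumes n: "2 \<le> n"
  shows "2 powr J n = (2 * real n / 3) powr (1 / \<alpha>)" "2 powr J n \<le> real n powr (1 / \<alpha>)"
    "2 powr (J n * \<alpha>) \<le> real n" "0 < J n" "2 powr J n \<le> real n"
proof -
  have "3 / (2 * real n) = (2 * real n / 3) powr (- 1)"
    using n by (simp add: powr_minus_divide)
  then have "2 powr J n = ((2 * real n / 3) powr (- 1)) powr (- 1 / \<alpha>)"
    using J[of n] n by simp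
  then show eq: "2 powr J n = (2 * real n / 3) powr (1 / \<alpha>)"
    unfolding powr_powr by simp
  show "2 powr J n \<le> real n powr (1 / \<alpha>)"
    unfolding eq using n \<alpha> by (intro powr_mono2) auto
  also have "\<dots> \<le> real n powr 1"
    using n \<alpha> by (intro powr_mono) auto
  finally show "2 powr J n \<le> real n"
    using n by simp
  have "2 powr (J n * \<alpha>) = 2 * real n / 3"
    unfolding powr_powr[symmetric] eq using n \<alpha> by (simp add: powr_powr)
  then show "2 powr (J n * \<alpha>) \<le> real n" using n by simp
  have "1 < (2 * real n / 3) powr (1 / \<alpha>)"
    using n \<alpha> by (intro gr_one_powr) auto
  then show "0 < J n"
    unfolding eq[symmetric] using powr_less_cancel_iff[of 2 0 "J n"] by simp
qed

lemma level:
  assumes n: "2 \<le> n" and j: "real_of_int j \<le> J n"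
  shows "2 powr j \<le> 2 powr J n" "2 powr j \<le> real n" "c\<^sub>1 \<le> real n * (\<tau> j)\<^sup>2"
proof -
  show le: "2 powr j \<le> 2 powr J n"
    using j by simp
  then show "2 powr j \<le> real n"
    using cutoff(5)[OF n] by linarith
  have "2 powr (j * \<alpha>) \<le> 2 powr (J n * \<alpha>)"
    using j \<alpha> by (intro powr_mono mult_right_mono) auto
  then have "2 powr (j * \<alpha>) \<le> real n"
    using cutoff(3)[OF n] by linarith
  then have "c\<^sub>1 * 1 \<le> c\<^sub>1 * (real n * 2 powr (- (j * \<alpha>)))"
    using c\<^sub>1 by (intro mult_left_mono) (auto simp: powr_minus divide_simps)
  then show "c\<^sub>1 \<le> real n * (\<tau> j)\<^sup>2"
    by (simp add: \<tau>_square algebra_simps)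
qed

text \<open>The fixed terms are divided by \<open>ln 2\<close> to become multiples of
  \<open>ln n\<close>. The summand \<open>\<beta> / \<alpha>\<close> reflects that
  \<open>1 / p j\<close> grows at most like \<open>n powr (\<beta> / \<alpha>)\<close>, and the
  final 1 that \<open>n \<tau>\<^sup>2\<close> is at most a constant times \<open>n\<close>.\<close>

definition "log_const = (1 + ln (2 * (1 + 1 / c\<^sub>2)) + ln (1 + c\<^sub>1 * 2 powr \<alpha>)) / ln 2 + \<beta> / \<alpha> + 1"

lemma log_bound:
  assumes n: "2 \<le> n" and j: "-1 \<le> j" "real_of_int j \<le> J n"
  shows "ln (2 / p j) + ln (1 + real n * (\<tau> j)\<^sup>2) \<le> log_const * ln (real n)"
    "1 \<le> log_const * ln (real n)"
proof -
  have ln2: "0 < ln (2::real)" "ln 2 \<le> ln (real n)" using n by auto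
  \<comment> \<open>The reciprocal of a minimum is a maximum of reciprocals, bounded here by their
    sum.\<close>
  have "1 / p j \<le> 1 + 1 / (c\<^sub>2 * 2 powr (- (j * \<beta>)))"
    using c\<^sub>2 by (auto simp: p_def min_def)
  also have "1 / (c\<^sub>2 * 2 powr (- (j * \<beta>))) = 1 / c\<^sub>2 * (2 powr j) powr \<beta>"
    by (simp add: powr_minus powr_powr divide_simps)
  also have "\<dots> \<le> 1 / c\<^sub>2 * (real n powr (1 / \<alpha>)) powr \<beta>"
    using c\<^sub>2 \<beta> order_trans[OF level(1)[OF n j(2)] cutoff(2)[OF n]]
    by (intro mult_left_mono powr_mono2) simp_all
  also have "(real n powr (1 / \<alpha>)) powr \<beta> = real n powr (\<beta> / \<alpha>)"
    by (simp add: powr_powr)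
  also have "1 + 1 / c\<^sub>2 * real n powr (\<beta> / \<alpha>) \<le> (1 + 1 / c\<^sub>2) * real n powr (\<beta> / \<alpha>)"
    using n \<beta> \<alpha> by (simp add: algebra_simps ge_one_powr_ge_zero)
  finally have "2 / p j \<le> 2 * (1 + 1 / c\<^sub>2) * real n powr (\<beta> / \<alpha>)"
    by (simp add: algebra_simps)
  then have "ln (2 / p j) \<le> ln (2 * (1 + 1 / c\<^sub>2) * real n powr (\<beta> / \<alpha>))"
    using p_bounds(1)[of j] by (intro ln_mono) auto
  also have "\<dots> = ln (2 * (1 + 1 / c\<^sub>2)) + \<beta> / \<alpha> * ln (real n)"
    using c\<^sub>2 n by (subst ln_mult_pos) (auto simp: ln_powr add_pos_pos)
  finally have 1: "ln (2 / p j) \<le> ln (2 * (1 + 1 / c\<^sub>2)) + \<beta> / \<alpha> * ln (real n)" .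
  have "1 + real n * (\<tau> j)\<^sup>2 \<le> real n * (1 + c\<^sub>1 * 2 powr \<alpha>)"
  proof -
    \<comment> \<open>The worst case is the scaling level \<open>j = -1\<close>.\<close>
    have "2 powr (- (j * \<alpha>)) \<le> 2 powr \<alpha>"
    proof (rule powr_mono)
      have "- real_of_int j * \<alpha> \<le> 1 * \<alpha>" using j(1) \<alpha> by (intro mult_right_mono) auto
      then show "- (j * \<alpha>) \<le> \<alpha>" by simp
    qed simp
    then have "real n * (c\<^sub>1 * 2 powr (- (j * \<alpha>))) \<le> real n * (c\<^sub>1 * 2 powr \<alpha>)"
      using c\<^sub>1 by (intro mult_left_mono) auto
    then show ?thesis using n by (simp add: \<tau>_square algebra_simps)
  qed
  then have "ln (1 + real n * (\<tau> j)\<^sup>2) \<le> ln (real n * (1 + c\<^sub>1 * 2 powr \<alpha>))"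
    by (intro ln_mono) (auto intro: add_pos_nonneg)
  also have "\<dots> = ln (real n) + ln (1 + c\<^sub>1 * 2 powr \<alpha>)"
    using n c\<^sub>1 by (intro ln_mult_pos) (auto intro: add_pos_nonneg)
  finally have 2: "ln (1 + real n * (\<tau> j)\<^sup>2) \<le> ln (real n) + ln (1 + c\<^sub>1 * 2 powr \<alpha>)" .
  define a where "a = 1 + ln (2 * (1 + 1 / c\<^sub>2)) + ln (1 + c\<^sub>1 * 2 powr \<alpha>)"
  have a: "1 \<le> a"
    using c\<^sub>1 c\<^sub>2 by (auto simp: a_def intro!: add_nonneg_nonneg ln_ge_zero)
  have "a \<le> a / ln 2 * ln (real n)"
    using ln2 a mult_left_mono[of "ln 2" "ln (real n)" "a / ln 2"] by simp
  moreover have eq: "log_const * ln (real n) = a / ln 2 * ln (real n) + \<beta> / \<alpha> * ln (real n) + ln (real n)"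
    by (simp add: log_const_def a_def algebra_simps)
  ultimately show "ln (2 / p j) + ln (1 + real n * (\<tau> j)\<^sup>2) \<le> log_const * ln (real n)"
    using 1 2 by (simp add: a_def)
  have "0 \<le> \<beta> / \<alpha> * ln (real n)" using \<beta> \<alpha> n by simp
  then show "1 \<le> log_const * ln (real n)"
    using eq a ln2 \<open>a \<le> a / ln 2 * ln (real n)\<close> by linarith
qed


section \<open>Expected error of one level\<close>

text \<open>\<open>CQ\<close> bounds the second moment of \<open>scaled_noise\<close>,
  \<open>CH\<close> the squared norm of the unwarped function, and \<open>CE\<close> is the constant
  of \<open>emp_deviation_sum\<close>. \<open>A1\<close> and \<open>A2\<close> collect the factors
  of the variance and of the shrinkage contribution.\<close>

definition "CQ = \<sigma> ^ 4 * (2 * B1\<^sup>2 * D\<^sub>0 + 2 * D\<^sub>0\<^sup>2)"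
definition "CH = bias_const s * R\<^sup>2 * 2 powr (2 * s)"
definition "CE = 2 * B1\<^sup>2 * CH + 4 * \<sigma>\<^sup>2 * D\<^sub>0"
definition "C1 K = 4 * K\<^sup>2 + 16 + 16 / c\<^sub>1"
definition "A1 K = C1 K * log_const * (1 + CQ) * 2 + 10 * CE / ln 2"
definition "A2 = 8 * CQ * R\<^sup>2 / c\<^sub>1\<^sup>2"

text \<open>An integrable majorant of the squared error of one coefficient; expectations are
  computed for it and never for the posterior median.\<close>

definition "coeff_bound K f j k n \<omega> =
  C1 K * (log_const * ln (real n) / real n) * (1 + (scaled_noise j k n \<omega>)\<^sup>2) +
  10 * (emp (unwarp f) j k n \<omega> - wavelet_coeff \<phi> \<psi> (unwarp f) j k)\<^sup>2 +
  8 * (wavelet_coeff \<phi> \<psi> (unwarp f) j k)\<^sup>2 * (scaled_noise j k n \<omega>)\<^sup>2 / (real n * (\<tau> j)\<^sup>2)\<^sup>2"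

lemma CQ_nonneg: "0 \<le> CQ"
  using D\<^sub>0_nonneg by (simp add: CQ_def)

lemma CE_nonneg: "0 \<le> CE"
  using D\<^sub>0_nonneg bias_const_nonneg by (simp add: CE_def CH_def)

lemma C1_nonneg: "0 \<le> C1 K"
  using c\<^sub>1 by (simp add: C1_def)

lemma log_const_nonneg: "0 \<le> log_const"
proof -
  have "0 \<le> ln (2 * (1 + 1 / c\<^sub>2))" "0 \<le> ln (1 + c\<^sub>1 * 2 powr \<alpha>)" "0 \<le> \<beta> / \<alpha>"
    using c\<^sub>1 c\<^sub>2 \<beta> \<alpha> by (auto intro!: ln_ge_zero)
  then show ?thesis by (simp add: log_const_def)
qed

lemma A1_nonneg: "0 \<le> A1 K"
  using C1_nonneg log_const_nonneg CQ_nonneg CE_nonneg by (simp add: A1_def)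

lemma A2_nonneg: "0 \<le> A2"
  using CQ_nonneg c\<^sub>1 by (simp add: A2_def)

lemma post_median_le_coeff_bound:
  assumes K: "0 \<le> K"
    "\<And>y. 1 / 2 \<le> y \<Longrightarrow> y < 1 \<Longrightarrow> - K \<le> the_inv std_normal_cdf y"
    "\<And>y. 1 / 2 \<le> y \<Longrightarrow> y \<le> 3 / 4 \<Longrightarrow> the_inv std_normal_cdf y \<le> K"
    and n: "2 \<le> n" and j: "-1 \<le> j" "real_of_int j \<le> J n" and \<omega>: "\<omega> \<in> space M"
  shows "(post_median f j k n \<omega> - wavelet_coeff \<phi> \<psi> (unwarp f) j k)\<^sup>2 \<le> coeff_bound K f j k n \<omega>"
proof -
  have n0: "0 < n" "0 < real n" using n by auto
  show ?thesis
    unfolding post_median_def coeff_bound_def C1_def coeff_eq_emp[OF \<omega>, symmetric]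
    by (rule posterior_median_risk[OF K \<tau>_pos scale_square(2)[OF \<omega>] coeff_zero[OF \<omega> n0(1)] p_bounds
        n0(2) c\<^sub>1 level(3)[OF n j(2)] scaled_noise_eq[OF \<omega> n0(1)] log_bound[OF n j]])
qed

text \<open>The three terms are summed over \<open>k\<close> by three means: counting positions,
  \<open>emp_deviation_sum\<close>, and the Besov bound for the level.\<close>

lemma coeff_bound_expectation:
  assumes f: "unwarp f \<in> besov_ball \<phi> \<psi> s R" and n: "2 \<le> n"
    and j: "-1 \<le> j" "real_of_int j \<le> J n"
  shows "\<And>k. k \<in> pos j \<Longrightarrow> integrable M (coeff_bound K f j k n)"
    and "(\<Sum>k\<in>pos j. expectation (coeff_bound K f j k n)) \<le>
      A1 K * (ln (real n) * 2 powr j / real n) + A2 * (2 powr (2 * (\<alpha> - s) * j) / (real n)\<^sup>2)"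
proof -
  let ?h = "unwarp f"
  let ?c = "\<lambda>k. wavelet_coeff \<phi> \<psi> ?h j k"
  let ?\<Lambda> = "log_const * ln (real n)"
  let ?t = "(real n * (\<tau> j)\<^sup>2)\<^sup>2"
  have h: "square_integrable (restrict_space lborel {0..1}) ?h"
    using f by (simp add: besov_ball_def)
  have n0: "0 < n" "0 < real n" using n by auto
  have ln2: "0 < ln (2::real)" "ln 2 \<le> ln (real n)" using n by auto
  note lev = level[OF n j(2)]
  have Q: "integrable M (\<lambda>\<omega>. (scaled_noise j k n \<omega>)\<^sup>2)" "expectation (\<lambda>\<omega>. (scaled_noise j k n \<omega>)\<^sup>2) \<le> CQ"
    if "k \<in> pos j" for k
    using scaled_noise_moment[OF j(1) that n0(1) lev(2)] by (auto simp: square_integrable_def CQ_def)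
  have E: "integrable M (\<lambda>\<omega>. (emp ?h j k n \<omega> - ?c k)\<^sup>2)" if "k \<in> pos j" for k
    using emp_deviation(1)[OF j(1) that n0(1) h] by (simp add: square_integrable_def)
  show int: "integrable M (coeff_bound K f j k n)" if "k \<in> pos j" for k
    unfolding coeff_bound_def using Q(1)[OF that] E[OF that] by auto
  have exp: "expectation (coeff_bound K f j k n) \<le> C1 K * (?\<Lambda> / real n) * (1 + CQ) +
      10 * expectation (\<lambda>\<omega>. (emp ?h j k n \<omega> - ?c k)\<^sup>2) + 8 * CQ / ?t * (?c k)\<^sup>2" if k: "k \<in> pos j" for k
  proof -
    have "expectation (coeff_bound K f j k n) =
       C1 K * (?\<Lambda> / real n) * (1 + expectation (\<lambda>\<omega>. (scaled_noise j k n \<omega>)\<^sup>2)) +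
       10 * expectation (\<lambda>\<omega>. (emp ?h j k n \<omega> - ?c k)\<^sup>2) +
       8 * (?c k)\<^sup>2 / ?t * expectation (\<lambda>\<omega>. (scaled_noise j k n \<omega>)\<^sup>2)"
      unfolding coeff_bound_def using Q(1)[OF k] E[OF k] by (simp add: prob_space)
    also have "\<dots> \<le> C1 K * (?\<Lambda> / real n) * (1 + CQ) +
       10 * expectation (\<lambda>\<omega>. (emp ?h j k n \<omega> - ?c k)\<^sup>2) + 8 * (?c k)\<^sup>2 / ?t * CQ"
      using Q(2)[OF k] C1_nonneg log_const_nonneg n0 by (intro add_mono mult_left_mono) auto
    finally show ?thesis by (simp add: mult_ac)
  qed
  note card = card_pos_le[OF j(1)]
  \<comment> \<open>With \<open>m = -2\<close> the expansion in \<open>per_bias\<close> is empty and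
    \<open>h\<close> itself remains.\<close>
  have H: "(LINT x|lborel. (indicator {0..1} x * ?h x)\<^sup>2) \<le> CH"
    using per_bias[OF f s, of "-2"] by (simp add: CH_def)
  \<comment> \<open>The fourth power of \<tau> in the denominator contributes
    \<open>2 powr (2 * \<alpha> * j)\<close>, the Besov decay
    \<open>2 powr (- (2 * s) * j)\<close>.\<close>
  have t: "8 * CQ / ?t * (R\<^sup>2 * 2 powr (- (2 * s) * j)) = A2 * (2 powr (2 * (\<alpha> - s) * j) / (real n)\<^sup>2)"
  proof -
    have "2 powr (2 * (\<alpha> - s) * j) * (2 powr (- (j * \<alpha>)))\<^sup>2 = 2 powr (- (2 * s) * j)"
      unfolding power2_eq_square powr_add[symmetric] by (simp add: algebra_simps)
    then show ?thesis
      using n0 c\<^sub>1 unfolding \<tau>_square A2_def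
      by (simp add: power_mult_distrib divide_simps)
  qed
  have "(\<Sum>k\<in>pos j. expectation (coeff_bound K f j k n)) \<le>
    (\<Sum>k\<in>pos j. C1 K * (?\<Lambda> / real n) * (1 + CQ) +
      10 * expectation (\<lambda>\<omega>. (emp ?h j k n \<omega> - ?c k)\<^sup>2) + 8 * CQ / ?t * (?c k)\<^sup>2)"
    by (intro sum_mono exp)
  also have "\<dots> = C1 K * (?\<Lambda> / real n) * (1 + CQ) * card (pos j) +
      10 * (\<Sum>k\<in>pos j. expectation (\<lambda>\<omega>. (emp ?h j k n \<omega> - ?c k)\<^sup>2)) + 8 * CQ / ?t * (\<Sum>k\<in>pos j. (?c k)\<^sup>2)"
    by (simp add: sum.distrib sum_distrib_left)
  also have "\<dots> \<le> C1 K * (?\<Lambda> / real n) * (1 + CQ) * (2 * 2 powr j) +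
      10 * (CE * (2 powr j / real n)) + 8 * CQ / ?t * (R\<^sup>2 * 2 powr (- (2 * s) * j))"
    using emp_deviation_sum[OF j(1) n0(1) h H] besov_level[OF f j(1)] card C1_nonneg[of K] log_const_nonneg CQ_nonneg n0
    unfolding CE_def[symmetric] by (intro add_mono mult_left_mono) auto
  also have "\<dots> \<le> A1 K * (ln (real n) * 2 powr j / real n) + A2 * (2 powr (2 * (\<alpha> - s) * j) / (real n)\<^sup>2)"
  proof -
    \<comment> \<open>The deviation term carries no logarithm; the factor
      \<open>ln n / ln 2 \<ge> 1\<close> brings it into the form of the first term.\<close>
    have "CE * (2 powr j / real n) * 1 \<le> CE * (2 powr j / real n) * (ln (real n) / ln 2)"
      using ln2 CE_nonneg n0 by (intro mult_left_mono) auto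
    then have "C1 K * (?\<Lambda> / real n) * (1 + CQ) * (2 * 2 powr j) + 10 * (CE * (2 powr j / real n)) \<le>
        C1 K * (?\<Lambda> / real n) * (1 + CQ) * (2 * 2 powr j) + 10 * (CE * (2 powr j / real n) * (ln (real n) / ln 2))"
      by simp
    also have "\<dots> = A1 K * (ln (real n) * 2 powr j / real n)"
      using n0 ln2 by (simp add: A1_def field_simps)
    finally show ?thesis unfolding t by simp
  qed
  finally show "(\<Sum>k\<in>pos j. expectation (coeff_bound K f j k n)) \<le>
      A1 K * (ln (real n) * 2 powr j / real n) + A2 * (2 powr (2 * (\<alpha> - s) * j) / (real n)\<^sup>2)" .
qed

section \<open>Summation over the levels\<close>

definition "variance_rate n = (1 / real n) powr (1 - 1 / \<alpha>) * (ln (real n))\<^sup>2"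
definition "bias_rate n = (1 / real n) powr (2 * s / \<alpha>)"

lemma rates_nonneg: "0 \<le> variance_rate n" "0 \<le> bias_rate n"
  by (simp_all add: variance_rate_def bias_rate_def)

lemma inverse_powr: "0 < n \<Longrightarrow> (1 / real n) powr a = real n powr (- a)"
  by (simp add: powr_divide powr_minus_divide)

lemma variance_sum:
  assumes n: "2 \<le> n"
  shows "(\<Sum>j\<in>{-1..\<lfloor>J n\<rfloor>}. ln (real n) * 2 powr real_of_int j / real n) \<le> 2 / ln 2 * variance_rate n"
proof -
  have ln2: "0 < ln (2::real)" "ln 2 \<le> ln (real n)" "0 \<le> ln (real n)" using n by auto
  have "(\<Sum>j\<in>{-1..\<lfloor>J n\<rfloor>}. 2 powr (1 * real_of_int j)) \<le> 2 powr (1 * real_of_int \<lfloor>J n\<rfloor>) / (1 - 2 powr (- 1))"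
    using cutoff(4)[OF n] by (intro sum_powr_increasing_le) (auto simp: le_floor_iff)
  also have "\<dots> = 2 * 2 powr real_of_int \<lfloor>J n\<rfloor>"
    by (simp add: powr_minus)
  also have "\<dots> \<le> 2 * real n powr (1 / \<alpha>)"
    using order_trans[OF level(1)[OF n of_int_floor_le] cutoff(2)[OF n]] by simp
  finally have S: "(\<Sum>j\<in>{-1..\<lfloor>J n\<rfloor>}. 2 powr real_of_int j) \<le> 2 * real n powr (1 / \<alpha>)" by simp
  have "(\<Sum>j\<in>{-1..\<lfloor>J n\<rfloor>}. ln (real n) * 2 powr real_of_int j / real n) =
      ln (real n) / real n * (\<Sum>j\<in>{-1..\<lfloor>J n\<rfloor>}. 2 powr real_of_int j)"
    by (simp add: sum_distrib_left)
  also have "\<dots> \<le> ln (real n) / real n * (2 * real n powr (1 / \<alpha>))"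
    using S n by (intro mult_left_mono) auto
  also have "\<dots> = 2 * (1 / real n) powr (1 - 1 / \<alpha>) * ln (real n)"
  proof -
    have "(1 / real n) powr (1 - 1 / \<alpha>) = real n powr (1 / \<alpha> - 1)"
      using n by (simp add: inverse_powr)
    also have "\<dots> = real n powr (1 / \<alpha>) / real n"
      using n by (simp add: powr_diff)
    finally show ?thesis by simp
  qed
  \<comment> \<open>The geometric sum yields one logarithm; another factor
    \<open>ln n / ln 2 \<ge> 1\<close> gives the squared logarithm of the rate.\<close>
  also have "\<dots> * 1 \<le> 2 * (1 / real n) powr (1 - 1 / \<alpha>) * ln (real n) * (ln (real n) / ln 2)"
    using ln2 by (intro mult_left_mono) auto
  finally show ?thesis
    by (simp add: variance_rate_def power2_eq_square mult_ac)
qed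

text \<open>For \<open>s = \<alpha>\<close> every summand is \<open>1 / n\<^sup>2\<close> and the
  sum counts levels, at most \<open>3 ln n / ln 2\<close> of them. Otherwise the top level dominates
  and \<open>2\<^sup>J \<le> n powr (1 / \<alpha>)\<close> yields
  \<open>n powr (2 - 2 * s / \<alpha>)\<close> before the division by
  \<open>n\<^sup>2\<close>.\<close>

lemma shrinkage_sum:
  obtains C where "0 \<le> C" "\<And>n. 2 \<le> n \<Longrightarrow>
    (\<Sum>j\<in>{-1..\<lfloor>J n\<rfloor>}. 2 powr (2 * (\<alpha> - s) * real_of_int j) / (real n)\<^sup>2) \<le> C * (variance_rate n + bias_rate n)"
proof (cases "s = \<alpha>")
  case True
  have "(\<Sum>j\<in>{-1..\<lfloor>J n\<rfloor>}. 2 powr (2 * (\<alpha> - s) * real_of_int j) / (real n)\<^sup>2) \<le>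
      3 / (ln 2)\<^sup>2 * (variance_rate n + bias_rate n)" if n: "2 \<le> n" for n
  proof -
    have ln2: "0 < ln (2::real)" "ln 2 \<le> ln (real n)" "0 \<le> ln (real n)" using n by auto
    have J0: "0 < J n" by (rule cutoff(4)[OF n])
    have "ln (2 powr J n) \<le> ln (real n)"
      using cutoff(5)[OF n] by (intro ln_mono) auto
    then have "J n \<le> ln (real n) / ln 2"
      using ln2 by (simp add: ln_powr field_simps)
    moreover have "1 \<le> ln (real n) / ln 2"
      using ln2 by simp
    moreover have "real_of_int \<lfloor>J n\<rfloor> \<le> J n"
      by simp
    moreover have "real (card {-1..\<lfloor>J n\<rfloor>}) = real_of_int \<lfloor>J n\<rfloor> + 2"
      using J0 by simp
    ultimately have card: "real (card {-1..\<lfloor>J n\<rfloor>}) \<le> 3 * (ln (real n) / ln 2)"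
      by linarith
    have "(\<Sum>j\<in>{-1..\<lfloor>J n\<rfloor>}. 2 powr (2 * (\<alpha> - s) * real_of_int j) / (real n)\<^sup>2) =
        real (card {-1..\<lfloor>J n\<rfloor>}) * (1 / (real n)\<^sup>2)"
      by (simp add: True)
    also have "\<dots> \<le> (3 * (ln (real n) / ln 2)) * (1 / real n) powr (1 - 1 / \<alpha>)"
    proof (rule mult_mono[OF card])
      have "(1 / (real n)\<^sup>2) = real n powr (- 2)"
        using n by (simp add: powr_minus_divide)
      also have "\<dots> \<le> real n powr (- (1 - 1 / \<alpha>))"
        using n \<alpha> by (intro powr_mono) auto
      finally show "1 / (real n)\<^sup>2 \<le> (1 / real n) powr (1 - 1 / \<alpha>)"
        using n by (simp add: inverse_powr)
    qed (use ln2 in auto)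
    also have "\<dots> * 1 \<le> (3 * (ln (real n) / ln 2)) * (1 / real n) powr (1 - 1 / \<alpha>) * (ln (real n) / ln 2)"
      using ln2 by (intro mult_left_mono) auto
    also have "\<dots> = 3 / (ln 2)\<^sup>2 * variance_rate n"
      by (simp add: variance_rate_def power2_eq_square)
    also have "\<dots> \<le> 3 / (ln 2)\<^sup>2 * (variance_rate n + bias_rate n)"
      using rates_nonneg by (intro mult_left_mono) auto
    finally show ?thesis by simp
  qed
  then show ?thesis
    by (intro that[of "3 / (ln 2)\<^sup>2"] divide_nonneg_nonneg) simp_all
next
  case False
  then have as: "0 < 2 * (\<alpha> - s)" using \<alpha> by simp
  define q where "q = 1 - 2 powr (- (2 * (\<alpha> - s)))"
  have q: "0 < q"
    using as powr_less_mono[of "- (2 * (\<alpha> - s))" 0 2] by (simp add: q_def)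
  have "(\<Sum>j\<in>{-1..\<lfloor>J n\<rfloor>}. 2 powr (2 * (\<alpha> - s) * real_of_int j) / (real n)\<^sup>2) \<le>
      1 / q * (variance_rate n + bias_rate n)" if n: "2 \<le> n" for n
  proof -
    have "(\<Sum>j\<in>{-1..\<lfloor>J n\<rfloor>}. 2 powr (2 * (\<alpha> - s) * real_of_int j)) \<le> 2 powr (2 * (\<alpha> - s) * real_of_int \<lfloor>J n\<rfloor>) / q"
      unfolding q_def using cutoff(4)[OF n] by (intro sum_powr_increasing_le as) (auto simp: le_floor_iff)
    also have "2 powr (2 * (\<alpha> - s) * real_of_int \<lfloor>J n\<rfloor>) \<le> (real n)\<^sup>2 * bias_rate n"
    proof -
      have "2 powr (2 * (\<alpha> - s) * real_of_int \<lfloor>J n\<rfloor>) \<le> 2 powr (J n * (2 * (\<alpha> - s)))"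
        using as by (intro powr_mono) (auto simp: mult.commute[of "J n"])
      also have "\<dots> = (2 powr J n) powr (2 * (\<alpha> - s))"
        by (simp add: powr_powr)
      also have "\<dots> \<le> (real n powr (1 / \<alpha>)) powr (2 * (\<alpha> - s))"
        using cutoff(2)[OF n] as by (intro powr_mono2) auto
      also have "\<dots> = real n powr (2 + - (2 * s / \<alpha>))"
        unfolding powr_powr using \<alpha> by (intro arg_cong[where f = "\<lambda>x. real n powr x"]) (simp add: field_simps)
      also have "\<dots> = (real n)\<^sup>2 * bias_rate n"
        using n by (simp only: powr_add) (simp add: bias_rate_def inverse_powr)
      finally show ?thesis .
    qed
    finally have "(\<Sum>j\<in>{-1..\<lfloor>J n\<rfloor>}. 2 powr (2 * (\<alpha> - s) * real_of_int j)) \<le> (real n)\<^sup>2 * bias_rate n / q"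
      using q by (simp add: divide_right_mono)
    then have "(\<Sum>j\<in>{-1..\<lfloor>J n\<rfloor>}. 2 powr (2 * (\<alpha> - s) * real_of_int j)) / (real n)\<^sup>2 \<le>
        (real n)\<^sup>2 * bias_rate n / q / (real n)\<^sup>2"
      by (intro divide_right_mono) auto
    also have "\<dots> = bias_rate n / q"
      using n by simp
    also have "\<dots> \<le> 1 / q * (variance_rate n + bias_rate n)"
      using q rates_nonneg by (simp add: divide_right_mono)
    finally show ?thesis by (simp add: sum_divide_distrib)
  qed
  then show ?thesis using q by (intro that[of "1 / q"]) auto
qed

lemma bias_term:
  assumes n: "2 \<le> n"
  shows "2 powr (- (2 * s) * J n) = (3 / 2) powr (2 * s / \<alpha>) * bias_rate n"
proof -
  have "2 powr (- (2 * s) * J n) = (2 powr J n) powr (- (2 * s))"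
    by (simp add: powr_powr mult.commute)
  also have "\<dots> = ((3 / (2 * real n)) powr (- 1 / \<alpha>)) powr (- (2 * s))"
    using n by (simp add: J)
  also have "\<dots> = (3 / 2 * (1 / real n)) powr (2 * s / \<alpha>)"
    unfolding powr_powr by simp
  also have "\<dots> = (3 / 2) powr (2 * s / \<alpha>) * bias_rate n"
    unfolding bias_rate_def by (intro powr_mult)
  finally show ?thesis .
qed

section \<open>The total risk\<close>

lemma risk_bound:
  obtains C where "0 \<le> C" "\<And>n f. 2 \<le> n \<Longrightarrow> unwarp f \<in> besov_ball \<phi> \<psi> s R \<Longrightarrow>
    l2_risk M (fhat n f) f \<le> ennreal (C * (variance_rate n + bias_rate n))"
proof -
  obtain K where K: "0 \<le> K"
    "\<And>y. 1 / 2 \<le> y \<Longrightarrow> y < 1 \<Longrightarrow> - K \<le> the_inv std_normal_cdf y"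
    "\<And>y. 1 / 2 \<le> y \<Longrightarrow> y \<le> 3 / 4 \<Longrightarrow> the_inv std_normal_cdf y \<le> K"
    using std_normal_quantile_bounds by blast
  obtain C\<^sub>S where CS: "0 \<le> C\<^sub>S" "\<And>n. 2 \<le> n \<Longrightarrow>
    (\<Sum>j\<in>{-1..\<lfloor>J n\<rfloor>}. 2 powr (2 * (\<alpha> - s) * real_of_int j) / (real n)\<^sup>2) \<le> C\<^sub>S * (variance_rate n + bias_rate n)"
    using shrinkage_sum by blast
  define CB where "CB = 2 * (bias_const s * R\<^sup>2 * (3 / 2) powr (2 * s / \<alpha>))"
  have CB: "0 \<le> CB" using bias_const_nonneg by (simp add: CB_def)
  define C where "C = 1 / m\<^sub>g * (2 * D\<^sub>0 * (A1 K * (2 / ln 2) + A2 * C\<^sub>S) + CB)"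
  have C: "0 \<le> C"
    using m\<^sub>g D\<^sub>0_nonneg A1_nonneg A2_nonneg CS(1) CB by (simp add: C_def)
  have "l2_risk M (fhat n f) f \<le> ennreal (C * (variance_rate n + bias_rate n))"
    if n: "2 \<le> n" and f: "unwarp f \<in> besov_ball \<phi> \<psi> s R" for n f
  proof -
    let ?K = "{-1..\<lfloor>J n\<rfloor>}"
    let ?b = "2 * (bias_const s * R\<^sup>2 * 2 powr (- (2 * s) * J n))"
    let ?T = "\<lambda>\<omega>. 1 / m\<^sub>g * (2 * D\<^sub>0 * (\<Sum>j\<in>?K. \<Sum>k\<in>pos j. coeff_bound K f j k n \<omega>) + ?b)"
    have J0: "- 2 \<le> J n" using cutoff(4)[OF n] by simp
    have lev: "-1 \<le> j" "real_of_int j \<le> J n" if "j \<in> ?K" for j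
      using that by (auto simp: le_floor_iff)
    have b0: "0 \<le> ?b" using bias_const_nonneg by simp
    have pw: "(\<Sum>j\<in>?K. \<Sum>k\<in>pos j. (post_median f j k n \<omega> - wavelet_coeff \<phi> \<psi> (unwarp f) j k)\<^sup>2)
        \<le> (\<Sum>j\<in>?K. \<Sum>k\<in>pos j. coeff_bound K f j k n \<omega>)" if "\<omega> \<in> space M" for \<omega>
      using lev by (intro sum_mono post_median_le_coeff_bound[OF K n _ _ that]) auto
    have T0: "0 \<le> ?T \<omega>" if "\<omega> \<in> space M" for \<omega>
    proof -
      have "0 \<le> (\<Sum>j\<in>?K. \<Sum>k\<in>pos j. (post_median f j k n \<omega> - wavelet_coeff \<phi> \<psi> (unwarp f) j k)\<^sup>2)"
        by (intro sum_nonneg) auto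
      then have "0 \<le> (\<Sum>j\<in>?K. \<Sum>k\<in>pos j. coeff_bound K f j k n \<omega>)"
        using pw[OF that] by linarith
      then show ?thesis using m\<^sub>g D\<^sub>0_nonneg b0 by simp
    qed
    have int: "integrable M (coeff_bound K f j k n)" if "j \<in> ?K" "k \<in> pos j" for j k
      using coeff_bound_expectation(1)[OF f n lev[OF that(1)] that(2)] .
    have Tint: "integrable M ?T"
      using int by (intro integrable_mult_right Bochner_Integration.integrable_add Bochner_Integration.integrable_sum) auto
    have "l2_risk M (fhat n f) f \<le> (\<integral>\<^sup>+\<omega>. ennreal (?T \<omega>) \<partial>M)"
      unfolding l2_risk_def
    \<comment> \<open>Monotonicity of the nonnegative integral asks for no measurability of the
      actual loss; only the majorant is integrated afterwards.\<close>
    proof (rule nn_integral_mono)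
      fix \<omega> assume \<omega>: "\<omega> \<in> space M"
      show "(\<integral>\<^sup>+t\<in>{0..1}. ennreal ((fhat n f \<omega> t - f t)\<^sup>2) \<partial>lborel) \<le> ennreal (?T \<omega>)"
        using pw[OF \<omega>] m\<^sub>g D\<^sub>0_nonneg
        by (intro order_trans[OF loss_le[OF f J0]] ennreal_leI mult_left_mono add_right_mono) auto
    qed
    also have "\<dots> = ennreal (expectation ?T)"
      using Tint T0 by (intro nn_integral_eq_integral) auto
    also have "\<dots> \<le> ennreal (C * (variance_rate n + bias_rate n))"
    proof (rule ennreal_leI)
      let ?S = "\<Sum>j\<in>?K. \<Sum>k\<in>pos j. expectation (coeff_bound K f j k n)"
      let ?r = "variance_rate n + bias_rate n"
      have Sint: "integrable M (\<lambda>\<omega>. \<Sum>j\<in>?K. \<Sum>k\<in>pos j. coeff_bound K f j k n \<omega>)"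
        using int by (intro Bochner_Integration.integrable_sum) auto
      have "expectation (\<lambda>\<omega>. \<Sum>j\<in>?K. \<Sum>k\<in>pos j. coeff_bound K f j k n \<omega>) = ?S"
        using int by (simp add: Bochner_Integration.integral_sum)
      then have T: "expectation ?T = 1 / m\<^sub>g * (2 * D\<^sub>0 * ?S + ?b)"
        using Sint by (simp add: prob_space)
      have "?S \<le> (\<Sum>j\<in>?K. A1 K * (ln (real n) * 2 powr j / real n) +
          A2 * (2 powr (2 * (\<alpha> - s) * j) / (real n)\<^sup>2))"
        by (intro sum_mono coeff_bound_expectation(2)[OF f n] lev)
      also have "\<dots> = A1 K * (\<Sum>j\<in>?K. ln (real n) * 2 powr j / real n) +
          A2 * (\<Sum>j\<in>?K. 2 powr (2 * (\<alpha> - s) * j) / (real n)\<^sup>2)"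
        by (simp only: sum.distrib sum_distrib_left)
      also have "\<dots> \<le> A1 K * (2 / ln 2 * ?r) + A2 * (C\<^sub>S * ?r)"
      proof (intro add_mono mult_left_mono CS(2)[OF n] A1_nonneg A2_nonneg)
        have "2 / ln 2 * variance_rate n \<le> 2 / ln 2 * ?r"
          using rates_nonneg by (intro mult_left_mono) auto
        then show "(\<Sum>j\<in>?K. ln (real n) * 2 powr j / real n) \<le> 2 / ln 2 * ?r"
          using variance_sum[OF n] by linarith
      qed
      also have "\<dots> = (A1 K * (2 / ln 2) + A2 * C\<^sub>S) * ?r"
        by (simp only: distrib_right mult.assoc)
      finally have S: "?S \<le> (A1 K * (2 / ln 2) + A2 * C\<^sub>S) * ?r" .
      have "?b = CB * bias_rate n"
        unfolding bias_term[OF n] by (simp add: CB_def)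
      also have "\<dots> \<le> CB * ?r"
        using CB rates_nonneg by (intro mult_left_mono) auto
      finally have b: "?b \<le> CB * ?r" .
      have "expectation ?T \<le> 1 / m\<^sub>g * (2 * D\<^sub>0 * ((A1 K * (2 / ln 2) + A2 * C\<^sub>S) * ?r) + CB * ?r)"
        unfolding T using S b m\<^sub>g D\<^sub>0_nonneg by (intro mult_left_mono add_mono) auto
      also have "\<dots> = C * ?r"
        by (simp only: C_def distrib_right mult.assoc)
      finally show "expectation ?T \<le> C * ?r" .
    qed
    finally show ?thesis .
  qed
  with C show ?thesis by (rule that)
qed

end

theorem theorem1:
  fixes M :: "'a measure" and X \<epsilon> :: "nat \<Rightarrow> 'a \<Rightarrow> real"
    and g \<phi> \<psi> :: "real \<Rightarrow> real" and r :: nat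
    and \<sigma> m\<^sub>g \<alpha> \<beta> c\<^sub>1 c\<^sub>2 s R :: real and J :: "nat \<Rightarrow> real"
  defines "G \<equiv> design_cdf g"
    and "\<tau> \<equiv> \<lambda>j::int. sqrt (c\<^sub>1 * 2 powr (- (real_of_int j * \<alpha>)))"
    and "p \<equiv> \<lambda>j::int. min 1 (c\<^sub>2 * 2 powr (- (real_of_int j * \<beta>)))"
  defines "fhat \<equiv> \<lambda>n f \<omega>. warped_estimator \<phi> \<psi> G \<sigma> \<tau> p (J n) n
                      (\<lambda>i. X i \<omega>) (\<lambda>i. f (X i \<omega>) + \<epsilon> i \<omega>)"
  assumes "0 < \<sigma>" and "0 < m\<^sub>g" and "\<forall>x\<in>{0..1}. m\<^sub>g \<le> g x"
    and "random_design M X \<epsilon> g \<sigma>"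
    and "compactly_supported_wavelets \<phi> \<psi>" and "vanishing_moments r \<psi>"
    and "0 \<le> \<alpha>" and "0 \<le> \<beta>" and "0 < c\<^sub>1" and "0 < c\<^sub>2"
    and "\<forall>n\<ge>1. 2 powr J n = (3 / (2 * real n)) powr (- 1 / \<alpha>)"
    and "0 < s" and "s < real r" and "0 < R"
    and "1 < \<alpha>" and "s \<le> \<alpha>"
  shows "\<exists>A B :: nat \<Rightarrow> real.
      A \<in> O(\<lambda>n. (1 / real n) powr (1 - 1 / \<alpha>) * (ln (real n))\<^sup>2) \<and>
      B \<in> O(\<lambda>n. (1 / real n) powr (2 * s / \<alpha>)) \<and>
      (\<forall>\<^sub>F n in sequentially.
        (SUP f\<in>{f. f \<circ> the_inv_into {0..1} G \<in> besov_ball \<phi> \<psi> s R}. l2_risk M (fhat n f) f)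
          = ennreal (A n + B n))"
proof -
  obtain L B where cw: "compact_wavelets \<phi> \<psi> L B"
    using compact_wavelets_exist[OF \<open>compactly_supported_wavelets \<phi> \<psi>\<close>] .
  interpret S: posterior_median_setting \<phi> \<psi> L B M X \<epsilon> g \<sigma> m\<^sub>g \<alpha> \<beta> c\<^sub>1 c\<^sub>2 s R J
  proof (intro posterior_median_setting.intro warped_design.intro warped_design_axioms.intro
      posterior_median_setting_axioms.intro)
    show "m\<^sub>g \<le> g x" if "x \<in> {0..1}" for x
      using \<open>\<forall>x\<in>{0..1}. m\<^sub>g \<le> g x\<close> that by blast
    show "2 powr J n = (3 / (2 * real n)) powr (- 1 / \<alpha>)" if "1 \<le> n" for n
      using \<open>\<forall>n\<ge>1. 2 powr J n = (3 / (2 * real n)) powr (- 1 / \<alpha>)\<close> that by blast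
  qed fact+
  have fhat: "fhat n f = S.fhat n f" for n f
    unfolding fhat_def S.fhat_def \<tau>_def p_def G_def S.\<tau>_def[abs_def] S.p_def[abs_def] by (rule refl)
  obtain C where C: "0 \<le> C" "\<And>n f. 2 \<le> n \<Longrightarrow> S.unwarp f \<in> besov_ball \<phi> \<psi> s R \<Longrightarrow>
    l2_risk M (S.fhat n f) f \<le> ennreal (C * (S.variance_rate n + S.bias_rate n))"
    using S.risk_bound by blast
  define Sup_risk where "Sup_risk n =
    (SUP f\<in>{f. f \<circ> the_inv_into {0..1} G \<in> besov_ball \<phi> \<psi> s R}. l2_risk M (fhat n f) f)" for n
  \<comment> \<open>The supremum has to equal a sum of two sequences. \<open>A\<close> takes as much
    of it as the variance rate permits, and the remainder \<open>B\<close> is then nonnegative and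
    within the bias rate.\<close>
  define A where "A n = min (enn2real (Sup_risk n)) (C * S.variance_rate n)" for n
  define B where "B n = enn2real (Sup_risk n) - A n" for n
  have le: "Sup_risk n \<le> ennreal (C * (S.variance_rate n + S.bias_rate n))" if "2 \<le> n" for n
    unfolding Sup_risk_def using C(2)[OF that] by (intro SUP_least) (auto simp: S.unwarp_def G_def fhat)
  have real_le: "enn2real (Sup_risk n) \<le> C * (S.variance_rate n + S.bias_rate n)" if "2 \<le> n" for n
    using le[OF that] C(1) S.rates_nonneg by (intro enn2real_leI) auto
  have rate: "0 \<le> C * S.variance_rate n" "0 \<le> C * S.bias_rate n" for n
    using C(1) S.rates_nonneg by auto
  have "A \<in> O(S.variance_rate)"
  proof (rule bigoI[of _ C], rule eventually_sequentiallyI[of 2])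
    show "norm (A n) \<le> C * norm (S.variance_rate n)" for n
      using rate[of n] S.rates_nonneg[of n] by (simp add: A_def)
  qed
  moreover have "B \<in> O(S.bias_rate)"
  proof (rule bigoI[of _ C], rule eventually_sequentiallyI[of 2])
    show "norm (B n) \<le> C * norm (S.bias_rate n)" if "2 \<le> n" for n
      using real_le[OF that] rate[of n] S.rates_nonneg[of n] by (simp add: B_def A_def algebra_simps)
  qed
  moreover have "\<forall>\<^sub>F n in sequentially. Sup_risk n = ennreal (A n + B n)"
  proof (rule eventually_sequentiallyI[of 2])
    fix n :: nat assume "2 \<le> n"
    \<comment> \<open>Finiteness makes \<open>enn2real\<close> lossless, so that \<open>A\<close>
      and \<open>B\<close> add up to the supremum exactly.\<close>
    then have "Sup_risk n < top"
      using le[of n] by (simp add: le_less_trans)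
    then show "Sup_risk n = ennreal (A n + B n)"
      by (simp add: B_def)
  qed
  ultimately show ?thesis
    unfolding Sup_risk_def S.variance_rate_def[abs_def] S.bias_rate_def[abs_def] by blast
qed

end
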